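(* For $p\in[0,1]$ let $\pi_p$ be the random growth rule on $\mathbf Z^2$ with neighborhood $\mathcal N=\{(0,0),(\pm1,0),(0,\pm1),(1,-1),(-1,1)\}$ given by: $\pi_p(\varnothing)=0$; $\pi_p(S)=1$ if $(0,0)\in S$ or if at least one of the four conditions $(-1,0)\in S$, $(1,0)\in S$, $\{(1,-1),(0,-1)\}\subset S$, $\{(-1,1),(0,1)\}\subset S$ is satisfied; and $\pi_p(S)=p$ for all other nonempty $S\subset\mathcal N$. Then for every $p\in[0,1]$ this rule has an asymptotic shape $L_p$, which is symmetric about the origin ($L_p=-L_p$) and whose top half $L_p\cap\{(x,y)\in\mathbf R^2:y\ge0\}$ consists of exactly the points $(x,y)$ with $$-\phi(y)\le x\le\phi(y)-y\ \text{ if } p\le y\le y_0,\qquad -1\le x\le1-y\ \text{ if }0\le y\le p,$$ where $$\phi(y)=1-p-(1-2p)y+2\sqrt{p(1-p)y(1-y)},\qquad y\in[p,1],$$ and $$y_0=y_0(p)=\begin{cases}1,&p\ge1/2,\\[2pt] \dfrac{2(1-p)}{3-\sqrt{8p}},&p<1/2.\end{cases}$$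
   Context: Dynamics. Given an initial set $A_0\subset\mathbf Z^2$ and a rule $\pi:2^{\mathcal N}\to[0,1]$, the random sets $A_1,A_2,\dots$ are generated as follows: given $A_t$, each $x\in\mathbf Z^2$ belongs to $A_{t+1}$ with probability $\pi\big(((x+\mathcal N)\cap A_t)-x\big)$, independently over all $x$ and $t$. Filling space. Let $\pi_d(S)=1$ if $\pi(S)>0$ and $0$ otherwise, and $\mathcal T(A)=\{x\in\mathbf Z^2:\pi_d((A-x)\cap\mathcal N)=1\}$. A set $A$ fills space if $\bigcup_{t\ge0}\mathcal T^t(A)=\mathbf Z^2$. Shape. The rule has asymptotic shape $L$ if $A_t/t\to L$ almost surely in the Hausdorff metric for every finite initial set $A_0$ which fills space. *)

theory Defs
  imports "HOL-Probability.Probability"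
begin

type_synonym site = "int \<times> int"

text \<open>Only the values of a rule on subsets of the neighborhood matter.\<close>

type_synonym rule = "site set \<Rightarrow> real"

definition local_config :: "site set \<Rightarrow> site set \<Rightarrow> site \<Rightarrow> site set" where
  "local_config N A x = (\<lambda>z. z - x) ` (((\<lambda>y. x + y) ` N) \<inter> A)"

definition history :: "'w measure \<Rightarrow> (nat \<Rightarrow> 'w \<Rightarrow> site set) \<Rightarrow> nat \<Rightarrow> 'w set set" where
  "history M A t =
     sigma_sets (space M) {{\<omega> \<in> space M. x \<in> A s \<omega>} | x s. s \<le> t}"

text \<open>The last clause says that, conditionally on the past \<open>A\<^sub>0, \<dots>, A\<^sub>t\<close>, the events
  \<open>x \<in> A\<^sub>t\<^sub>+\<^sub>1\<close> are independent over \<open>x\<close> with probabilities given by the rule: the product is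
  the conditional probability of \<open>X \<subseteq> A\<^sub>t\<^sub>+\<^sub>1\<close>, expressed by integrating over an arbitrary
  event \<open>E\<close> of the past. These events, for finite \<open>X\<close>, determine the conditional law of the
  random set \<open>A\<^sub>t\<^sub>+\<^sub>1\<close>.\<close>

definition growth_process ::
  "site set \<Rightarrow> rule \<Rightarrow> site set \<Rightarrow> 'w measure \<Rightarrow> (nat \<Rightarrow> 'w \<Rightarrow> site set) \<Rightarrow> bool" where
  "growth_process N \<pi> A0 M A \<longleftrightarrow>
     prob_space M \<and>
     (\<forall>\<omega>\<in>space M. A 0 \<omega> = A0) \<and>
     (\<forall>t x. {\<omega> \<in> space M. x \<in> A t \<omega>} \<in> sets M) \<and>
     (\<forall>t X E. finite X \<longrightarrow> E \<in> history M A t \<longrightarrow>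
        measure M (E \<inter> {\<omega> \<in> space M. X \<subseteq> A (Suc t) \<omega>}) =
        (LINT \<omega>:E|M. (\<Prod>x\<in>X. \<pi> (local_config N (A t \<omega>) x))))"

definition det_rule :: "rule \<Rightarrow> rule" where
  "det_rule \<pi> S = (if \<pi> S > 0 then 1 else 0)"

definition det_step :: "site set \<Rightarrow> rule \<Rightarrow> site set \<Rightarrow> site set" where
  "det_step N \<pi> A = {x. det_rule \<pi> ((\<lambda>z. z - x) ` A \<inter> N) = 1}"

definition fills_space :: "site set \<Rightarrow> rule \<Rightarrow> site set \<Rightarrow> bool" where
  "fills_space N \<pi> A \<longleftrightarrow> (\<Union>t. (det_step N \<pi> ^^ t) A) = UNIV"

text \<open>Valued in \<^typ>\<open>ennreal\<close>, so that empty and unbounded sets need no separate treatment.\<close>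

definition hausdorff_distance :: "'a::metric_space set \<Rightarrow> 'a set \<Rightarrow> ennreal" where
  "hausdorff_distance S T =
     max (SUP a\<in>S. INF b\<in>T. ennreal (dist a b)) (SUP b\<in>T. INF a\<in>S. ennreal (dist a b))"

definition scaled :: "nat \<Rightarrow> site set \<Rightarrow> (real \<times> real) set" where
  "scaled t A = (\<lambda>(x, y). (real_of_int x / real t, real_of_int y / real t)) ` A"

text \<open>The type argument is the type of the underlying sample space. A theorem in which it is
  a type variable covers every realization of the dynamics on every probability space.\<close>

definition has_asymptotic_shape ::
  "'w itself \<Rightarrow> site set \<Rightarrow> rule \<Rightarrow> (real \<times> real) set \<Rightarrow> bool" where
  "has_asymptotic_shape _ N \<pi> L \<longleftrightarrow>
     compact L \<and> L \<noteq> {} \<and>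
     (\<forall>A0 (M :: 'w measure) A.
        finite A0 \<longrightarrow> fills_space N \<pi> A0 \<longrightarrow> growth_process N \<pi> A0 M A \<longrightarrow>
        (AE \<omega> in M. (\<lambda>t. hausdorff_distance (scaled t (A t \<omega>)) L) \<longlonglongrightarrow> 0))"

definition hex_nbhd :: "site set" where
  "hex_nbhd = {(0, 0), (1, 0), (-1, 0), (0, 1), (0, -1), (1, -1), (-1, 1)}"

definition hex_rule :: "real \<Rightarrow> rule" where
  "hex_rule p S =
     (if S = {} then 0
      else if (0, 0) \<in> S \<or> (-1, 0) \<in> S \<or> (1, 0) \<in> S \<or>
              {(1, -1), (0, -1)} \<subseteq> S \<or> {(-1, 1), (0, 1)} \<subseteq> S then 1
      else p)"

definition \<phi> :: "real \<Rightarrow> real \<Rightarrow> real" where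
  "\<phi> p y = 1 - p - (1 - 2 * p) * y + 2 * sqrt (p * (1 - p) * y * (1 - y))"

definition y0 :: "real \<Rightarrow> real" where
  "y0 p = (if p \<ge> 1 / 2 then 1 else 2 * (1 - p) / (3 - sqrt (8 * p)))"

end

(* The edge of an occupied row is a last passage process. As long as the rows are long enough, the
   left end -D(y) of row y in the upper half obeys D'(y) = max (D y + 1) (D (y - 1) + B y) with
   independent Bernoulli variables B, and the right end obeys the same recursion after the
   symmetry (x, y) -> (-x - y, y) of the rule. This recursion is exactly solvable: if v, q satisfy
   v q (1 - p) = p (1 - v), then increments D y - D (y - 1) = V - 1 - U with independent V Bernoulli v
   and U geometric of ratio q form a stationary family (a discrete Burke property), once row 0 is
   driven by a source with steps 1 + geometric. Comparison with these stationary solutions gives for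
   each v a linear upper bound t eta + y (v - eta), eta = 1 / (1 - q), up to exponentially small
   probabilities, and the infimum over v of these bounds is t phi(y / t).

   For the matching lower bound, write the stationary solution started from a random profile as a
   maximum over the row in which the last passage path leaves the initial profile. Exit rows away
   from the characteristic one are ruled out by the upper bound for slightly perturbed v, because
   the optimal v is unique, and the exit rows near it are dominated by a point start with a little
   extra time.

   The set itself is then grown from one point by many short blocks: first a long horizontal
   segment, then segments climbing with slope a. Within a block the segment is so long that its two
   ends do not interact, and its length does not shrink as long as 2 phi(a) > a, that is a < y0. *)

theory Submission
  imports Defs "HOL-Real_Asymp.Real_Asymp"
begin

section \<open>The row process\<close>

text \<open>At row \<open>a * t\<close> the bound with \<open>v = p + w\<close> has speed
  \<open>(1 - a) * (1 - p + p * (1 - p) / w) + a * (p + w)\<close>. It is least at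
  \<open>w^2 = p * (1 - p) * (1 - a) / a\<close>, with value \<open>\<phi> p a\<close>. There
  \<open>v \<le> 1\<close> means \<open>a \<ge> p\<close>; for smaller \<open>a\<close> the choice
  \<open>v = 1\<close> gives 1, hence the vertical stretch of the left edge up to height p. For p <
  1/2 the number \<open>y0 p\<close> solves y = 2 \<phi>(y), the height at which the left and right
  bounds stop being compatible.

  The obstacle is the source in row 0, which the true process lacks. A source only helps, so upper
  bounds are not affected. For lower bounds the target row is placed above the elapsed time:
  information climbs at most one row per step, so the source has not arrived there.

  Last passage paths never appear as objects. The recursion commutes with maxima, so a profile can
  be cut into pieces and each piece run alone. An arbitrary realization enters only through its laws
  at single times, which is all that Borel-Cantelli asks for.\<close>

definition rstep :: "int \<times> (nat \<Rightarrow> bool) \<Rightarrow> (nat \<Rightarrow> int) \<Rightarrow> nat \<Rightarrow> int" where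
  "rstep n D y = (case y of 0 \<Rightarrow> D 0 + fst n
     | Suc j \<Rightarrow> max (D (Suc j) + 1) (D j + of_bool (snd n (Suc j))))"

lemma rstep_0 [simp]: "rstep n D 0 = D 0 + fst n"
  by (simp add: rstep_def)

lemma rstep_Suc [simp]:
  "rstep n D (Suc j) = max (D (Suc j) + 1) (D j + of_bool (snd n (Suc j)))"
  by (simp add: rstep_def)

definition run :: "(int \<times> (nat \<Rightarrow> bool)) list \<Rightarrow> (nat \<Rightarrow> int) \<Rightarrow> nat \<Rightarrow> int" where
  "run ns D = fold rstep ns D"

lemma run_Nil [simp]: "run [] D = D"
  by (simp add: run_def)

lemma run_Cons [simp]: "run (n # ns) D = run ns (rstep n D)"
  by (simp add: run_def)

lemma run_append [simp]: "run (ms @ ns) D = run ns (run ms D)"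
  by (simp add: run_def)

text \<open>Row 0 then advances by exactly one site, as horizontal growth does. The coins are kept,
  which couples the run with and without source.\<close>

definition unsourced :: "int \<times> (nat \<Rightarrow> bool) \<Rightarrow> int \<times> (nat \<Rightarrow> bool)" where
  "unsourced n = (1, snd n)"

lemma unsourced_simps [simp]: "fst (unsourced n) = 1" "snd (unsourced n) = snd n"
  by (simp_all add: unsourced_def)

text \<open>The recursion is linear over (max, +), so each value is inherited from a single initial
  profile. This does the work of last passage paths. Rows above \<open>Y\<close> are left out
  because information never moves down.\<close>

lemma run_cover:
  assumes "\<And>i. i \<le> Y \<Longrightarrow> \<exists>F\<in>\<F>. G i \<le> F i" and "i \<le> Y"
  shows "\<exists>F\<in>\<F>. run ns G i \<le> run ns F i"
  using assms
proof (induction ns arbitrary: G \<F>)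
  case Nil
  then show ?case by simp
next
  case (Cons n ns)
  have "\<exists>F\<in>rstep n ` \<F>. rstep n G j \<le> F j" if jY: "j \<le> Y" for j
  proof (cases j)
    case 0
    then obtain F where "F \<in> \<F>" "G 0 \<le> F 0"
      using Cons.prems(1)[of 0] by auto
    then show ?thesis using 0 by (auto intro!: bexI[of _ F])
  next
    case (Suc k)
    obtain F where F: "F \<in> \<F>" "G (Suc k) \<le> F (Suc k)"
      using Cons.prems(1)[of "Suc k"] Suc jY by auto
    obtain F' where F': "F' \<in> \<F>" "G k \<le> F' k"
      using Cons.prems(1)[of k] Suc jY by auto
    have "rstep n G j \<le> rstep n F j \<or> rstep n G j \<le> rstep n F' j"
      using F(2) F'(2) Suc by (auto simp: max_def)
    with F F' show ?thesis by auto
  qed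
  from Cons.IH[OF this Cons.prems(2)] show ?case by simp
qed

lemma run_mono:
  assumes "\<And>i. i \<le> Y \<Longrightarrow> G i \<le> F i" and "i \<le> Y"
  shows "run ns G i \<le> run ns F i"
  using run_cover[of Y "{F}" G i ns] assms by auto

lemma run_unsourced_le:
  assumes "\<And>n. n \<in> set ns \<Longrightarrow> fst n \<ge> 1"
  shows "run (map unsourced ns) D i \<le> run ns D i"
  using assms
proof (induction ns arbitrary: D)
  case (Cons n ns)
  have "run (map unsourced ns) (rstep (unsourced n) D) i \<le> run (map unsourced ns) (rstep n D) i"
  proof (rule run_mono[where Y = i])
    fix j
    show "rstep (unsourced n) D j \<le> rstep n D j"
      using Cons.prems[of n] by (cases j) auto
  qed simp
  also have "\<dots> \<le> run ns (rstep n D) i"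
    using Cons by auto
  finally show ?case by simp
qed simp

text \<open>Information travels upwards by at most one row per step, so that the source at row 0
  is not felt in rows above the running time.\<close>

lemma run_unsourced_local:
  assumes "length ns < Y" and "\<And>i. i \<le> Y \<Longrightarrow> Y \<le> i + length ns \<Longrightarrow> D i = D' i"
  shows "run (map unsourced ns) D Y = run ns D' Y"
  using assms
proof (induction ns arbitrary: D D')
  case (Cons n ns)
  have "run (map unsourced ns) (rstep (unsourced n) D) Y = run ns (rstep n D') Y"
  proof (rule Cons.IH)
    show "length ns < Y" using Cons.prems by simp
    fix i assume i: "i \<le> Y" "Y \<le> i + length ns"
    then obtain j where j: "i = Suc j" using Cons.prems(1) by (cases i) auto
    have "D i = D' i" "D j = D' j" using Cons.prems(2) i j by auto
    then show "rstep (unsourced n) D i = rstep n D' i" using j by simp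
  qed
  then show ?case by simp
qed simp

lemma run_le:
  assumes "\<And>i. i \<le> Y \<Longrightarrow> D i \<le> c" and "i \<le> Y"
  shows "run (map unsourced ns) D i \<le> c + int (length ns)"
  using assms
proof (induction ns arbitrary: D c)
  case (Cons n ns)
  have step: "rstep (unsourced n) D j \<le> c + 1" if "j \<le> Y" for j
    using Cons.prems(1)[of j] Cons.prems(1)[of "j - 1"] that by (cases j) auto
  show ?case using Cons.IH[of "rstep (unsourced n) D" "c + 1"] step Cons.prems(2) by simp
qed simp

text \<open>In each step one may stay in the row and gain at least 1, or climb one row and lose
  nothing; \<open>i\<close> of the steps are spent climbing.\<close>

lemma run_ge:
  assumes "\<And>n. n \<in> set ns \<Longrightarrow> fst n \<ge> 1" and "i \<le> length ns"
  shows "D j + int (length ns) - int i \<le> run ns D (j + i)"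
  using assms
proof (induction ns arbitrary: D i j)
  case (Cons n ns)
  show ?case
  proof (cases "i \<le> length ns")
    case True
    have "D j + 1 \<le> rstep n D j"
      using Cons.prems(1)[of n] by (cases j) auto
    also have "rstep n D j + int (length ns) - int i \<le> run ns (rstep n D) (j + i)"
      using Cons True by auto
    finally show ?thesis by simp
  next
    case False
    then have i: "i = Suc (length ns)" using Cons.prems by simp
    have "D j \<le> rstep n D (Suc j)" by (auto simp: max_def)
    also have "rstep n D (Suc j) + int (length ns) - int (length ns)
        \<le> run ns (rstep n D) (Suc j + length ns)"
      using Cons.prems by (intro Cons.IH) auto
    finally show ?thesis using i by simp
  qed
qed simp

lemma rstep_shift: "rstep n (\<lambda>i. D i + c) = (\<lambda>i. rstep n D i + c)"
proof
  fix i show "rstep n (\<lambda>i. D i + c) i = rstep n D i + c"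
    by (cases i) auto
qed

lemma run_shift: "run ns (\<lambda>i. D i + c) = (\<lambda>i. run ns D i + c)"
  by (induction ns arbitrary: D) (simp_all add: rstep_shift)

lemma run_row_0: "run ns D 0 = D 0 + sum_list (map fst ns)"
  by (induction ns arbitrary: D) simp_all

section \<open>Profiles and their increments\<close>

definition psum :: "(nat \<Rightarrow> int) \<Rightarrow> nat \<Rightarrow> int" where
  "psum d j = (\<Sum>i = 1..j. d i)"

text \<open>The value 0 outside \<open>{1..Y}\<close> agrees with the default value of the product
  measure \<open>incs\<close>.\<close>

definition inc :: "nat \<Rightarrow> (nat \<Rightarrow> int) \<Rightarrow> nat \<Rightarrow> int" where
  "inc Y D i = (if i \<in> {1..Y} then D i - D (i - 1) else 0)"

lemma psum_0 [simp]: "psum d 0 = 0"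
  by (simp add: psum_def)

lemma psum_Suc [simp]: "psum d (Suc j) = psum d j + d (Suc j)"
  by (simp add: psum_def)

lemma psum_inc: "y \<le> Y \<Longrightarrow> psum (inc Y D) y = D y - D 0"
  by (induction y) (auto simp: inc_def)

lemma run_psum_inc:
  assumes "i \<le> Y"
  shows "run ns D i = run ns (psum (inc Y D)) i + D 0"
proof -
  have eq: "D j = psum (inc Y D) j + D 0" if "j \<le> Y" for j
    using psum_inc[OF that] by simp
  have "run ns D i = run ns (\<lambda>j. psum (inc Y D) j + D 0) i"
    by (intro antisym run_mono[where Y = Y] assms) (metis eq order_refl)+
  then show ?thesis by (simp add: run_shift)
qed

text \<open>Running commutes with adding a constant, so the increments evolve on their own.\<close>

lemma inc_run: "inc Y (run ns D) = inc Y (run ns (psum (inc Y D)))"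
proof
  fix i show "inc Y (run ns D) i = inc Y (run ns (psum (inc Y D))) i"
  proof (cases "i \<in> {1..Y}")
    case True
    then have "i \<le> Y" "i - 1 \<le> Y" by auto
    from run_psum_inc[OF this(1), of ns D] run_psum_inc[OF this(2), of ns D]
    show ?thesis using True by (simp add: inc_def)
  qed (simp only: inc_def if_False)
qed

lemma inc_psum:
  assumes "\<And>i. i \<notin> {1..Y} \<Longrightarrow> d i = 0"
  shows "inc Y (psum d) = d"
proof
  fix i show "inc Y (psum d) i = d i"
    using assms[of i] by (cases i) (auto simp: inc_def)
qed

section \<open>Stationary increments\<close>

definition bern :: "real \<Rightarrow> 'i set \<Rightarrow> ('i \<Rightarrow> bool) pmf" where
  "bern p R = Pi_pmf R False (\<lambda>_. bernoulli_pmf p)"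

definition uv :: "real \<Rightarrow> real \<Rightarrow> (nat \<times> bool) pmf" where
  "uv v q = pair_pmf (geometric_pmf (1 - q)) (bernoulli_pmf v)"

definition dval :: "nat \<times> bool \<Rightarrow> int" where
  "dval z = of_bool (snd z) - 1 - int (fst z)"

definition source :: "real \<Rightarrow> real \<Rightarrow> nat \<Rightarrow> (int \<times> (nat \<Rightarrow> bool)) pmf" where
  "source p q Y = pair_pmf (map_pmf (\<lambda>k. 1 + int k) (geometric_pmf (1 - q))) (bern p {1..Y})"

definition incs :: "real \<Rightarrow> real \<Rightarrow> nat \<Rightarrow> (nat \<Rightarrow> int) pmf" where
  "incs v q Y = Pi_pmf {1..Y} 0 (\<lambda>_. map_pmf dval (uv v q))"

text \<open>Update of one row: if its increment is \<open>V - 1 - U\<close> and its coin is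
  \<open>B\<close>, then with \<open>(U', V')\<close> the image, the new value exceeds the old value
  of the same row by \<open>1 + U'\<close> and the old value of the row below by \<open>V'\<close>.
  The subtraction of natural numbers is meant to truncate at 0.\<close>

definition burke :: "(nat \<times> bool) \<times> bool \<Rightarrow> nat \<times> bool" where
  "burke z = (fst (fst z) + of_bool (snd z) - of_bool (snd (fst z)),
              snd z \<or> (snd (fst z) \<and> fst (fst z) = 0))"

text \<open>Every pair has exactly two preimages. At \<open>(0, True)\<close> their weights add up
  because p + (1 - p) = 1, and everywhere else because of the balance equation.\<close>

lemma map_burke:
  assumes "0 \<le> p" "p \<le> 1" "0 \<le> v" "v \<le> 1" "0 \<le> q" "q < 1"
    and bal: "v * q * (1 - p) = p * (1 - v)"
  shows "map_pmf burke (pair_pmf (uv v q) (bernoulli_pmf p)) = uv v q"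
proof (rule pmf_eqI)
  fix x :: "nat \<times> bool"
  let ?M = "pair_pmf (uv v q) (bernoulli_pmf p)"
  have geo: "pmf (geometric_pmf (1 - q)) n = q ^ n * (1 - q)" for n
    using assms by simp
  obtain k b where x: "x = (k, b)" by fastforce
  consider "b" "k = 0" | j where "b" "k = Suc j" | "\<not> b" by (cases k) auto
  then show "pmf (map_pmf burke ?M) x = pmf (uv v q) x"
  proof cases
    case 1
    have "burke -` {x} = {((0, True), True), ((0, True), False)}"
      using 1 x by (auto simp: burke_def of_bool_def split: if_splits)
    then have "pmf (map_pmf burke ?M) x
        = pmf ?M ((0, True), True) + pmf ?M ((0, True), False)"
      by (simp add: pmf_map measure_measure_pmf_finite)
    also have "\<dots> = pmf (uv v q) x"
      using assms 1 x by (simp add: uv_def pmf_pair geo algebra_simps)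
    finally show ?thesis .
  next
    case 2
    have "burke -` {x} = {((j, False), True), ((Suc j, True), True)}"
      using 2 x by (auto simp: burke_def of_bool_def split: if_splits)
    then have "pmf (map_pmf burke ?M) x
        = pmf ?M ((j, False), True) + pmf ?M ((Suc j, True), True)"
      by (simp add: pmf_map measure_measure_pmf_finite)
    also have "\<dots> = q ^ j * (1 - q) * (p * (1 - v) + v * q * p)"
      using assms(1-6) by (simp add: uv_def pmf_pair geo algebra_simps)
    also have "p * (1 - v) + v * q * p = v * q"
      using bal by (simp add: algebra_simps)
    finally show ?thesis
      using assms 2 x by (simp add: uv_def pmf_pair geo)
  next
    case 3
    have "burke -` {x} = {((k, False), False), ((Suc k, True), False)}"
      using 3 x by (auto simp: burke_def of_bool_def split: if_splits)
    then have "pmf (map_pmf burke ?M) x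
        = pmf ?M ((k, False), False) + pmf ?M ((Suc k, True), False)"
      by (simp add: pmf_map measure_measure_pmf_finite)
    also have "\<dots> = q ^ k * (1 - q) * ((1 - v) * (1 - p) + v * q * (1 - p))"
      using assms(1-6) by (simp add: uv_def pmf_pair geo algebra_simps)
    also have "(1 - v) * (1 - p) + v * q * (1 - p) = 1 - v"
      using bal by (simp add: algebra_simps)
    finally show ?thesis
      using assms 3 x by (simp add: uv_def pmf_pair geo)
  qed
qed

lemma Pi_pmf_zip:
  assumes "finite A"
  shows "pair_pmf (Pi_pmf A a P) (Pi_pmf A b Q)
       = map_pmf (\<lambda>f. (fst \<circ> f, snd \<circ> f)) (Pi_pmf A (a, b) (\<lambda>i. pair_pmf (P i) (Q i)))"
proof (rule pmf_eqI)
  fix z :: "('a \<Rightarrow> 'b) \<times> ('a \<Rightarrow> 'c)"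
  obtain f g where z: "z = (f, g)" by fastforce
  let ?h = "\<lambda>f::'a \<Rightarrow> 'b \<times> 'c. (fst \<circ> f, snd \<circ> f)"
  let ?w = "\<lambda>i. (f i, g i)"
  have inj: "inj ?h" by (auto simp: inj_def fun_eq_iff prod_eq_iff)
  have w: "?h ?w = z" using z by (simp add: comp_def)
  have "pmf (map_pmf ?h (Pi_pmf A (a, b) (\<lambda>i. pair_pmf (P i) (Q i)))) (?h ?w)
      = pmf (Pi_pmf A (a, b) (\<lambda>i. pair_pmf (P i) (Q i))) ?w"
    by (rule pmf_map_inj'[OF inj])
  also have "\<dots> = (if \<forall>x. x \<notin> A \<longrightarrow> f x = a \<and> g x = b
      then \<Prod>x\<in>A. pmf (P x) (f x) * pmf (Q x) (g x) else 0)"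
    unfolding pmf_Pi[OF assms] by (simp add: pmf_pair) blast
  also have "\<dots> = pmf (pair_pmf (Pi_pmf A a P) (Pi_pmf A b Q)) z"
    unfolding z pmf_pair pmf_Pi[OF assms] by (auto simp: prod.distrib)
  finally show "pmf (pair_pmf (Pi_pmf A a P) (Pi_pmf A b Q)) z
      = pmf (map_pmf ?h (Pi_pmf A (a, b) (\<lambda>i. pair_pmf (P i) (Q i)))) z" unfolding w ..
qed

text \<open>The new increment of row \<open>i\<close> combines \<open>V'\<close> of that row,
  measured from the old row below, with \<open>U'\<close> of row \<open>i - 1\<close>, which tells
  how far the row below has moved meanwhile. For row 1 that movement is the source.\<close>

definition shifted_inc :: "nat \<Rightarrow> nat \<Rightarrow> (nat \<Rightarrow> nat \<times> bool) \<Rightarrow> nat \<Rightarrow> int" where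
  "shifted_inc Y u w i = (if i \<in> {1..Y} then
     of_bool (snd (w i)) - 1 - int (if i = 1 then u else fst (w (i - 1))) else 0)"

lemma inc_rstep:
  fixes z :: "nat \<Rightarrow> (nat \<times> bool) \<times> bool" and Y :: nat
  defines "d \<equiv> \<lambda>i. if i \<in> {1..Y} then dval (fst (z i)) else 0"
  shows "inc Y (rstep (1 + int u, \<lambda>i. snd (z i)) (psum d)) = shifted_inc Y u (\<lambda>i. burke (z i))"
proof
  fix i
  let ?n = "(1 + int u, \<lambda>i. snd (z i))"
  \<comment> \<open>The new row is measured twice: from the old row below in \<open>a\<close>, from
    its own old position in \<open>b\<close>.\<close>
  have a: "rstep ?n (psum d) (Suc j) = psum d j + of_bool (snd (burke (z (Suc j))))"
    and b: "rstep ?n (psum d) (Suc j) = psum d (Suc j) + 1 + int (fst (burke (z (Suc j))))"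
    if "Suc j \<le> Y" for j
  proof -
    obtain k V B where z: "z (Suc j) = ((k, V), B)" by (metis surj_pair)
    have d: "d (Suc j) = of_bool V - 1 - int k"
      using that z by (simp add: d_def dval_def)
    show "rstep ?n (psum d) (Suc j) = psum d j + of_bool (snd (burke (z (Suc j))))"
      and "rstep ?n (psum d) (Suc j) = psum d (Suc j) + 1 + int (fst (burke (z (Suc j))))"
      unfolding rstep_Suc psum_Suc d snd_conv z burke_def
      by (cases V; cases B; cases "k = 0"; simp)+
  qed
  show "inc Y (rstep ?n (psum d)) i = shifted_inc Y u (\<lambda>i. burke (z i)) i"
  proof (cases "i \<in> {1..Y}")
    case True
    then obtain j where j: "i = Suc j" "Suc j \<le> Y" by (cases i) auto
    show ?thesis
    proof (cases j)
      case 0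
      then show ?thesis using j a[of 0] by (simp add: inc_def shifted_inc_def del: rstep_Suc)
    next
      case (Suc k)
      then show ?thesis using j a[of j] b[of k]
        by (simp add: inc_def shifted_inc_def del: rstep_Suc psum_Suc)
    qed
  qed (simp only: inc_def shifted_inc_def if_False)
qed

text \<open>The induction carries along the geometric variable that leaves row \<open>Y\<close>: it
  is independent of the increments formed so far and feeds row \<open>Y + 1\<close>. For
  \<open>Y = 0\<close> it is the source.\<close>

lemma map_shifted_inc:
  "map_pmf (\<lambda>(u, w). (shifted_inc Y u w, if Y = 0 then u else fst (w Y)))
     (pair_pmf (geometric_pmf (1 - q)) (Pi_pmf {1..Y} z\<^sub>0 (\<lambda>_. uv v q)))
   = pair_pmf (incs v q Y) (geometric_pmf (1 - q))"
proof (induction Y)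
  case 0
  have "shifted_inc 0 u w = (\<lambda>_. 0)" for u w
    by (auto simp: shifted_inc_def fun_eq_iff)
  then show ?case
    by (simp add: incs_def pair_return_pmf1 pair_return_pmf2 map_pmf_comp)
next
  case (Suc Y)
  let ?G = "geometric_pmf (1 - q)" and ?V = "bernoulli_pmf v"
  let ?P = "Pi_pmf {1..Y} z\<^sub>0 (\<lambda>_. uv v q)"
  let ?F = "\<lambda>u w. (shifted_inc Y u w, if Y = 0 then u else fst (w Y))"
  have ins: "{1..Suc Y} = insert (Suc Y) {1..Y}" by auto
  have upd: "shifted_inc (Suc Y) u (w(Suc Y := z))
      = (fst (?F u w))(Suc Y := of_bool (snd z) - 1 - int (snd (?F u w)))" for u w z
    by (auto simp: shifted_inc_def fun_eq_iff)
  have "map_pmf (\<lambda>(u, w). (shifted_inc (Suc Y) u w, if Suc Y = 0 then u else fst (w (Suc Y))))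
     (pair_pmf ?G (Pi_pmf {1..Suc Y} z\<^sub>0 (\<lambda>_. uv v q)))
    = bind_pmf ?G (\<lambda>u. bind_pmf (uv v q) (\<lambda>z. bind_pmf ?P (\<lambda>w.
        return_pmf (shifted_inc (Suc Y) u (w(Suc Y := z)), fst z))))"
    unfolding ins
    by (subst Pi_pmf_insert')
       (simp_all add: pair_pmf_def map_pmf_def bind_assoc_pmf bind_return_pmf)
  also have "\<dots> = bind_pmf (uv v q) (\<lambda>z. bind_pmf ?G (\<lambda>u. bind_pmf ?P (\<lambda>w.
        return_pmf ((fst (?F u w))(Suc Y := of_bool (snd z) - 1 - int (snd (?F u w))), fst z))))"
    unfolding upd by (rule bind_commute_pmf)
  also have "\<dots> = bind_pmf (uv v q) (\<lambda>z. bind_pmf (map_pmf (\<lambda>(u, w). ?F u w) (pair_pmf ?G ?P))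
      (\<lambda>x. return_pmf ((fst x)(Suc Y := of_bool (snd z) - 1 - int (snd x)), fst z)))"
    by (simp add: pair_pmf_def map_pmf_def bind_assoc_pmf bind_return_pmf)
  also have "\<dots> = bind_pmf ?G (\<lambda>u. bind_pmf ?V (\<lambda>b. bind_pmf (incs v q Y) (\<lambda>f.
      bind_pmf ?G (\<lambda>l. return_pmf (f(Suc Y := of_bool b - 1 - int l), u)))))"
    unfolding Suc by (simp add: uv_def pair_pmf_def bind_assoc_pmf bind_return_pmf)
  also have "\<dots> = bind_pmf ?G (\<lambda>u. bind_pmf ?G (\<lambda>l. bind_pmf ?V (\<lambda>b. bind_pmf (incs v q Y) (\<lambda>f.
      return_pmf (f(Suc Y := of_bool b - 1 - int l), u)))))"
    by (subst (2) bind_commute_pmf, subst (3) bind_commute_pmf) (rule refl)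
  also have "\<dots> = pair_pmf (incs v q (Suc Y)) ?G"
    unfolding incs_def ins
    by (subst Pi_pmf_insert', simp, simp, subst pair_commute_pmf)
       (simp add: uv_def dval_def pair_pmf_def map_pmf_def bind_assoc_pmf bind_return_pmf)
  finally show ?case .
qed

context
  fixes p v q :: real
  assumes p: "0 \<le> p" "p \<le> 1" and v: "0 \<le> v" "v \<le> 1" and q: "0 \<le> q" "q < 1"
    and bal: "v * q * (1 - p) = p * (1 - v)"
begin

lemma incs_step:
  "map_pmf (\<lambda>(d, n). inc Y (rstep n (psum d))) (pair_pmf (incs v q Y) (source p q Y)) = incs v q Y"
proof -
  let ?G = "geometric_pmf (1 - q)" and ?R = "{1..Y}"
  \<comment> \<open>The default \<open>(0, True)\<close> is chosen because its \<open>dval\<close>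
    is 0, the default of \<open>incs\<close>.\<close>
  let ?U = "Pi_pmf ?R (0, True) (\<lambda>_. uv v q)"
  let ?Z = "Pi_pmf ?R ((0, True), False) (\<lambda>_. pair_pmf (uv v q) (bernoulli_pmf p))"
  have incs: "incs v q Y = map_pmf (\<lambda>w. dval \<circ> w) ?U"
    unfolding incs_def by (rule Pi_pmf_map) (auto simp: dval_def)
  have zip: "pair_pmf ?U (bern p ?R) = map_pmf (\<lambda>f. (fst \<circ> f, snd \<circ> f)) ?Z"
    unfolding bern_def by (rule Pi_pmf_zip) simp
  have supp: "z i = ((0, True), False)" if "z \<in> set_pmf ?Z" "i \<notin> ?R" for z i
    using that set_Pi_pmf_subset[of ?R "((0, True), False)"] by blast
  have "map_pmf (\<lambda>(d, n). inc Y (rstep n (psum d))) (pair_pmf (incs v q Y) (source p q Y))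
      = map_pmf (\<lambda>((w, b), u). inc Y (rstep (1 + int u, b) (psum (dval \<circ> w))))
          (pair_pmf (pair_pmf ?U (bern p ?R)) ?G)"
    unfolding incs source_def pair_pmf_def map_pmf_def
    by (simp add: bind_assoc_pmf bind_return_pmf)
       (subst (2) bind_commute_pmf, rule refl)
  also have "\<dots> = map_pmf (\<lambda>(z, u). inc Y (rstep (1 + int u, snd \<circ> z) (psum (dval \<circ> (fst \<circ> z)))))
          (pair_pmf ?Z ?G)"
    unfolding zip pair_map_pmf1 pmf.map_comp
    by (intro map_pmf_cong) (auto simp: comp_def)
  also have "\<dots> = map_pmf (\<lambda>(z, u). shifted_inc Y u (burke \<circ> z)) (pair_pmf ?Z ?G)"
  proof (intro map_pmf_cong refl, clarify)
    fix z u assume "(z, u) \<in> set_pmf (pair_pmf ?Z ?G)"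
    then have z: "z \<in> set_pmf ?Z" by simp
    have "dval (fst (z i)) = 0" if "i \<notin> ?R" for i
      unfolding supp[OF z that] by (simp add: dval_def)
    then have "dval \<circ> (fst \<circ> z) = (\<lambda>i. if i \<in> ?R then dval (fst (z i)) else 0)"
      unfolding fun_eq_iff comp_def by meson
    then show "inc Y (rstep (1 + int u, snd \<circ> z) (psum (dval \<circ> (fst \<circ> z))))
        = shifted_inc Y u (burke \<circ> z)"
      using inc_rstep[of Y u z] by (simp add: comp_def)
  qed
  also have "\<dots> = map_pmf (\<lambda>(u, w). shifted_inc Y u w)
      (pair_pmf ?G (map_pmf (\<lambda>z. burke \<circ> z) ?Z))"
    by (subst (2) pair_commute_pmf)
       (simp add: pair_map_pmf1 pair_map_pmf2 map_pmf_comp case_prod_unfold)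
  also have "map_pmf (\<lambda>z. burke \<circ> z) ?Z
      = Pi_pmf ?R (burke ((0, True), False)) (\<lambda>_. uv v q)"
    by (subst Pi_pmf_map[symmetric]) (auto simp: map_burke[OF p v q bal])
  also have "map_pmf (\<lambda>(u, w). shifted_inc Y u w)
      (pair_pmf ?G (Pi_pmf ?R (burke ((0, True), False)) (\<lambda>_. uv v q)))
    = map_pmf fst (pair_pmf (incs v q Y) ?G)"
    by (subst map_shifted_inc[where z\<^sub>0 = "burke ((0, True), False)", symmetric])
       (simp add: map_pmf_comp case_prod_unfold)
  finally show ?thesis by (simp add: map_fst_pair_pmf)
qed

lemma incs_run:
  "map_pmf (\<lambda>(d, ns). inc Y (run ns (psum d)))
     (pair_pmf (incs v q Y) (replicate_pmf t (source p q Y))) = incs v q Y"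
proof (induction t)
  case 0
  have "inc Y (psum d) = d" if "d \<in> set_pmf (incs v q Y)" for d
    using that set_Pi_pmf_subset[of "{1..Y}" "0::int"]
    by (intro inc_psum) (auto simp: incs_def)
  then have "map_pmf (\<lambda>d. inc Y (psum d)) (incs v q Y) = map_pmf id (incs v q Y)"
    by (intro map_pmf_cong) auto
  then show ?case
    by (simp add: pair_return_pmf2 map_pmf_comp pmf.map_id)
next
  case (Suc t)
  let ?S = "source p q Y"
  have "map_pmf (\<lambda>(d, ns). inc Y (run ns (psum d))) (pair_pmf (incs v q Y) (replicate_pmf (Suc t) ?S))
    = bind_pmf (pair_pmf (incs v q Y) ?S) (\<lambda>(d, n). bind_pmf (replicate_pmf t ?S) (\<lambda>ns.
        return_pmf (inc Y (run ns (rstep n (psum d))))))"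
    by (simp add: pair_pmf_def map_pmf_def bind_assoc_pmf bind_return_pmf)
  also have "\<dots> = bind_pmf (map_pmf (\<lambda>(d, n). inc Y (rstep n (psum d))) (pair_pmf (incs v q Y) ?S))
      (\<lambda>d. bind_pmf (replicate_pmf t ?S) (\<lambda>ns. return_pmf (inc Y (run ns (psum d)))))"
    by (subst inc_run) (simp add: map_pmf_def bind_assoc_pmf bind_return_pmf case_prod_unfold)
  also have "\<dots> = map_pmf (\<lambda>(d, ns). inc Y (run ns (psum d)))
      (pair_pmf (incs v q Y) (replicate_pmf t ?S))"
    unfolding incs_step by (simp add: pair_pmf_def map_pmf_def bind_assoc_pmf bind_return_pmf)
  finally show ?case using Suc by simp
qed

end

section \<open>Exponentially small probabilities\<close>

definition expsmall :: "(nat \<Rightarrow> real) \<Rightarrow> bool" where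
  "expsmall f \<longleftrightarrow> (\<exists>c>0. \<forall>\<^sub>F n in sequentially. f n \<le> exp (- c * real n))"

lemma expsmall_mono:
  assumes "expsmall g" "\<forall>\<^sub>F n in sequentially. f n \<le> g n"
  shows "expsmall f"
proof -
  from assms(1) obtain c where "c > 0" "\<forall>\<^sub>F n in sequentially. g n \<le> exp (- c * real n)"
    by (auto simp: expsmall_def)
  from this(2) assms(2) have "\<forall>\<^sub>F n in sequentially. f n \<le> exp (- c * real n)"
    by eventually_elim linarith
  with \<open>c > 0\<close> show ?thesis by (auto simp: expsmall_def)
qed

lemma expsmall_linear_mult:
  assumes "expsmall f" "a \<ge> 0" "b \<ge> 0"
  shows "expsmall (\<lambda>n. (a * real n + b) * f n)"
proof -
  from assms(1) obtain c where c: "c > 0" "\<forall>\<^sub>F n in sequentially. f n \<le> exp (- c * real n)"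
    by (auto simp: expsmall_def)
  \<comment> \<open>Half of the rate is given up to absorb the linear factor.\<close>
  have "((\<lambda>n. (a * real n + b) * exp (- (c / 2) * real n)) \<longlongrightarrow> 0) sequentially"
    using c(1) by real_asymp
  then have "\<forall>\<^sub>F n in sequentially. (a * real n + b) * exp (- (c / 2) * real n) < 1"
    by (rule order_tendstoD) simp
  with c(2) have "\<forall>\<^sub>F n in sequentially. (a * real n + b) * f n \<le> exp (- (c / 2) * real n)"
  proof eventually_elim
    case (elim n)
    have "(a * real n + b) * f n \<le> (a * real n + b) * exp (- c * real n)"
      using elim assms by (intro mult_left_mono) auto
    also have "exp (- c * real n) = exp (- (c / 2) * real n) * exp (- (c / 2) * real n)"
      by (simp flip: exp_add)
    also have "(a * real n + b) * \<dots> \<le> 1 * exp (- (c / 2) * real n)"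
      unfolding mult.assoc[symmetric] using elim by (intro mult_right_mono) auto
    finally show ?case by simp
  qed
  with c(1) show ?thesis unfolding expsmall_def by (intro exI[of _ "c / 2"]) auto
qed

lemma expsmall_add:
  assumes "expsmall f" "expsmall g"
  shows "expsmall (\<lambda>n. f n + g n)"
proof -
  from assms(1) obtain c where c: "c > 0" "\<forall>\<^sub>F n in sequentially. f n \<le> exp (- c * real n)"
    by (auto simp: expsmall_def)
  from assms(2) obtain d where d: "d > 0" "\<forall>\<^sub>F n in sequentially. g n \<le> exp (- d * real n)"
    by (auto simp: expsmall_def)
  have "expsmall (\<lambda>n. exp (- min c d * real n))"
    using c(1) d(1) unfolding expsmall_def by (intro exI[of _ "min c d"]) auto
  then have "expsmall (\<lambda>n. (0 * real n + 2) * exp (- min c d * real n))"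
    by (rule expsmall_linear_mult) auto
  moreover have "\<forall>\<^sub>F n in sequentially. f n + g n \<le> (0 * real n + 2) * exp (- min c d * real n)"
    using c(2) d(2)
  proof eventually_elim
    case (elim n)
    have "exp (- c * real n) \<le> exp (- min c d * real n)" "exp (- d * real n) \<le> exp (- min c d * real n)"
      by (auto intro!: mult_right_mono)
    with elim have "f n + g n \<le> exp (- min c d * real n) + exp (- min c d * real n)"
      by linarith
    then show ?case by simp
  qed
  ultimately show ?thesis by (rule expsmall_mono)
qed

lemma expsmall_zero: "expsmall (\<lambda>_. 0)"
  unfolding expsmall_def by (intro exI[of _ 1]) auto

lemma expsmall_sum:
  assumes "finite I" "\<And>i. i \<in> I \<Longrightarrow> expsmall (f i)"
  shows "expsmall (\<lambda>n. \<Sum>i\<in>I. f i n)"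
  using assms by (induction rule: finite_induct) (simp_all add: expsmall_zero expsmall_add)

lemma expsmall_compose:
  assumes "expsmall f" "\<delta> > 0" "\<forall>\<^sub>F n in sequentially. \<delta> * real n \<le> real (g n)"
  shows "expsmall (\<lambda>n. f (g n))"
proof -
  from assms(1) obtain c where c: "c > 0" "\<forall>\<^sub>F n in sequentially. f n \<le> exp (- c * real n)"
    by (auto simp: expsmall_def)
  have "filterlim (\<lambda>n. \<delta> * real n) at_top sequentially"
    using assms(2) by real_asymp
  then have "filterlim (\<lambda>n. real (g n)) at_top sequentially"
    by (rule filterlim_at_top_mono) (rule assms(3))
  then have "filterlim g at_top sequentially"
    using filterlim_sequentially_iff_filterlim_real by blast
  then have "\<forall>\<^sub>F n in sequentially. f (g n) \<le> exp (- c * real (g n))"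
    by (rule eventually_compose_filterlim[OF c(2)])
  with assms(3) have "\<forall>\<^sub>F n in sequentially. f (g n) \<le> exp (- (c * \<delta>) * real n)"
  proof eventually_elim
    case (elim n)
    have "c * (\<delta> * real n) \<le> c * real (g n)"
      using elim c(1) by (intro mult_left_mono) auto
    then have "exp (- c * real (g n)) \<le> exp (- (c * \<delta>) * real n)" by simp
    with elim show ?case by linarith
  qed
  then show ?thesis
    unfolding expsmall_def using c(1) assms(2) by (intro exI[of _ "c * \<delta>"]) auto
qed

lemma expsmall_summable:
  assumes "expsmall f" "\<And>n. 0 \<le> f n"
  shows "summable f"
proof -
  from assms(1) obtain c where c: "c > 0" "\<forall>\<^sub>F n in sequentially. f n \<le> exp (- c * real n)"
    by (auto simp: expsmall_def)
  have "summable (\<lambda>n. exp (- c) ^ n)"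
    using c(1) by (intro summable_geometric) auto
  moreover have "\<forall>\<^sub>F n in sequentially. norm (f n) \<le> exp (- c) ^ n"
    using c(2)
  proof eventually_elim
    case (elim n)
    then show ?case using assms(2)[of n] by (simp add: exp_of_nat_mult[symmetric] mult.commute)
  qed
  ultimately show ?thesis by (rule summable_comparison_test_ev[rotated])
qed

section \<open>Chernoff bounds from exponential moments\<close>

text \<open>\<open>m\<close> dominates the right derivative at 0 of the cumulant generating function of \<open>X\<close>.\<close>

definition cgf_bound :: "'a pmf \<Rightarrow> ('a \<Rightarrow> real) \<Rightarrow> real \<Rightarrow> bool" where
  "cgf_bound P X m \<longleftrightarrow> (\<forall>\<epsilon>>0. \<forall>\<^sub>F \<theta> in at_right 0.
     (\<integral>\<^sup>+x. ennreal (exp (\<theta> * X x)) \<partial>P) \<le> ennreal (exp ((m + \<epsilon>) * \<theta>)))"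

text \<open>The difference \<open>exp ((m + \<epsilon>) * \<theta>) - F \<theta>\<close> vanishes at
  0 with derivative \<open>\<epsilon>\<close>, so it is positive just to the right of 0.\<close>

lemma cgf_boundI:
  fixes P :: "'a pmf"
  assumes "F 0 = 1" "(F has_real_derivative m) (at 0)"
    and "\<forall>\<^sub>F \<theta> in at_right 0. (\<integral>\<^sup>+x. ennreal (exp (\<theta> * X x)) \<partial>P) \<le> ennreal (F \<theta>)"
  shows "cgf_bound P X m"
  unfolding cgf_bound_def
proof (intro allI impI)
  fix \<epsilon> :: real assume \<epsilon>: "\<epsilon> > 0"
  let ?G = "\<lambda>\<theta>. exp ((m + \<epsilon>) * \<theta>) - F \<theta>"
  have "(?G has_real_derivative \<epsilon>) (at 0)"
    by (auto intro!: derivative_eq_intros assms(2))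
  from DERIV_pos_inc_right[OF this \<epsilon>] obtain d where
    d: "d > 0" "\<And>h. 0 < h \<Longrightarrow> h < d \<Longrightarrow> ?G 0 < ?G (0 + h)" by blast
  have "\<forall>\<^sub>F \<theta> in at_right 0. F \<theta> \<le> exp ((m + \<epsilon>) * \<theta>)"
    unfolding eventually_at_right_field
    using d(1) by (intro exI[of _ d]) (use d(2) assms(1) in \<open>fastforce simp: less_imp_le\<close>)
  with assms(3) show "\<forall>\<^sub>F \<theta> in at_right 0.
     (\<integral>\<^sup>+x. ennreal (exp (\<theta> * X x)) \<partial>P) \<le> ennreal (exp ((m + \<epsilon>) * \<theta>))"
    by eventually_elim (meson ennreal_leI order_trans)
qed

lemma prob_le_exp_moment:
  fixes P :: "'a pmf"
  assumes "(\<integral>\<^sup>+x. ennreal (exp (\<theta> * S x)) \<partial>P) \<le> ennreal (exp b)" "\<theta> \<ge> 0"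
  shows "measure_pmf.prob P {x. S x \<ge> a} \<le> exp (b - \<theta> * a)"
proof -
  have "ennreal (measure_pmf.prob P {x. S x \<ge> a}) = (\<integral>\<^sup>+x. indicator {x. S x \<ge> a} x \<partial>P)"
    by (simp add: measure_pmf.emeasure_eq_measure)
  also have "\<dots> \<le> (\<integral>\<^sup>+x. ennreal (exp (- \<theta> * a)) * ennreal (exp (\<theta> * S x)) \<partial>P)"
  proof (rule nn_integral_mono)
    fix x
    have "1 \<le> exp (- \<theta> * a) * exp (\<theta> * S x)" if "a \<le> S x"
      using that assms(2) mult_left_mono[of a "S x" \<theta>] by (simp flip: exp_add)
    then show "indicator {x. S x \<ge> a} x \<le> ennreal (exp (- \<theta> * a)) * ennreal (exp (\<theta> * S x))"
      by (auto simp: indicator_def simp flip: ennreal_mult' ennreal_1)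
  qed
  also have "\<dots> = ennreal (exp (- \<theta> * a)) * (\<integral>\<^sup>+x. ennreal (exp (\<theta> * S x)) \<partial>P)"
    by (simp add: nn_integral_cmult)
  also have "\<dots> \<le> ennreal (exp (- \<theta> * a)) * ennreal (exp b)"
    by (intro mult_left_mono assms(1)) auto
  also have "\<dots> = ennreal (exp (b - \<theta> * a))"
    by (simp add: exp_diff exp_minus field_simps flip: ennreal_mult')
  finally show ?thesis by simp
qed

lemma nn_integral_exp_replicate:
  fixes P :: "'a pmf"
  shows "(\<integral>\<^sup>+xs. ennreal (exp (\<theta> * (\<Sum>x\<leftarrow>xs. X x))) \<partial>replicate_pmf n P)
   = (\<integral>\<^sup>+x. ennreal (exp (\<theta> * X x)) \<partial>P) ^ n"
proof (induction n)
  case (Suc n)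
  have "(\<integral>\<^sup>+xs. ennreal (exp (\<theta> * (\<Sum>x\<leftarrow>xs. X x))) \<partial>replicate_pmf (Suc n) P)
      = (\<integral>\<^sup>+x. (\<integral>\<^sup>+xs. ennreal (exp (\<theta> * X x)) * ennreal (exp (\<theta> * (\<Sum>x\<leftarrow>xs. X x)))
          \<partial>replicate_pmf n P) \<partial>P)"
    by (simp add: exp_add distrib_left ennreal_mult')
  also have "\<dots> = (\<integral>\<^sup>+x. ennreal (exp (\<theta> * X x)) \<partial>P) ^ Suc n"
    by (simp add: nn_integral_cmult nn_integral_multc Suc)
  finally show ?case .
qed simp

text \<open>Deviations are measured in units of the time \<open>t\<close>, while up to
  \<open>3 * t\<close> terms are summed. An excess of \<open>\<epsilon> / 6\<close> per term costs
  at most \<open>\<epsilon> / 2 * t\<close> and leaves the rate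
  \<open>\<theta> * \<epsilon> / 2\<close>.\<close>

lemma chernoff:
  fixes P :: "'a pmf"
  assumes "cgf_bound P X m" "\<epsilon> > 0"
  obtains c where "c > 0"
    "\<And>t. measure_pmf.prob (replicate_pmf t P) {xs. (\<Sum>x\<leftarrow>xs. X x) \<ge> real t * (m + \<epsilon>)} \<le> exp (- c * real t)"
    "\<And>t A d I. finite A \<Longrightarrow> I \<subseteq> A \<Longrightarrow> card I \<le> 3 * t \<Longrightarrow>
       measure_pmf.prob (Pi_pmf A d (\<lambda>_. P)) {y. (\<Sum>i\<in>I. X (y i)) \<ge> real (card I) * m + \<epsilon> * real t}
       \<le> exp (- c * real t)"
proof -
  have "\<forall>\<^sub>F \<theta> in at_right 0.
     (\<integral>\<^sup>+x. ennreal (exp (\<theta> * X x)) \<partial>P) \<le> ennreal (exp ((m + \<epsilon> / 6) * \<theta>))"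
    using assms unfolding cgf_bound_def by auto
  moreover have "\<forall>\<^sub>F \<theta> in at_right 0. (\<theta>::real) > 0"
    by (simp add: eventually_at_right_less)
  ultimately have "\<forall>\<^sub>F \<theta> in at_right 0. \<theta> > 0 \<and>
     (\<integral>\<^sup>+x. ennreal (exp (\<theta> * X x)) \<partial>P) \<le> ennreal (exp ((m + \<epsilon> / 6) * \<theta>))"
    by eventually_elim simp
  then obtain \<theta> where \<theta>: "\<theta> > 0"
    "(\<integral>\<^sup>+x. ennreal (exp (\<theta> * X x)) \<partial>P) \<le> ennreal (exp ((m + \<epsilon> / 6) * \<theta>))"
    using eventually_happens[of _ "at_right (0::real)"] trivial_limit_at_right_real by blast
  have pow: "(\<integral>\<^sup>+x. ennreal (exp (\<theta> * X x)) \<partial>P) ^ n \<le> ennreal (exp (real n * ((m + \<epsilon> / 6) * \<theta>)))" for n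
    using power_mono[OF \<theta>(2), of n] by (simp add: ennreal_power exp_of_nat_mult[symmetric])
  show thesis
  proof (rule that[of "\<theta> * \<epsilon> / 2"])
    show "\<theta> * \<epsilon> / 2 > 0" using \<theta> assms by simp
  next
    fix t
    have "measure_pmf.prob (replicate_pmf t P) {xs. (\<Sum>x\<leftarrow>xs. X x) \<ge> real t * (m + \<epsilon>)}
        \<le> exp (real t * ((m + \<epsilon> / 6) * \<theta>) - \<theta> * (real t * (m + \<epsilon>)))"
      using \<theta>(1) by (intro prob_le_exp_moment) (auto simp: nn_integral_exp_replicate pow)
    also have "\<dots> \<le> exp (- (\<theta> * \<epsilon> / 2) * real t)"
      using \<theta>(1) assms(2) by (simp add: algebra_simps)
    finally show "measure_pmf.prob (replicate_pmf t P) {xs. (\<Sum>x\<leftarrow>xs. X x) \<ge> real t * (m + \<epsilon>)}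
        \<le> exp (- (\<theta> * \<epsilon> / 2) * real t)" .
  next
    fix t A d and I :: "'b set"
    assume A: "finite A" "I \<subseteq> A" and t: "card I \<le> 3 * t"
    have fin: "finite I" using A finite_subset by blast
    have "(\<integral>\<^sup>+y. ennreal (exp (\<theta> * (\<Sum>i\<in>I. X (y i)))) \<partial>Pi_pmf A d (\<lambda>_. P))
        = (\<integral>\<^sup>+y. (\<Prod>i\<in>A. (if i \<in> I then ennreal (exp (\<theta> * X (y i))) else 1)) \<partial>Pi_pmf A d (\<lambda>_. P))"
    proof (rule nn_integral_cong)
      fix y
      have "ennreal (exp (\<theta> * (\<Sum>i\<in>I. X (y i)))) = (\<Prod>i\<in>I. ennreal (exp (\<theta> * X (y i))))"
        using fin by (simp add: sum_distrib_left exp_sum prod_ennreal)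
      also have "\<dots> = (\<Prod>i\<in>A. (if i \<in> I then ennreal (exp (\<theta> * X (y i))) else 1))"
        using A by (simp add: prod.If_cases Int_absorb1)
      finally show "ennreal (exp (\<theta> * (\<Sum>i\<in>I. X (y i)))) = \<dots>" .
    qed
    also have "\<dots> = (\<Prod>i\<in>A. \<integral>\<^sup>+x. (if i \<in> I then ennreal (exp (\<theta> * X x)) else 1) \<partial>P)"
      using A by (intro nn_integral_prod_Pi_pmf)
    also have "\<dots> = (\<Prod>i\<in>A. if i \<in> I then \<integral>\<^sup>+x. ennreal (exp (\<theta> * X x)) \<partial>P else 1)"
      by (intro prod.cong) auto
    also have "\<dots> = (\<integral>\<^sup>+x. ennreal (exp (\<theta> * X x)) \<partial>P) ^ card I"
      using A by (simp add: prod.If_cases Int_absorb1)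
    also note pow
    finally have "measure_pmf.prob (Pi_pmf A d (\<lambda>_. P))
          {y. (\<Sum>i\<in>I. X (y i)) \<ge> real (card I) * m + \<epsilon> * real t}
        \<le> exp (real (card I) * ((m + \<epsilon> / 6) * \<theta>) - \<theta> * (real (card I) * m + \<epsilon> * real t))"
      using \<theta>(1) by (intro prob_le_exp_moment) auto
    also have "\<dots> \<le> exp (- (\<theta> * \<epsilon> / 2) * real t)"
    proof -
      have "real (card I) * (\<theta> * \<epsilon>) \<le> 3 * real t * (\<theta> * \<epsilon>)"
        using t \<theta>(1) assms(2) by (intro mult_right_mono) auto
      then show ?thesis by (simp add: algebra_simps)
    qed
    finally show "measure_pmf.prob (Pi_pmf A d (\<lambda>_. P))
          {y. (\<Sum>i\<in>I. X (y i)) \<ge> real (card I) * m + \<epsilon> * real t}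
        \<le> exp (- (\<theta> * \<epsilon> / 2) * real t)" .
  qed
qed

lemma nn_integral_exp_geometric:
  assumes "0 \<le> q" "q < 1" "q * exp \<theta> < 1"
  shows "(\<integral>\<^sup>+n. ennreal (exp (\<theta> * real n)) \<partial>geometric_pmf (1 - q)) = ennreal ((1 - q) / (1 - q * exp \<theta>))"
proof -
  have "(\<integral>\<^sup>+n. ennreal (exp (\<theta> * real n)) \<partial>geometric_pmf (1 - q))
      = (\<Sum>n. ennreal (pmf (geometric_pmf (1 - q)) n) * ennreal (exp (\<theta> * real n)))"
    by (simp add: nn_integral_measure_pmf nn_integral_count_space_nat)
  also have "\<dots> = (\<Sum>n. ennreal ((1 - q) * (q * exp \<theta>) ^ n))"
    using assms by (intro suminf_cong)
      (simp add: power_mult_distrib exp_of_nat_mult[symmetric] mult_ac flip: ennreal_mult')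
  also have "\<dots> = ennreal ((1 - q) * (1 / (1 - q * exp \<theta>)))"
    using assms by (intro suminf_ennreal_eq sums_mult geometric_sums) auto
  finally show ?thesis by simp
qed

section \<open>Exponential moments of the source and of the stationary increments\<close>

context
  fixes v q s :: real
  assumes v: "0 \<le> v" "v \<le> 1" and q: "0 \<le> q" "q < 1"
begin

lemma eventually_geometric_ratio: "\<forall>\<^sub>F \<theta> in at_right 0. q * exp (s * \<theta>) < 1"
proof -
  have "((\<lambda>\<theta>. q * exp (s * \<theta>)) \<longlongrightarrow> q * exp (s * 0)) (at_right 0)"
    by (intro tendsto_intros)
  then show ?thesis by (rule order_tendstoD) (use q in simp)
qed

text \<open>The factor \<open>s\<close> will be 1 or -1, so that one computation serves both
  tails.\<close>

lemma cgf_bound_source: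
  "cgf_bound (map_pmf (\<lambda>k. 1 + int k) (geometric_pmf (1 - q))) (\<lambda>x. s * real_of_int x) (s * (1 / (1 - q)))"
proof (rule cgf_boundI)
  let ?F = "\<lambda>\<theta>. exp (s * \<theta>) * ((1 - q) / (1 - q * exp (s * \<theta>)))"
  show "?F 0 = 1" using q by simp
  show "(?F has_real_derivative s * (1 / (1 - q))) (at 0)"
  proof -
    define r where "r = 1 - q"
    then have r: "r > 0" "q = 1 - r" using q by auto
    show ?thesis
      unfolding r(2) using r(1)
      by (auto intro!: derivative_eq_intros simp: field_simps power2_eq_square)
  qed
  show "\<forall>\<^sub>F \<theta> in at_right 0. (\<integral>\<^sup>+x. ennreal (exp (\<theta> * (s * real_of_int x)))
      \<partial>map_pmf (\<lambda>k. 1 + int k) (geometric_pmf (1 - q))) \<le> ennreal (?F \<theta>)"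
    using eventually_geometric_ratio
  proof eventually_elim
    case (elim \<theta>)
    have "(\<integral>\<^sup>+x. ennreal (exp (\<theta> * (s * real_of_int x))) \<partial>map_pmf (\<lambda>k. 1 + int k) (geometric_pmf (1 - q)))
        = (\<integral>\<^sup>+k. ennreal (exp (s * \<theta>)) * ennreal (exp ((s * \<theta>) * real k)) \<partial>geometric_pmf (1 - q))"
      by (simp add: exp_add[symmetric] algebra_simps flip: ennreal_mult')
    also have "\<dots> = ennreal (?F \<theta>)"
      by (subst nn_integral_cmult, simp, subst nn_integral_exp_geometric[OF q elim])
         (rule ennreal_mult'[symmetric], simp)
    finally show ?case by simp
  qed
qed

lemma eventually_geometric_ratio': "\<forall>\<^sub>F \<theta> in at_right 0. q * exp (- (s * \<theta>)) < 1"
proof -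
  have "((\<lambda>\<theta>. q * exp (- (s * \<theta>))) \<longlongrightarrow> q * exp (- (s * 0))) (at_right 0)"
    by (intro tendsto_intros)
  then show ?thesis by (rule order_tendstoD) (use q in simp)
qed

lemma cgf_bound_inc:
  "cgf_bound (map_pmf dval (uv v q)) (\<lambda>x. s * real_of_int x) (s * (v - 1 / (1 - q)))"
proof (rule cgf_boundI)
  let ?F = "\<lambda>\<theta>. exp (- (s * \<theta>)) * ((1 - v + v * exp (s * \<theta>)) * ((1 - q) / (1 - q * exp (- (s * \<theta>)))))"
  show "?F 0 = 1" using q by simp
  show "(?F has_real_derivative s * (v - 1 / (1 - q))) (at 0)"
  proof -
    define r where "r = 1 - q"
    then have r: "r > 0" "q = 1 - r" using q by auto
    show ?thesis
      unfolding r(2) using r(1)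
      by (auto intro!: derivative_eq_intros simp: field_simps power2_eq_square)
  qed
  show "\<forall>\<^sub>F \<theta> in at_right 0. (\<integral>\<^sup>+x. ennreal (exp (\<theta> * (s * real_of_int x)))
      \<partial>map_pmf dval (uv v q)) \<le> ennreal (?F \<theta>)"
    using eventually_geometric_ratio'
  proof eventually_elim
    case (elim \<theta>)
    have ber: "(\<integral>\<^sup>+b. ennreal (exp ((s * \<theta>) * of_bool b)) \<partial>bernoulli_pmf v)
        = ennreal (1 - v + v * exp (s * \<theta>))"
      using v by (simp add: nn_integral_measure_pmf_support[of UNIV] UNIV_bool
          ennreal_mult'[symmetric] ennreal_plus[symmetric] add.commute mult.commute del: ennreal_plus)
    have "(\<integral>\<^sup>+x. ennreal (exp (\<theta> * (s * real_of_int x))) \<partial>map_pmf dval (uv v q))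
        = (\<integral>\<^sup>+k. (\<integral>\<^sup>+b. ennreal (exp (- (s * \<theta>))) * (ennreal (exp ((- (s * \<theta>)) * real k)) *
            ennreal (exp ((s * \<theta>) * of_bool b))) \<partial>bernoulli_pmf v) \<partial>geometric_pmf (1 - q))"
      by (simp add: uv_def dval_def nn_integral_pair_pmf' exp_add[symmetric] algebra_simps
          flip: ennreal_mult' of_bool_def)
    also have "\<dots> = ennreal (exp (- (s * \<theta>))) *
        (ennreal ((1 - q) / (1 - q * exp (- (s * \<theta>)))) * ennreal (1 - v + v * exp (s * \<theta>)))"
      using q elim ber nn_integral_exp_geometric[of q "- (s * \<theta>)"]
      by (simp add: nn_integral_cmult nn_integral_multc)
    also have "\<dots> = ennreal (?F \<theta>)"
    proof -
      have "0 \<le> (1 - q) / (1 - q * exp (- (s * \<theta>)))" "0 \<le> 1 - v + v * exp (s * \<theta>)"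
        using q v elim by auto
      moreover have "ennreal a * (ennreal b * ennreal c) = ennreal (a * (c * b))"
        if "0 \<le> b" "0 \<le> c" "0 \<le> a" for a b c
        using that by (simp add: ennreal_mult mult.commute)
      ultimately show ?thesis by simp
    qed
    finally show ?case by simp
  qed
qed

end

section \<open>Deviations and upper bounds for the row process\<close>

definition balanced :: "real \<Rightarrow> real \<Rightarrow> real \<Rightarrow> bool" where
  "balanced p v q \<longleftrightarrow> 0 \<le> p \<and> p \<le> 1 \<and> 0 \<le> v \<and> v \<le> 1 \<and> 0 \<le> q \<and> q < 1 \<and>
     v * q * (1 - p) = p * (1 - v)"

definition rnoise :: "real \<Rightarrow> nat \<Rightarrow> (int \<times> (nat \<Rightarrow> bool)) pmf" where
  "rnoise p Y = map_pmf (Pair 1) (bern p {1..Y})"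

definition joint :: "real \<Rightarrow> real \<Rightarrow> real \<Rightarrow> nat \<Rightarrow> nat \<Rightarrow>
    ((nat \<Rightarrow> int) \<times> (int \<times> (nat \<Rightarrow> bool)) list) pmf" where
  "joint p v q Y t = pair_pmf (incs v q Y) (replicate_pmf t (source p q Y))"

text \<open>A point start; \<open>- C\<close> stands in for minus infinity, which an integer profile
  cannot take.\<close>

definition pt :: "nat \<Rightarrow> int \<Rightarrow> int \<Rightarrow> nat \<Rightarrow> int" where
  "pt j k C i = (if i = j then k else - C)"

lemma map_replicate_pmf: "map_pmf (map f) (replicate_pmf n P) = replicate_pmf n (map_pmf f P)"
proof (induction n)
  case (Suc n)
  then show ?case by (simp add: map_bind_pmf bind_map_pmf flip: Suc)
qed simp

lemma map_unsourced_source: "map_pmf unsourced (source p q Y) = rnoise p Y"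
proof -
  have "map_pmf unsourced (source p q Y) = map_pmf (Pair 1) (map_pmf snd (source p q Y))"
    by (simp add: map_pmf_comp unsourced_def[abs_def])
  then show ?thesis
    by (simp add: rnoise_def source_def map_snd_pair_pmf)
qed

text \<open>Erasing the source puts the true row process and the stationary one on the same
  coins.\<close>

lemma replicate_rnoise:
  "replicate_pmf t (rnoise p Y) = map_pmf (\<lambda>(d, ns). map unsourced ns) (joint p v q Y t)"
proof -
  have "map_pmf (\<lambda>(d, ns). map unsourced ns) (joint p v q Y t)
      = map_pmf (map unsourced) (map_pmf snd (joint p v q Y t))"
    by (simp add: map_pmf_comp case_prod_unfold)
  then show ?thesis
    by (simp add: joint_def map_snd_pair_pmf map_replicate_pmf map_unsourced_source)
qed

lemma set_joint:
  assumes "(d, ns) \<in> set_pmf (joint p v q Y t)"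
  shows "length ns = t" "\<And>n. n \<in> set ns \<Longrightarrow> fst n \<ge> 1"
proof -
  have ns: "ns \<in> set_pmf (replicate_pmf t (source p q Y))"
    using assms by (simp add: joint_def)
  show "length ns = t" using ns by (simp add: set_replicate_pmf)
  fix n assume "n \<in> set ns"
  then have "n \<in> set_pmf (source p q Y)" using ns by (auto simp: set_replicate_pmf in_lists_conv_set)
  then show "fst n \<ge> 1" by (auto simp: source_def)
qed

lemma set_replicate_rnoise:
  assumes "ns \<in> set_pmf (replicate_pmf t (rnoise p Y))"
  shows "length ns = t" "\<And>n. n \<in> set ns \<Longrightarrow> fst n = 1"
  using assms by (auto simp: set_replicate_pmf rnoise_def in_lists_conv_set)

lemma prob_mono_pmf:
  assumes "\<And>x. x \<in> set_pmf P \<Longrightarrow> x \<in> A \<Longrightarrow> x \<in> B"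
  shows "measure_pmf.prob P A \<le> measure_pmf.prob P B"
  by (rule measure_pmf.finite_measure_mono_AE) (use assms in \<open>auto simp: AE_measure_pmf_iff\<close>)

lemma prob_Un_le: "measure_pmf.prob P (A \<union> B) \<le> measure_pmf.prob P A + measure_pmf.prob P B"
  by (rule measure_Un_le) auto

lemma prob_UN_le:
  "finite I \<Longrightarrow> measure_pmf.prob P (\<Union>i\<in>I. A i) \<le> (\<Sum>i\<in>I. measure_pmf.prob P (A i))"
  by (rule measure_UNION_le) auto

lemma stationary_deviation:
  assumes bal: "balanced p v q" and "\<epsilon> > 0"
  defines "\<eta> \<equiv> 1 / (1 - q)"
  obtains c where "c > 0"
    "\<And>t Y y s. y \<le> Y \<Longrightarrow> y \<le> 3 * t \<Longrightarrow> s \<in> {1, -1} \<Longrightarrow>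
       measure_pmf.prob (incs v q Y) {d. s * of_int (psum d y) \<ge> s * (real y * (v - \<eta>)) + \<epsilon> * real t}
       \<le> exp (- c * real t)"
    "\<And>t Y s. s \<in> {1, -1} \<Longrightarrow>
       measure_pmf.prob (replicate_pmf t (source p q Y))
         {ns. s * of_int (sum_list (map fst ns)) \<ge> s * (real t * \<eta>) + \<epsilon> * real t}
       \<le> exp (- c * real t)"
proof -
  have v: "0 \<le> v" "v \<le> 1" and q: "0 \<le> q" "q < 1"
    using bal by (auto simp: balanced_def)
  have "\<exists>c>0. (\<forall>t Y y. y \<le> Y \<longrightarrow> y \<le> 3 * t \<longrightarrow>
       measure_pmf.prob (incs v q Y) {d. s * of_int (psum d y) \<ge> s * (real y * (v - \<eta>)) + \<epsilon> * real t}
       \<le> exp (- c * real t)) \<and>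
    (\<forall>t Y. measure_pmf.prob (replicate_pmf t (source p q Y))
         {ns. s * of_int (sum_list (map fst ns)) \<ge> s * (real t * \<eta>) + \<epsilon> * real t}
       \<le> exp (- c * real t))" for s :: real
  proof -
    obtain c where c: "c > 0" "\<And>t A d I. finite A \<Longrightarrow> I \<subseteq> A \<Longrightarrow> card I \<le> 3 * t \<Longrightarrow>
       measure_pmf.prob (Pi_pmf (A :: nat set) d (\<lambda>_. map_pmf dval (uv v q)))
         {y. (\<Sum>i\<in>I. s * real_of_int (y i)) \<ge> real (card I) * (s * (v - 1 / (1 - q))) + \<epsilon> * real t}
       \<le> exp (- c * real t)"
      by (rule chernoff[OF cgf_bound_inc[OF v q, of s] \<open>\<epsilon> > 0\<close>]) blast
    obtain c' where c': "c' > 0" "\<And>t. measure_pmf.prob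
       (replicate_pmf t (map_pmf (\<lambda>k. 1 + int k) (geometric_pmf (1 - q))))
         {xs. (\<Sum>x\<leftarrow>xs. s * real_of_int x) \<ge> real t * (s * (1 / (1 - q)) + \<epsilon>)} \<le> exp (- c' * real t)"
      by (rule chernoff[OF cgf_bound_source[OF v q, of s] \<open>\<epsilon> > 0\<close>]) blast
    have mono: "exp (- c * real t) \<le> exp (- min c c' * real t)"
      "exp (- c' * real t) \<le> exp (- min c c' * real t)" for t
      by (auto intro!: mult_right_mono)
    have 1: "measure_pmf.prob (incs v q Y) {d. s * of_int (psum d y) \<ge> s * (real y * (v - \<eta>)) + \<epsilon> * real t}
       \<le> exp (- c * real t)" if "y \<le> Y" "y \<le> 3 * t" for t Y y :: nat
      using c(2)[of "{1..Y}" "{1..y}" t 0] that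
      by (simp add: incs_def psum_def \<eta>_def sum_distrib_left mult_ac)
    have list: "(\<Sum>n\<leftarrow>ns. s * real_of_int (fst n)) = s * of_int (sum_list (map fst ns))"
      for ns :: "(int \<times> (nat \<Rightarrow> bool)) list"
      by (induction ns) (simp_all add: algebra_simps)
    have law: "map_pmf (map fst) (replicate_pmf t (source p q Y))
        = replicate_pmf t (map_pmf (\<lambda>k. 1 + int k) (geometric_pmf (1 - q)))" for t Y
      by (simp add: map_replicate_pmf source_def map_fst_pair_pmf)
    have 2: "measure_pmf.prob (replicate_pmf t (source p q Y))
         {ns. s * of_int (sum_list (map fst ns)) \<ge> s * (real t * \<eta>) + \<epsilon> * real t}
       \<le> exp (- c' * real t)" for t Y
      using c'(2)[of t, folded law[of t Y]]
      by (simp add: vimage_def comp_def list \<eta>_def algebra_simps)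
    show ?thesis
      by (intro exI[of _ "min c c'"] conjI allI impI order_trans[OF 1 mono(1)] order_trans[OF 2 mono(2)])
         (use c c' in auto)
  qed
  from this[of 1] this[of "-1"] obtain c c' where c: "c > 0" "c' > 0" and *:
    "\<And>t Y y. y \<le> Y \<Longrightarrow> y \<le> 3 * t \<Longrightarrow>
       measure_pmf.prob (incs v q Y) {d. 1 * of_int (psum d y) \<ge> 1 * (real y * (v - \<eta>)) + \<epsilon> * real t}
       \<le> exp (- c * real t)"
    "\<And>t Y. measure_pmf.prob (replicate_pmf t (source p q Y))
         {ns. 1 * of_int (sum_list (map fst ns)) \<ge> 1 * (real t * \<eta>) + \<epsilon> * real t}
       \<le> exp (- c * real t)"
    "\<And>t Y y. y \<le> Y \<Longrightarrow> y \<le> 3 * t \<Longrightarrow>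
       measure_pmf.prob (incs v q Y) {d. - 1 * of_int (psum d y) \<ge> - 1 * (real y * (v - \<eta>)) + \<epsilon> * real t}
       \<le> exp (- c' * real t)"
    "\<And>t Y. measure_pmf.prob (replicate_pmf t (source p q Y))
         {ns. - 1 * of_int (sum_list (map fst ns)) \<ge> - 1 * (real t * \<eta>) + \<epsilon> * real t}
       \<le> exp (- c' * real t)"
    by blast
  have mono: "exp (- c * real t) \<le> exp (- min c c' * real t)"
      "exp (- c' * real t) \<le> exp (- min c c' * real t)" for t
      by (auto intro!: mult_right_mono)
  show thesis
  proof (rule that[of "min c c'"])
    show "min c c' > 0" using c by simp
  next
    fix t Y y :: nat and s :: real assume a: "y \<le> Y" "y \<le> 3 * t" "s \<in> {1, -1}"
    show "measure_pmf.prob (incs v q Y) {d. s * of_int (psum d y) \<ge> s * (real y * (v - \<eta>)) + \<epsilon> * real t}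
       \<le> exp (- min c c' * real t)"
      using a(3) order_trans[OF *(1)[OF a(1,2)] mono(1)] order_trans[OF *(3)[OF a(1,2)] mono(2)]
      by (elim insertE) (simp_all only: singleton_iff empty_iff)
  next
    fix t Y :: nat and s :: real assume a: "s \<in> {1, -1}"
    show "measure_pmf.prob (replicate_pmf t (source p q Y))
         {ns. s * of_int (sum_list (map fst ns)) \<ge> s * (real t * \<eta>) + \<epsilon> * real t}
       \<le> exp (- min c c' * real t)"
      using a order_trans[OF *(2) mono(1)] order_trans[OF *(4) mono(2)]
      by (elim insertE) (simp_all only: singleton_iff empty_iff)
  qed
qed

text \<open>The value in row \<open>y\<close> is the total of the source plus the increments after
  the run. Both have known laws, the second one by stationarity, and a union bound needs no
  independence between them.\<close>

lemma stationary_run_deviation: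
  assumes bal: "balanced p v q" and "\<epsilon> > 0"
  defines "\<eta> \<equiv> 1 / (1 - q)"
  obtains c where "c > 0"
    "\<And>t Y y s. y \<le> Y \<Longrightarrow> y \<le> 3 * t \<Longrightarrow> s \<in> {1, -1} \<Longrightarrow>
       measure_pmf.prob (joint p v q Y t) {(d, ns). s * of_int (psum d y) \<ge> s * (real y * (v - \<eta>)) + \<epsilon> * real t}
       \<le> exp (- c * real t)"
    "\<And>t Y y s. y \<le> Y \<Longrightarrow> y \<le> 3 * t \<Longrightarrow> s \<in> {1, -1} \<Longrightarrow>
       measure_pmf.prob (joint p v q Y t) {(d, ns). s * of_int (run ns (psum d) y) \<ge>
         s * (real t * \<eta> + real y * (v - \<eta>)) + 2 * \<epsilon> * real t}
       \<le> 2 * exp (- c * real t)"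
proof -
  from stationary_deviation[OF bal \<open>\<epsilon> > 0\<close>, folded \<eta>_def] obtain c where c: "c > 0"
    and 1: "\<And>t Y y s. y \<le> Y \<Longrightarrow> y \<le> 3 * t \<Longrightarrow> s \<in> {1, -1} \<Longrightarrow>
       measure_pmf.prob (incs v q Y) {d. s * of_int (psum d y) \<ge> s * (real y * (v - \<eta>)) + \<epsilon> * real t}
       \<le> exp (- c * real t)"
    and 2: "\<And>t Y s. s \<in> {1, -1} \<Longrightarrow>
       measure_pmf.prob (replicate_pmf t (source p q Y))
         {ns. s * of_int (sum_list (map fst ns)) \<ge> s * (real t * \<eta>) + \<epsilon> * real t}
       \<le> exp (- c * real t)"
    by blast
  show thesis
  proof (rule that[OF c])
    fix t Y y :: nat and s :: real assume a: "y \<le> Y" "y \<le> 3 * t" "s \<in> {1, -1}"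
    have law_d: "map_pmf fst (joint p v q Y t) = incs v q Y"
      by (simp add: joint_def map_fst_pair_pmf)
    show i: "measure_pmf.prob (joint p v q Y t) {(d, ns). s * of_int (psum d y) \<ge> s * (real y * (v - \<eta>)) + \<epsilon> * real t}
       \<le> exp (- c * real t)"
      using 1[OF a, folded law_d] by (simp add: vimage_def case_prod_unfold)
    have law_ns: "map_pmf snd (joint p v q Y t) = replicate_pmf t (source p q Y)"
      by (simp add: joint_def map_snd_pair_pmf)
    have ii: "measure_pmf.prob (joint p v q Y t) {(d, ns). s * of_int (sum_list (map fst ns)) \<ge> s * (real t * \<eta>) + \<epsilon> * real t}
       \<le> exp (- c * real t)"
      using 2[OF a(3), of t Y, folded law_ns] by (simp add: vimage_def case_prod_unfold)
    have law_run: "map_pmf (\<lambda>(d, ns). inc Y (run ns (psum d))) (joint p v q Y t) = incs v q Y"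
      unfolding joint_def using bal by (intro incs_run) (auto simp: balanced_def)
    have iii: "measure_pmf.prob (joint p v q Y t) {(d, ns). s * of_int (psum (inc Y (run ns (psum d))) y) \<ge> s * (real y * (v - \<eta>)) + \<epsilon> * real t}
       \<le> exp (- c * real t)"
      using 1[OF a, folded law_run] by (simp add: vimage_def case_prod_unfold)
    have dec: "run ns (psum d) y = sum_list (map fst ns) + psum (inc Y (run ns (psum d))) y" for d ns
      using psum_inc[OF a(1), of "run ns (psum d)"] run_row_0[of ns "psum d"] by simp
    have "measure_pmf.prob (joint p v q Y t) {(d, ns). s * of_int (run ns (psum d) y) \<ge>
         s * (real t * \<eta> + real y * (v - \<eta>)) + 2 * \<epsilon> * real t}
      \<le> measure_pmf.prob (joint p v q Y t)
         ({(d, ns). s * of_int (sum_list (map fst ns)) \<ge> s * (real t * \<eta>) + \<epsilon> * real t} \<union>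
          {(d, ns). s * of_int (psum (inc Y (run ns (psum d))) y) \<ge> s * (real y * (v - \<eta>)) + \<epsilon> * real t})"
      by (rule prob_mono_pmf) (auto simp: dec distrib_left)
    also have "\<dots> \<le> exp (- c * real t) + exp (- c * real t)"
      by (rule order_trans[OF prob_Un_le]) (intro add_mono ii iii)
    finally show "measure_pmf.prob (joint p v q Y t) {(d, ns). s * of_int (run ns (psum d) y) \<ge>
         s * (real t * \<eta> + real y * (v - \<eta>)) + 2 * \<epsilon> * real t}
       \<le> 2 * exp (- c * real t)" by simp
  qed
qed

text \<open>A point start lies below the stationary profile translated to pass through the point,
  apart from the background \<open>- C\<close>, which cannot reach \<open>a\<close> in time. Of the
  three deviation terms two belong to the stationary run and one to the initial profile at row
  \<open>j\<close>.\<close>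

lemma point_upper_bound:
  assumes bal: "balanced p v q" and "\<epsilon> > 0"
  defines "\<eta> \<equiv> 1 / (1 - q)"
  obtains c where "c > 0"
    "\<And>t Y y j k C a. j \<le> y \<Longrightarrow> y \<le> Y \<Longrightarrow> Y \<le> 3 * t \<Longrightarrow>
       real_of_int k + real t * \<eta> + (real y - real j) * (v - \<eta>) + 3 * \<epsilon> * real t \<le> a \<Longrightarrow>
       real t - of_int C < a \<Longrightarrow>
       measure_pmf.prob (replicate_pmf t (rnoise p Y)) {ns. of_int (run ns (pt j k C) y) \<ge> a}
       \<le> 3 * exp (- c * real t)"
proof -
  from stationary_run_deviation[OF bal \<open>\<epsilon> > 0\<close>, folded \<eta>_def] obtain c where c: "c > 0"
    and 1: "\<And>t Y y s. y \<le> Y \<Longrightarrow> y \<le> 3 * t \<Longrightarrow> s \<in> {1, -1} \<Longrightarrow>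
       measure_pmf.prob (joint p v q Y t) {(d, ns). s * of_int (psum d y) \<ge> s * (real y * (v - \<eta>)) + \<epsilon> * real t}
       \<le> exp (- c * real t)"
    and 2: "\<And>t Y y s. y \<le> Y \<Longrightarrow> y \<le> 3 * t \<Longrightarrow> s \<in> {1, -1} \<Longrightarrow>
       measure_pmf.prob (joint p v q Y t) {(d, ns). s * of_int (run ns (psum d) y) \<ge>
         s * (real t * \<eta> + real y * (v - \<eta>)) + 2 * \<epsilon> * real t}
       \<le> 2 * exp (- c * real t)"
    by blast
  show thesis
  proof (rule that[OF c])
    fix t Y y j :: nat and k C :: int and a :: real
    assume j: "j \<le> y" "y \<le> Y" "Y \<le> 3 * t"
      and a: "real_of_int k + real t * \<eta> + (real y - real j) * (v - \<eta>) + 3 * \<epsilon> * real t \<le> a"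
      and C: "real t - of_int C < a"
    let ?J = "joint p v q Y t"
    have "measure_pmf.prob (replicate_pmf t (rnoise p Y)) {ns. of_int (run ns (pt j k C) y) \<ge> a}
        = measure_pmf.prob ?J {(d, ns). of_int (run (map unsourced ns) (pt j k C) y) \<ge> a}"
      unfolding replicate_rnoise[of t p Y v q] by (simp add: vimage_def case_prod_unfold)
    also have "\<dots> \<le> measure_pmf.prob ?J
        ({(d, ns). 1 * of_int (run ns (psum d) y) \<ge> 1 * (real t * \<eta> + real y * (v - \<eta>)) + 2 * \<epsilon> * real t} \<union>
         {(d, ns). - 1 * of_int (psum d j) \<ge> - 1 * (real j * (v - \<eta>)) + \<epsilon> * real t})"
    proof (rule prob_mono_pmf, clarify)
      fix d ns assume s: "(d, ns) \<in> set_pmf ?J"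
        and r: "a \<le> of_int (run (map unsourced ns) (pt j k C) y)"
        and n: "\<not> - 1 * of_int (psum d j) \<ge> - 1 * (real j * (v - \<eta>)) + \<epsilon> * real t"
      let ?G = "\<lambda>i. psum d i + (k - psum d j)"
      have "\<exists>F\<in>{?G, \<lambda>_. - C}. run (map unsourced ns) (pt j k C) y \<le> run (map unsourced ns) F y"
        by (rule run_cover[of y]) (auto simp: pt_def)
      moreover have "run (map unsourced ns) (\<lambda>_. - C) y \<le> - C + int t"
        using run_le[of y "\<lambda>_. - C" "- C" y ns] set_joint(1)[OF s] by simp
      then have "of_int (run (map unsourced ns) (\<lambda>_. - C) y) < a"
        using C by linarith
      ultimately have "run (map unsourced ns) (pt j k C) y \<le> run (map unsourced ns) ?G y"
        using r by auto
      also have "\<dots> \<le> run ns ?G y"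
        by (rule run_unsourced_le) (rule set_joint(2)[OF s])
      also have "\<dots> = run ns (psum d) y + (k - psum d j)"
        by (simp add: run_shift)
      finally have "a \<le> of_int (run ns (psum d) y) + (of_int k - of_int (psum d j))"
        using r by linarith
      with n a show "1 * of_int (run ns (psum d) y) \<ge> 1 * (real t * \<eta> + real y * (v - \<eta>)) + 2 * \<epsilon> * real t"
        by (simp add: algebra_simps)
    qed
    also have "\<dots> \<le> 2 * exp (- c * real t) + exp (- c * real t)"
      using j by (intro order_trans[OF prob_Un_le] add_mono 1 2) auto
    finally show "measure_pmf.prob (replicate_pmf t (rnoise p Y)) {ns. of_int (run ns (pt j k C) y) \<ge> a}
       \<le> 3 * exp (- c * real t)" by simp
  qed
qed

section \<open>Exit decomposition\<close>

text \<open>In the coordinate \<open>w = v - p\<close> the speed of the source is affine in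
  \<open>1 / w\<close>, and \<open>q < 1\<close> becomes \<open>0 < w\<close>.\<close>

lemma balanced_params:
  assumes "0 < p" "p < 1" "0 < w" "w \<le> 1 - p"
  defines "v \<equiv> p + w"
  defines "q \<equiv> p * (1 - v) / (v * (1 - p))"
  shows "balanced p v q" "1 / (1 - q) = 1 - p + p * (1 - p) / w"
proof -
  have v: "0 < v" "v \<le> 1" "p < v" using assms by (auto simp: v_def)
  have "1 - q = (v * (1 - p) - p * (1 - v)) / (v * (1 - p))"
    using v assms(1,2) by (simp add: q_def diff_divide_distrib)
  also have "v * (1 - p) - p * (1 - v) = w" by (simp add: v_def algebra_simps)
  finally have q: "1 - q = w / (v * (1 - p))" .
  moreover have "w / (v * (1 - p)) > 0" using v assms by simp
  ultimately have "q < 1" by linarith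
  moreover have "0 \<le> q" using v assms(1,2) by (simp add: q_def)
  ultimately show "balanced p v q"
    using v assms(1,2) by (simp add: balanced_def q_def)
  show "1 / (1 - q) = 1 - p + p * (1 - p) / w"
    unfolding q using assms(1-3) by (simp add: v_def field_simps)
qed

text \<open>Suppose that the stationary run is not too low at row \<open>Y\<close>, the initial
  profile is nowhere too high, and no exit row outside the window
  \<open>{j\<^sub>0..j\<^sub>0 + s}\<close> does too well. Then the value at \<open>Y\<close> comes
  from the window, and a point start at \<open>j\<^sub>0\<close> with \<open>s\<close> extra steps
  dominates the whole window. The condition \<open>t < Y\<close> hides the source from row
  \<open>Y\<close>.\<close>

lemma exit_decomposition:
  fixes \<mu> e c\<^sub>0 :: real
  assumes n: "n \<le> Y" "s \<le> n" and t: "t < Y" and \<mu>: "\<mu> \<le> 0"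
  defines "j\<^sub>0 \<equiv> Y - n"
  defines "k \<equiv> \<lambda>j. \<lfloor>real j * \<mu> + e\<rfloor>"
  shows "measure_pmf.prob (replicate_pmf (s + t) (rnoise p Y))
           {ns. of_int (run ns (pt j\<^sub>0 0 C) Y) < c\<^sub>0 - of_int (k j\<^sub>0)}
    \<le> measure_pmf.prob (joint p v q Y t) {(d, ns). of_int (run ns (psum d) Y) < c\<^sub>0}
    + (\<Sum>j\<le>Y. measure_pmf.prob (joint p v q Y t) {(d, ns). of_int (psum d j) > real j * \<mu> + e})
    + (\<Sum>j\<in>{..Y} - {j\<^sub>0..j\<^sub>0 + s}. measure_pmf.prob (replicate_pmf t (rnoise p Y))
         {ns. of_int (run ns (pt j (k j) (C - k j\<^sub>0)) Y) \<ge> c\<^sub>0})"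
proof -
  let ?J = "joint p v q Y t" and ?R = "\<lambda>t. replicate_pmf t (rnoise p Y)"
  let ?C = "C - k j\<^sub>0" and ?far = "{..Y} - {j\<^sub>0..j\<^sub>0 + s}"
  \<comment> \<open>The window as one profile; as \<open>\<mu> \<le> 0\<close>, the bound at its
    lowest row is the largest.\<close>
  define Win where "Win i = (if i \<in> {j\<^sub>0..j\<^sub>0 + s} then k j\<^sub>0 else - ?C)" for i
  define A1 where "A1 = {(d :: nat \<Rightarrow> int, ns). of_int (run ns (psum d) Y) < c\<^sub>0}"
  define A2 where "A2 j = {(d, ns :: (int \<times> (nat \<Rightarrow> bool)) list). of_int (psum d j) > real j * \<mu> + e}" for j
  define A3 where "A3 j = {(d :: nat \<Rightarrow> int, ns). of_int (run (map unsourced ns) (pt j (k j) ?C) Y) \<ge> c\<^sub>0}" for j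
  define A4 where "A4 = {(d :: nat \<Rightarrow> int, ns). of_int (run (map unsourced ns) Win Y) \<ge> c\<^sub>0}"
  have rnoise: "measure_pmf.prob (?R t) {ns. Q ns} = measure_pmf.prob ?J {(d, ns). Q (map unsourced ns)}" for Q
    unfolding replicate_rnoise[of t p Y v q] by (simp add: vimage_def case_prod_unfold)
  have k_window: "k j \<le> k j\<^sub>0" if "j\<^sub>0 \<le> j" for j
  proof -
    have "real j * \<mu> \<le> real j\<^sub>0 * \<mu>" using that \<mu> by (intro mult_right_mono_neg) auto
    then show ?thesis unfolding k_def by (intro floor_mono) simp
  qed
  have "(d, ns) \<in> A1 \<union> (\<Union>j\<le>Y. A2 j) \<union> (\<Union>j\<in>?far. A3 j) \<union> A4"
    if dn: "(d, ns) \<in> set_pmf ?J" for d ns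
  proof (rule ccontr)
    assume n: "\<not> ?thesis"
    then have "\<And>j. j \<le> Y \<Longrightarrow> of_int (psum d j) \<le> real j * \<mu> + e" by (force simp: A2_def)
    then have psum: "\<And>j. j \<le> Y \<Longrightarrow> psum d j \<le> k j" by (simp add: k_def le_floor_iff)
    have "\<exists>F\<in>insert Win ((\<lambda>j. pt j (k j) ?C) ` ?far). run (map unsourced ns) (psum d) Y \<le> run (map unsourced ns) F Y"
    proof (rule run_cover[of Y])
      fix i assume i: "i \<le> Y"
      show "\<exists>F\<in>insert Win ((\<lambda>j. pt j (k j) ?C) ` ?far). psum d i \<le> F i"
      proof (cases "i \<in> {j\<^sub>0..j\<^sub>0 + s}")
        case True
        then have "psum d i \<le> Win i"
          using psum[OF i] k_window[of i] by (simp add: Win_def)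
        then show ?thesis by blast
      next
        case False
        then show ?thesis using i psum[OF i] by (intro bexI[of _ "pt i (k i) ?C"]) (auto simp: pt_def)
      qed
    qed simp
    then obtain F where F: "F \<in> insert Win ((\<lambda>j. pt j (k j) ?C) ` ?far)"
      "run (map unsourced ns) (psum d) Y \<le> run (map unsourced ns) F Y" by blast
    moreover have "run (map unsourced ns) (psum d) Y = run ns (psum d) Y"
      using t set_joint(1)[OF dn] by (intro run_unsourced_local) auto
    moreover have "c\<^sub>0 \<le> of_int (run ns (psum d) Y)" using n by (simp add: A1_def)
    ultimately have "c\<^sub>0 \<le> of_int (run (map unsourced ns) F Y)" by linarith
    with F(1) n show False by (auto simp: A3_def A4_def)
  qed
  \<comment> \<open>The four events cover everything, so their probabilities sum to at least 1. The
    last of them is then bounded by the complement of the event in the claim.\<close>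
  then have "measure_pmf.prob ?J UNIV \<le> measure_pmf.prob ?J (A1 \<union> (\<Union>j\<le>Y. A2 j) \<union> (\<Union>j\<in>?far. A3 j) \<union> A4)"
    by (intro prob_mono_pmf) auto
  also have "\<dots> \<le> measure_pmf.prob ?J A1 + (\<Sum>j\<le>Y. measure_pmf.prob ?J (A2 j))
      + (\<Sum>j\<in>?far. measure_pmf.prob ?J (A3 j)) + measure_pmf.prob ?J A4"
    by (intro order_trans[OF prob_Un_le] add_mono order_refl prob_UN_le) auto
  also have "(\<Sum>j\<in>?far. measure_pmf.prob ?J (A3 j)) = (\<Sum>j\<in>?far. measure_pmf.prob (?R t)
         {ns. of_int (run ns (pt j (k j) ?C) Y) \<ge> c\<^sub>0})"
    by (simp add: rnoise A3_def)
  also have "measure_pmf.prob ?J A4 = measure_pmf.prob (?R t) {ns. of_int (run ns Win Y) \<ge> c\<^sub>0}"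
    by (simp add: rnoise A4_def)
  \<comment> \<open>An independent list of \<open>s\<close> noises is put in front: the time in
    which a point start fills the window.\<close>
  also have "\<dots> = measure_pmf.prob (pair_pmf (?R s) (?R t)) {(ms, ns). of_int (run ns Win Y) \<ge> c\<^sub>0}"
    by (subst (1) map_snd_pair_pmf[of "?R s" "?R t", symmetric])
       (simp add: vimage_def case_prod_unfold)
  also have "\<dots> \<le> measure_pmf.prob (pair_pmf (?R s) (?R t))
      {(ms, ns). of_int (run (ms @ ns) (pt j\<^sub>0 0 C) Y) \<ge> c\<^sub>0 - of_int (k j\<^sub>0)}"
  proof (rule prob_mono_pmf, clarify)
    fix ms ns assume m: "(ms, ns) \<in> set_pmf (pair_pmf (?R s) (?R t))" and r: "c\<^sub>0 \<le> of_int (run ns Win Y)"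
    then have ms: "length ms = s" "\<And>m. m \<in> set ms \<Longrightarrow> fst m \<ge> 1"
      using set_replicate_rnoise[of ms s p Y] by auto
    have "run ns Win Y \<le> run ns (\<lambda>i. run ms (pt j\<^sub>0 0 C) i + k j\<^sub>0) Y"
    proof (rule run_mono[of Y])
      fix i
      have "- C \<le> run ms (pt j\<^sub>0 0 C) i" if "i \<noteq> j\<^sub>0"
        using run_ge[of ms 0 "pt j\<^sub>0 0 C" i] ms that by (simp add: pt_def)
      moreover have "0 \<le> run ms (pt j\<^sub>0 0 C) i" if "i \<in> {j\<^sub>0..j\<^sub>0 + s}"
      proof -
        have "i - j\<^sub>0 \<le> length ms" "j\<^sub>0 + (i - j\<^sub>0) = i" using that ms(1) by auto
        then show ?thesis using run_ge[of ms "i - j\<^sub>0" "pt j\<^sub>0 0 C" j\<^sub>0] ms(2) by (simp add: pt_def)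
      qed
      ultimately show "Win i \<le> run ms (pt j\<^sub>0 0 C) i + k j\<^sub>0" by (auto simp: Win_def)
    qed simp
    then have "run ns Win Y \<le> run (ms @ ns) (pt j\<^sub>0 0 C) Y + k j\<^sub>0"
      by (simp add: run_shift)
    with r show "of_int (run (ms @ ns) (pt j\<^sub>0 0 C) Y) \<ge> c\<^sub>0 - of_int (k j\<^sub>0)" by linarith
  qed
  also have "\<dots> = measure_pmf.prob (?R (s + t)) {ns. of_int (run ns (pt j\<^sub>0 0 C) Y) \<ge> c\<^sub>0 - of_int (k j\<^sub>0)}"
  proof -
    have "?R (s + t) = map_pmf (\<lambda>(ms, ns). ms @ ns) (pair_pmf (?R s) (?R t))"
      by (simp add: replicate_pmf_distrib pair_pmf_def map_pmf_def bind_assoc_pmf bind_return_pmf)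
    then show ?thesis by (simp add: vimage_def case_prod_unfold)
  qed
  also have "\<dots> = 1 - measure_pmf.prob (?R (s + t)) {ns. of_int (run ns (pt j\<^sub>0 0 C) Y) < c\<^sub>0 - of_int (k j\<^sub>0)}"
    by (subst measure_pmf.prob_compl[symmetric]) (auto intro!: arg_cong[of _ _ "measure_pmf.prob _"])
  finally show ?thesis by (simp add: A1_def A2_def)
qed

text \<open>The start row \<open>j\<close> and the number \<open>Y\<close> of rows with coins stay
  free: the proof wants the target far above row 0, and the site dynamics can serve any
  \<open>j\<close>. With \<open>int T < C\<close>, rows not reached from row \<open>j\<close> remain
  negative throughout.\<close>

definition row_speed :: "real \<Rightarrow> real \<Rightarrow> real \<Rightarrow> bool" where
  "row_speed p a \<kappa> \<longleftrightarrow> (\<exists>c>0. \<forall>\<^sub>F T in sequentially. \<exists>j Y C. int T < C \<and>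
     measure_pmf.prob (replicate_pmf T (rnoise p Y))
       {ns. of_int (run ns (pt j 0 C) (j + nat \<lfloor>a * real T\<rfloor>)) < \<kappa> * real T} \<le> exp (- c * real T))"

lemma row_speed_deterministic:
  assumes "\<And>T. \<exists>j Y C. int T < C \<and> (\<forall>ns\<in>set_pmf (replicate_pmf T (rnoise p Y)).
     \<kappa> * real T \<le> of_int (run ns (pt j 0 C) (j + nat \<lfloor>a * real T\<rfloor>)))"
  shows "row_speed p a \<kappa>"
  unfolding row_speed_def
proof (rule exI[of _ 1], intro conjI always_eventually allI)
  fix T
  obtain j Y C where j: "int T < C" "\<And>ns. ns \<in> set_pmf (replicate_pmf T (rnoise p Y)) \<Longrightarrow>
     \<kappa> * real T \<le> of_int (run ns (pt j 0 C) (j + nat \<lfloor>a * real T\<rfloor>))"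
    using assms[of T] by blast
  have "measure_pmf.prob (replicate_pmf T (rnoise p Y))
       {ns. of_int (run ns (pt j 0 C) (j + nat \<lfloor>a * real T\<rfloor>)) < \<kappa> * real T}
     \<le> measure_pmf.prob (replicate_pmf T (rnoise p Y)) {}"
    using j(2) by (intro prob_mono_pmf) force
  then show "\<exists>j Y C. int T < C \<and> measure_pmf.prob (replicate_pmf T (rnoise p Y))
       {ns. of_int (run ns (pt j 0 C) (j + nat \<lfloor>a * real T\<rfloor>)) < \<kappa> * real T} \<le> exp (- 1 * real T)"
    using j(1) by (intro exI[of _ j] exI[of _ Y] exI[of _ C]) (auto intro: order_trans)
qed simp

text \<open>The coins are ignored: climbing steps gain nothing, all others gain 1. At p = 0 this is
  sharp, as \<phi> is then 1 - a.\<close>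

lemma row_speed_0:
  assumes "0 \<le> a" "a \<le> 1" "\<kappa> \<le> 1 - a"
  shows "row_speed p a \<kappa>"
proof (rule row_speed_deterministic, intro exI conjI ballI)
  fix T ns assume ns: "ns \<in> set_pmf (replicate_pmf T (rnoise p 0))"
  let ?n = "nat \<lfloor>a * real T\<rfloor>"
  have n: "real ?n \<le> a * real T" using assms by simp
  have "a * real T \<le> 1 * real T" using assms by (intro mult_right_mono) auto
  with n have "?n \<le> T" by simp
  then have "pt 0 0 (int T + 1) 0 + int T - int ?n \<le> run ns (pt 0 0 (int T + 1)) (0 + ?n)"
    using run_ge[of ns ?n "pt 0 0 (int T + 1)" 0] set_replicate_rnoise[OF ns] by simp
  moreover have "\<kappa> * real T \<le> (1 - a) * real T" using assms by (intro mult_right_mono) auto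
  ultimately show "\<kappa> * real T \<le> of_int (run ns (pt 0 0 (int T + 1)) (0 + ?n))"
    using n by (simp add: pt_def algebra_simps)
qed simp

lemma run_all_True:
  assumes "\<And>n. n \<in> set ns \<Longrightarrow> fst n = 1"
    and "\<And>n i. n \<in> set ns \<Longrightarrow> i \<in> {1..Y} \<Longrightarrow> snd n i" and "i \<le> Y" "i \<le> length ns"
  shows "D 0 + int (length ns) \<le> run ns D i"
proof -
  have "D j + int (length ns) \<le> run ns D (j + i)" if "i \<le> length ns" "j + i \<le> Y" for i j
    using assms(1,2) that
  proof (induction ns arbitrary: D i j)
    case (Cons n ns)
    show ?case
    proof (cases "i \<le> length ns")
      case True
      have "D j + 1 \<le> rstep n D j" using Cons.prems(1)[of n] by (cases j) (auto simp: rstep_def)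
      also have "rstep n D j + int (length ns) \<le> run ns (rstep n D) (j + i)"
        using Cons True by auto
      finally show ?thesis by simp
    next
      case False
      then have i: "i = Suc (length ns)" using Cons.prems by simp
      have "D j + 1 \<le> rstep n D (Suc j)"
        using Cons.prems(2)[of n "Suc j"] Cons.prems(4) i by auto
      also have "rstep n D (Suc j) + int (length ns) \<le> run ns (rstep n D) (Suc j + length ns)"
        using Cons.prems i by (intro Cons.IH) auto
      finally show ?thesis using i by simp
    qed
  qed simp
  from this[of i 0] assms(3,4) show ?thesis by simp
qed

text \<open>At p = 1 every step gains 1, climbing or not.\<close>

lemma row_speed_1:
  assumes "0 \<le> a" "a \<le> 1" "\<kappa> \<le> 1"
  shows "row_speed 1 a \<kappa>"
proof (rule row_speed_deterministic, intro exI conjI ballI)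
  fix T ns assume ns: "ns \<in> set_pmf (replicate_pmf T (rnoise 1 T))"
  let ?n = "nat \<lfloor>a * real T\<rfloor>"
  have "a * real T \<le> 1 * real T" using assms by (intro mult_right_mono) auto
  then have n: "?n \<le> T" by linarith
  have "snd n i" if "n \<in> set ns" "i \<in> {1..T}" for n i
  proof -
    have "n \<in> set_pmf (rnoise 1 T)" using ns that by (auto simp: set_replicate_pmf in_lists_conv_set)
    then have "snd n \<in> set_pmf (bern 1 {1..T})" by (auto simp: rnoise_def)
    then show ?thesis using that(2) by (auto simp: bern_def set_Pi_pmf PiE_dflt_def set_pmf_iff)
  qed
  then have "pt 0 0 (int T + 1) 0 + int T \<le> run ns (pt 0 0 (int T + 1)) ?n"
    using run_all_True[of ns T ?n "pt 0 0 (int T + 1)"] set_replicate_rnoise[OF ns] n by auto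
  moreover have "\<kappa> * real T \<le> 1 * real T" using assms by (intro mult_right_mono) auto
  ultimately show "\<kappa> * real T \<le> of_int (run ns (pt 0 0 (int T + 1)) (0 + ?n))"
    by (simp add: pt_def)
qed simp

text \<open>Perturbing the optimal parameter \<open>w\<close> in either direction improves the upper bound
  by a linear amount for exit rows away from the characteristic one.\<close>

lemma perturbed_bound:
  fixes p w w' \<rho> t i :: real
  assumes "w > 0" "w' > 0" "p * (1 - p) = \<rho> * w\<^sup>2"
  defines "\<eta> \<equiv> \<lambda>w. 1 - p + p * (1 - p) / w"
  shows "(t * \<eta> w + i * (p + w - \<eta> w)) - (t * \<eta> w' + i * (p + w' - \<eta> w'))
    = (w - w') * (i - (t - i) * (\<rho> * (w / w')))"
proof -
  have "\<eta> w = 1 - p + \<rho> * w" "\<eta> w' = 1 - p + \<rho> * w\<^sup>2 / w'"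
    using assms by (simp_all add: \<eta>_def power2_eq_square)
  then show ?thesis
    unfolding \<open>\<eta> w = _\<close> \<open>\<eta> w' = _\<close> using assms(1,2) by (simp add: field_simps power2_eq_square)
qed

text \<open>For an exit row below \<open>j\<^sub>0\<close>, at least \<open>a * T\<close> rows
  remain for about \<open>(1 - \<sigma>) * T\<close> steps. Without perturbation the expression
  vanishes at \<open>i = a * t\<close>; with \<open>\<sigma> = 2 * \<delta>\<close> the missing time
  outweighs the factor \<open>1 + \<delta>\<close>. The condition
  \<open>8 \<le> T * \<sigma>\<close> absorbs the rounding of \<open>t\<close>.\<close>

lemma far_exit_above:
  fixes a \<sigma> \<delta> T t i :: real
  assumes "0 < a" "a < 1" "\<sigma> = 2 * \<delta>" "0 < \<delta>" "\<delta> \<le> 1" "a * T \<le> i" "t \<le> T - \<sigma> * T + 1" "8 \<le> T * \<sigma>"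
  defines "\<rho> \<equiv> a / (1 - a)"
  shows "\<rho> * \<sigma> * T / 4 \<le> i - (t - i) * (\<rho> * (1 + \<delta>))"
proof -
  have \<rho>: "0 < \<rho>" "a * (1 + \<rho>) = \<rho>" using assms by (simp_all add: \<rho>_def field_simps)
  have T: "0 < T" using assms by (smt (verit) mult_neg_pos mult_nonneg_nonpos2)
  have "(a * T) * (1 + \<rho> * (1 + \<delta>)) \<le> i * (1 + \<rho> * (1 + \<delta>))"
    using assms \<rho> by (intro mult_right_mono) auto
  moreover have "t * (\<rho> * (1 + \<delta>)) \<le> (T - \<sigma> * T + 1) * (\<rho> * (1 + \<delta>))"
    using assms \<rho> by (intro mult_right_mono) auto
  moreover have "(a * T) * (1 + \<rho> * (1 + \<delta>)) - (T - \<sigma> * T + 1) * (\<rho> * (1 + \<delta>))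
      = \<rho> * (T * (a * \<delta> - \<delta> + \<sigma> + \<sigma> * \<delta>) - (1 + \<delta>)) + T * (a * (1 + \<rho>) - \<rho>)"
    by (simp add: algebra_simps)
  moreover have "\<rho> * (T * \<sigma> / 4) \<le> \<rho> * (T * (a * \<delta> - \<delta> + \<sigma> + \<sigma> * \<delta>) - (1 + \<delta>))"
  proof (intro mult_left_mono)
    have "T * (\<sigma> / 2) \<le> T * (a * \<delta> - \<delta> + \<sigma> + \<sigma> * \<delta>)"
      using assms T by (intro mult_left_mono) auto
    then show "T * \<sigma> / 4 \<le> T * (a * \<delta> - \<delta> + \<sigma> + \<sigma> * \<delta>) - (1 + \<delta>)"
      using assms by simp
  qed (use \<rho> in simp)
  moreover have "T * (a * (1 + \<rho>) - \<rho>) = 0" using \<rho>(2) by simp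
  moreover have "i - (t - i) * (\<rho> * (1 + \<delta>)) = i * (1 + \<rho> * (1 + \<delta>)) - t * (\<rho> * (1 + \<delta>))"
    by (simp add: algebra_simps)
  moreover have "\<rho> * \<sigma> * T / 4 = \<rho> * (T * \<sigma> / 4)" by simp
  ultimately show ?thesis by linarith
qed

text \<open>For an exit row above the window, \<open>i\<close> falls short of \<open>a * t\<close>
  by at least \<open>(1 - a) * \<sigma> * T\<close>. As \<open>1 + \<rho> = 1 / (1 - a)\<close>,
  this is worth \<open>\<sigma> * T\<close> on the left, of which the perturbation costs at most
  half.\<close>

lemma far_exit_below:
  fixes a \<sigma> \<delta> T t i :: real
  assumes "0 < a" "a < 1" "\<sigma> = 2 * \<delta>" "0 < \<delta>" "0 \<le> T" "i \<le> (a - \<sigma>) * T" "T - \<sigma> * T \<le> t"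
  defines "\<rho> \<equiv> a / (1 - a)"
  shows "i - (t - i) * (\<rho> * (1 / (1 + \<delta>))) \<le> - (\<sigma> * T / (2 * (1 + \<delta>)))"
proof -
  have \<rho>: "0 < \<rho>" "a * (1 + \<rho>) = \<rho>" using assms by (simp_all add: \<rho>_def field_simps)
  have "i * (1 + \<rho> + \<delta>) \<le> ((a - \<sigma>) * T) * (1 + \<rho> + \<delta>)"
    using assms \<rho> by (intro mult_right_mono) auto
  moreover have "(T - \<sigma> * T) * \<rho> \<le> t * \<rho>"
    using assms \<rho> by (intro mult_right_mono) auto
  moreover have "((a - \<sigma>) * T) * (1 + \<rho> + \<delta>) - (T - \<sigma> * T) * \<rho>
      = T * (- \<sigma> + \<delta> * (a - \<sigma>)) + T * (a * (1 + \<rho>) - \<rho>)"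
    by (simp add: algebra_simps)
  moreover have "T * (- \<sigma> + \<delta> * (a - \<sigma>)) \<le> T * (- \<sigma> / 2)"
  proof (intro mult_left_mono)
    have "\<delta> * (a - \<sigma>) \<le> \<delta> * 1" using assms by (intro mult_left_mono) auto
    then show "- \<sigma> + \<delta> * (a - \<sigma>) \<le> - \<sigma> / 2" using assms by simp
  qed (use assms in simp)
  ultimately have "i * (1 + \<rho> + \<delta>) - t * \<rho> \<le> T * (- \<sigma> / 2)" using \<rho>(2) by simp
  then have "(i * (1 + \<rho> + \<delta>) - t * \<rho>) / (1 + \<delta>) \<le> T * (- \<sigma> / 2) / (1 + \<delta>)"
    using assms by (intro divide_right_mono) auto
  also have "(i * (1 + \<rho> + \<delta>) - t * \<rho>) / (1 + \<delta>) = i - (t - i) * (\<rho> * (1 / (1 + \<delta>)))"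
    using assms(4) by (simp add: field_simps)
  finally show ?thesis by (simp add: mult.commute)
qed

section \<open>Lower bound for the row process\<close>

lemma nat_floor_bounds:
  fixes x :: real
  assumes "0 \<le> x"
  shows "real (nat \<lfloor>x\<rfloor>) \<le> x" "x < real (nat \<lfloor>x\<rfloor>) + 1"
proof -
  have "real (nat \<lfloor>x\<rfloor>) = of_int \<lfloor>x\<rfloor>" using assms by simp
  then show "real (nat \<lfloor>x\<rfloor>) \<le> x" "x < real (nat \<lfloor>x\<rfloor>) + 1" by linarith+
qed

text \<open>\<open>w\<close> makes the terms \<open>(1 - a) * (p * (1 - p) / w)\<close> and
  \<open>a * w\<close> equal, hence their sum least. The condition \<open>p < a\<close> is the same
  as \<open>w < 1 - p\<close>, so the minimiser is interior.\<close>

lemma characteristic_parameter: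
  assumes p: "0 < p" "p < a" "a < 1"
  defines "\<rho> \<equiv> a / (1 - a)"
  defines "w \<equiv> sqrt (p * (1 - p) / \<rho>)"
  shows "0 < \<rho>" "0 < w" "w < 1 - p" "p * (1 - p) = \<rho> * w\<^sup>2"
    "(1 - a) * (1 - p + p * (1 - p) / w) + a * (p + w) = \<phi> p a"
proof -
  have p1: "p < 1" using p by simp
  show \<rho>: "0 < \<rho>" using p by (simp add: \<rho>_def)
  have P: "0 < p * (1 - p)" using p p1 by simp
  show w: "0 < w" using P \<rho> by (simp add: w_def)
  have w2: "w\<^sup>2 = p * (1 - p) / \<rho>" using P \<rho> by (simp add: w_def)
  then show eq: "p * (1 - p) = \<rho> * w\<^sup>2" using \<rho> by simp
  have "p < \<rho> * (1 - p)" using p p1 by (simp add: \<rho>_def field_simps)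
  then have "p * (1 - p) < \<rho> * (1 - p) * (1 - p)" using p1 by (intro mult_strict_right_mono) auto
  then have "w\<^sup>2 < (1 - p)\<^sup>2" using \<rho> by (subst w2) (simp add: pos_divide_less_eq power2_eq_square mult_ac)
  then show "w < 1 - p" using p1 by (intro power_less_imp_less_base[of w 2]) auto
  have 1: "p * (1 - p) / w = \<rho> * w" using w by (simp add: eq power2_eq_square)
  have 2: "(1 - a) * (\<rho> * w) = a * w" using p by (simp add: \<rho>_def)
  have 3: "a * w = sqrt (p * (1 - p) * a * (1 - a))"
  proof -
    have "p * (1 - p) * a * (1 - a) = (a * w)\<^sup>2"
      unfolding power_mult_distrib w2 using p by (simp add: \<rho>_def power2_eq_square)
    then show ?thesis using w p by simp
  qed
  have "(1 - a) * (1 - p + \<rho> * w) + a * (p + w)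
      = (1 - a) * (1 - p) + a * p + (1 - a) * (\<rho> * w) + a * w" by (simp add: algebra_simps)
  also have "\<dots> = 1 - p - (1 - 2 * p) * a + 2 * (a * w)" unfolding 2 by (simp add: algebra_simps)
  finally show "(1 - a) * (1 - p + p * (1 - p) / w) + a * (p + w) = \<phi> p a"
    unfolding 1 \<phi>_def 3[symmetric] .
qed

lemma row_speed_interior:
  assumes p: "0 < p" and a: "p < a" "a < 1" and \<kappa>: "\<kappa> < \<phi> p a"
  shows "row_speed p a \<kappa>"
proof -
  define \<epsilon> where "\<epsilon> = \<phi> p a - \<kappa>"
  define \<rho> where "\<rho> = a / (1 - a)"
  define w where "w = sqrt (p * (1 - p) / \<rho>)"
  define \<eta>' where "\<eta>' w = 1 - p + p * (1 - p) / w" for w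
  define q' where "q' w = p * (1 - (p + w)) / ((p + w) * (1 - p))" for w
  define \<mu>' where "\<mu>' w = p + w - \<eta>' w" for w
  define \<eta> where "\<eta> = \<eta>' w"
  define \<mu> where "\<mu> = \<mu>' w"
  note w = characteristic_parameter[OF p a, folded \<rho>_def, folded w_def]
  have p1: "p < 1" and a0: "0 < a" using p a by auto
  have \<epsilon>: "0 < \<epsilon>" using \<kappa> by (simp add: \<epsilon>_def)
  have bal: "balanced p (p + w') (q' w')" and \<eta>': "1 / (1 - q' w') = \<eta>' w'" "1 \<le> \<eta>' w'"
    if "0 < w'" "w' \<le> 1 - p" for w'
  proof -
    show b: "balanced p (p + w') (q' w')" and e: "1 / (1 - q' w') = \<eta>' w'"
      unfolding q'_def \<eta>'_def using balanced_params[OF p p1 that] by simp_all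
    show "1 \<le> \<eta>' w'" using b unfolding e[symmetric] balanced_def by simp
  qed
  have \<eta>1: "1 \<le> \<eta>" unfolding \<eta>_def using \<eta>' w by simp
  have \<mu>0: "\<mu> \<le> 0" using \<eta>1 w by (simp add: \<mu>_def \<mu>'_def \<eta>_def)
  have speed: "\<eta> + a * \<mu> = \<phi> p a"
    using w(5)[folded \<eta>'_def] by (simp add: \<mu>_def \<mu>'_def \<eta>_def algebra_simps)
  \<comment> \<open>In this order the entries give \<open>\<sigma> \<le> 1 / 2\<close>, a window
    that fits below row \<open>Y\<close>, a loss of at most \<open>\<epsilon> / 2\<close> for the
    time set aside, and \<open>w2 \<le> 1 - p\<close>.\<close>
  define \<delta> where "\<delta> = Min {1 / 4, a / 4, \<epsilon> / (4 * \<eta>), (1 - p) / w - 1}"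
  have \<delta>: "0 < \<delta>" "\<delta> \<le> 1 / 4" "\<delta> \<le> a / 4" "\<delta> \<le> \<epsilon> / (4 * \<eta>)" "\<delta> \<le> (1 - p) / w - 1"
    unfolding \<delta>_def by (use a0 \<epsilon> \<eta>1 w(2,3) in simp, (rule Min_le; simp)+)
  define \<sigma> where "\<sigma> = 2 * \<delta>"
  have \<sigma>: "0 < \<sigma>" "\<sigma> \<le> 1 / 2" "\<sigma> \<le> a / 2" "\<sigma> * \<eta> \<le> \<epsilon> / 2"
    using \<delta> \<eta>1 by (simp_all add: \<sigma>_def field_simps)
  define w1 where "w1 = w / (1 + \<delta>)"
  define w2 where "w2 = w * (1 + \<delta>)"
  have w1: "0 < w1" "w1 < w" "w1 \<le> 1 - p" "w / w1 = 1 + \<delta>"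
  proof -
    show "0 < w1" "w / w1 = 1 + \<delta>" using w(2) \<delta>(1) by (simp_all add: w1_def)
    show "w1 < w" using w(2) \<delta>(1) by (simp add: w1_def field_simps)
    with w(3) show "w1 \<le> 1 - p" by simp
  qed
  have w2: "0 < w2" "w < w2" "w2 \<le> 1 - p" "w / w2 = 1 / (1 + \<delta>)"
  proof -
    show "0 < w2" "w / w2 = 1 / (1 + \<delta>)" using w(2) \<delta>(1) by (simp_all add: w2_def)
    show "w < w2" using w(2) \<delta>(1) by (simp add: w2_def field_simps)
    show "w2 \<le> 1 - p" using w(2) \<delta>(5) by (simp add: w2_def field_simps)
  qed
  \<comment> \<open>The amount per unit of time by which \<open>w1\<close> and \<open>w2\<close>
    improve the bound for exit rows below and above the window.\<close>
  define k where "k = min ((w - w1) * (\<rho> * \<sigma> / 4)) ((w2 - w) * (\<sigma> / (2 * (1 + \<delta>))))"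
  have k: "0 < k" using w(1) w1(2) w2(2) \<sigma>(1) \<delta>(1) by (simp add: k_def)
  have k_le: "k \<le> (w - w1) * (\<rho> * \<sigma> / 4)" "k \<le> (w2 - w) * (\<sigma> / (2 * (1 + \<delta>)))"
    unfolding k_def by (rule min.cobounded1, rule min.cobounded2)
  define e where "e = min (k / 6) (\<epsilon> / 6)"
  have e: "0 < e" "e \<le> k / 6" "e \<le> \<epsilon> / 6" using k \<epsilon> by (simp_all add: e_def)
  obtain c0 where c0: "c0 > 0"
    and dev: "\<And>t Y y s. y \<le> Y \<Longrightarrow> y \<le> 3 * t \<Longrightarrow> s \<in> {1, -1} \<Longrightarrow>
       measure_pmf.prob (joint p (p + w) (q' w) Y t) {(d, ns). s * of_int (psum d y) \<ge> s * (real y * \<mu>) + e * real t}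
       \<le> exp (- c0 * real t)"
      "\<And>t Y y s. y \<le> Y \<Longrightarrow> y \<le> 3 * t \<Longrightarrow> s \<in> {1, -1} \<Longrightarrow>
       measure_pmf.prob (joint p (p + w) (q' w) Y t) {(d, ns). s * of_int (run ns (psum d) y) \<ge>
         s * (real t * \<eta> + real y * \<mu>) + 2 * e * real t}
       \<le> 2 * exp (- c0 * real t)"
    using stationary_run_deviation[OF bal[of w] e(1)] w \<eta>'(1)[of w]
    unfolding \<mu>_def \<mu>'_def \<eta>_def by (metis less_imp_le)
  have ub: "\<exists>c>0. \<forall>t Y y j k C a. j \<le> y \<longrightarrow> y \<le> Y \<longrightarrow> Y \<le> 3 * t \<longrightarrow>
       real_of_int k + real t * \<eta>' w' + (real y - real j) * \<mu>' w' + 3 * e * real t \<le> a \<longrightarrow>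
       real t - of_int C < a \<longrightarrow>
       measure_pmf.prob (replicate_pmf t (rnoise p Y)) {ns. of_int (run ns (pt j k C) y) \<ge> a}
       \<le> 3 * exp (- c * real t)" if "0 < w'" "w' \<le> 1 - p" for w'
    by (rule point_upper_bound[OF bal[OF that] e(1)]) (unfold \<eta>'(1)[OF that] \<mu>'_def, blast)
  obtain c1 where c1: "c1 > 0"
    and ub1: "\<And>t Y y j k C a. j \<le> y \<Longrightarrow> y \<le> Y \<Longrightarrow> Y \<le> 3 * t \<Longrightarrow>
       real_of_int k + real t * \<eta>' w1 + (real y - real j) * \<mu>' w1 + 3 * e * real t \<le> a \<Longrightarrow>
       real t - of_int C < a \<Longrightarrow>
       measure_pmf.prob (replicate_pmf t (rnoise p Y)) {ns. of_int (run ns (pt j k C) y) \<ge> a}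
       \<le> 3 * exp (- c1 * real t)"
    using ub[OF w1(1,3)] by blast
  obtain c2 where c2: "c2 > 0"
    and ub2: "\<And>t Y y j k C a. j \<le> y \<Longrightarrow> y \<le> Y \<Longrightarrow> Y \<le> 3 * t \<Longrightarrow>
       real_of_int k + real t * \<eta>' w2 + (real y - real j) * \<mu>' w2 + 3 * e * real t \<le> a \<Longrightarrow>
       real t - of_int C < a \<Longrightarrow>
       measure_pmf.prob (replicate_pmf t (rnoise p Y)) {ns. of_int (run ns (pt j k C) y) \<ge> a}
       \<le> 3 * exp (- c2 * real t)"
    using ub[OF w2(1,3)] by blast
  define c where "c = min c0 (min c1 c2)"
  have c: "0 < c" using c0 c1 c2 by (simp add: c_def)
  have c_mono: "exp (- c0 * real t) \<le> exp (- c * real t)" "exp (- c1 * real t) \<le> exp (- c * real t)"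
    "exp (- c2 * real t) \<le> exp (- c * real t)" for t :: nat
    by (auto simp: c_def intro!: mult_right_mono)
  have bound: "\<exists>j Y C. int T < C \<and>
     measure_pmf.prob (replicate_pmf T (rnoise p Y))
       {ns. of_int (run ns (pt j 0 C) (j + nat \<lfloor>a * real T\<rfloor>)) < \<kappa> * real T}
     \<le> (4 * real T + 10) * exp (- (c / 2) * real T)" if T: "2 \<le> T" "8 \<le> real T * \<sigma>" for T
  proof -
    \<comment> \<open>The target row \<open>T + 1\<close> lies above the elapsed time, so the source
      is not felt, yet \<open>Y \<le> 3 * t\<close> as the deviation bounds require.\<close>
    define s t n Y where "s = nat \<lfloor>\<sigma> * real T\<rfloor>" and "t = T - s" and "n = nat \<lfloor>a * real T\<rfloor>" and "Y = T + 1"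
    have s: "real s \<le> \<sigma> * real T" "\<sigma> * real T \<le> real s + 1"
      using nat_floor_bounds[of "\<sigma> * real T"] \<sigma>(1) by (simp_all add: s_def)
    have n: "real n \<le> a * real T" "a * real T < real n + 1"
      using nat_floor_bounds[of "a * real T"] a0 by (simp_all add: n_def)
    have "\<sigma> * real T \<le> (1 / 2) * real T" using \<sigma>(2) by (intro mult_right_mono) auto
    then have sT: "real s \<le> real T / 2" using s(1) by simp
    have "a * real T \<le> 1 * real T" using a by (intro mult_right_mono) auto
    then have nT: "n \<le> T" using n(1) by linarith
    have sn: "s \<le> n"
      unfolding s_def n_def using \<sigma> a0 by (intro nat_mono floor_mono mult_right_mono) auto
    have "2 * s \<le> T" using sT by linarith
    then have t: "s + t = T" "real t = real T - real s" "real T / 2 \<le> real t" "t < Y" "Y \<le> 3 * t"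
      using T(1) by (simp_all add: t_def Y_def of_nat_diff)
    define j0 where "j0 = Y - n"
    have j0: "j0 + n = Y" using nT by (simp add: j0_def Y_def)
    define cc where "cc = real t * \<eta> + real Y * \<mu> - 2 * e * real t"
    define kk where "kk j = \<lfloor>real j * \<mu> + e * real t\<rfloor>" for j :: nat
    \<comment> \<open>The first entry is demanded by \<open>row_speed\<close>; the second keeps the
      background of the far exits below \<open>cc\<close>.\<close>
    define C where "C = max (int T + 1) (\<lceil>real t - cc\<rceil> + kk j0 + 1)"
    have "\<lceil>real t - cc\<rceil> \<le> C - kk j0 - 1" by (simp add: C_def)
    then have "real t - cc \<le> of_int (C - kk j0 - 1)" by (simp only: ceiling_le_iff)
    then have C: "int T < C" "real t - of_int (C - kk j0) < cc"
      by (simp_all add: C_def)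
    let ?E = "exp (- c * real t)"
    \<comment> \<open>The losses are \<open>3 * e * t\<close> from deviations and
      \<open>\<sigma> * \<eta> * T\<close> from the time set aside, each at most half of
      \<open>\<epsilon> * T\<close>.\<close>
    have thr: "\<kappa> * real T \<le> cc - of_int (kk j0)"
    proof -
      have "of_int (kk j0) \<le> real j0 * \<mu> + e * real t" by (simp add: kk_def)
      moreover have "real Y = real j0 + real n" using j0 by simp
      ultimately have "cc - of_int (kk j0) \<ge> real t * \<eta> + real n * \<mu> - 3 * (e * real t)"
        by (simp add: cc_def algebra_simps)
      moreover have "(a * real T) * \<mu> \<le> real n * \<mu>" using n(1) \<mu>0 by (intro mult_right_mono_neg)
      moreover have "(real T - \<sigma> * real T) * \<eta> \<le> real t * \<eta>"
        using s(1) t(2) \<eta>1 by (intro mult_right_mono) auto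
      moreover have "e * real t \<le> (\<epsilon> / 6) * real T" using e t(2) by (intro mult_mono) auto
      moreover have "(\<sigma> * \<eta>) * real T \<le> (\<epsilon> / 2) * real T" using \<sigma>(4) by (intro mult_right_mono) auto
      ultimately have "(\<eta> + a * \<mu>) * real T - \<epsilon> * real T \<le> cc - of_int (kk j0)"
        by (simp add: algebra_simps)
      then show ?thesis unfolding speed \<epsilon>_def by (simp add: algebra_simps)
    qed
    have far: "measure_pmf.prob (replicate_pmf t (rnoise p Y))
         {ns. of_int (run ns (pt j (kk j) (C - kk j0)) Y) \<ge> cc} \<le> 3 * ?E"
      if j: "j \<in> {..Y} - {j0..j0 + s}" for j
    proof -
      define i where "i = real Y - real j"
      have kj: "of_int (kk j) \<le> real j * \<mu> + e * real t" by (simp add: kk_def)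
      \<comment> \<open>Six deviation terms: three of the point start, two in \<open>cc\<close>, one
        in \<open>kk\<close>.\<close>
      have et: "6 * (e * real t) \<le> k * real T"
      proof -
        have "e * real t \<le> (k / 6) * real T" using e t(2) by (intro mult_mono) auto
        then show ?thesis by simp
      qed
      have prem: "of_int (kk j) + real t * \<eta>' w' + (real Y - real j) * \<mu>' w' + 3 * e * real t \<le> cc"
        if "k * real T \<le> (real t * \<eta> + i * \<mu>) - (real t * \<eta>' w' + i * \<mu>' w')" for w'
        using that kj et unfolding cc_def i_def by (simp add: algebra_simps)
      consider "j < j0" | "j0 + s < j" using j by fastforce
      then show ?thesis
      proof cases
        case 1
        have i: "a * real T \<le> i" using 1 n(2) j0 by (simp add: i_def)
        have "\<rho> * \<sigma> * real T / 4 \<le> i - (real t - i) * (\<rho> * (1 + \<delta>))"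
          unfolding \<rho>_def using a0 a \<delta> s t i T(2) by (intro far_exit_above[OF _ _ \<sigma>_def]) auto
        then have "(w - w1) * (\<rho> * \<sigma> * real T / 4) \<le> (w - w1) * (i - (real t - i) * (\<rho> * (1 + \<delta>)))"
          using w1(2) by (intro mult_left_mono) auto
        also have "\<dots> = (real t * \<eta> + i * \<mu>) - (real t * \<eta>' w1 + i * \<mu>' w1)"
          using perturbed_bound[OF w(2) w1(1) w(4), of "real t" i] w1(4)
          by (simp add: \<eta>_def \<mu>_def \<eta>'_def \<mu>'_def)
        finally have "(w - w1) * (\<rho> * \<sigma> / 4) * real T \<le> \<dots>" by (simp add: mult_ac)
        moreover have "k * real T \<le> (w - w1) * (\<rho> * \<sigma> / 4) * real T"
          by (intro mult_right_mono k_le) simp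
        ultimately have "k * real T \<le> (real t * \<eta> + i * \<mu>) - (real t * \<eta>' w1 + i * \<mu>' w1)"
          by linarith
        then have "measure_pmf.prob (replicate_pmf t (rnoise p Y))
            {ns. of_int (run ns (pt j (kk j) (C - kk j0)) Y) \<ge> cc} \<le> 3 * exp (- c1 * real t)"
          using j t C(2) by (intro ub1 prem) auto
        also have "\<dots> \<le> 3 * ?E" using c_mono by simp
        finally show ?thesis .
      next
        case 2
        have "i \<le> real n - real s - 1" using 2 j0 by (simp add: i_def)
        then have i: "i \<le> (a - \<sigma>) * real T" using n s by (simp add: algebra_simps)
        have "i - (real t - i) * (\<rho> * (1 / (1 + \<delta>))) \<le> - (\<sigma> * real T / (2 * (1 + \<delta>)))"
          unfolding \<rho>_def using a0 a \<delta> s t i by (intro far_exit_below[OF _ _ \<sigma>_def]) auto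
        then have "(w2 - w) * (i - (real t - i) * (\<rho> * (1 / (1 + \<delta>)))) \<le> (w2 - w) * (- (\<sigma> * real T / (2 * (1 + \<delta>))))"
          using w2(2) by (intro mult_left_mono) auto
        moreover have "(real t * \<eta> + i * \<mu>) - (real t * \<eta>' w2 + i * \<mu>' w2)
            = - ((w2 - w) * (i - (real t - i) * (\<rho> * (1 / (1 + \<delta>)))))"
          using perturbed_bound[OF w(2) w2(1) w(4), of "real t" i] w2(4)
          by (simp add: \<eta>_def \<mu>_def \<eta>'_def \<mu>'_def flip: mult_minus_left)
        moreover have "k * real T \<le> (w2 - w) * (\<sigma> / (2 * (1 + \<delta>))) * real T"
          by (intro mult_right_mono k_le) simp
        moreover have "(w2 - w) * (\<sigma> / (2 * (1 + \<delta>))) * real T = - ((w2 - w) * (- (\<sigma> * real T / (2 * (1 + \<delta>)))))"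
          by simp
        ultimately have "k * real T \<le> (real t * \<eta> + i * \<mu>) - (real t * \<eta>' w2 + i * \<mu>' w2)"
          by linarith
        then have "measure_pmf.prob (replicate_pmf t (rnoise p Y))
            {ns. of_int (run ns (pt j (kk j) (C - kk j0)) Y) \<ge> cc} \<le> 3 * exp (- c2 * real t)"
          using j t C(2) by (intro ub2 prem) auto
        also have "\<dots> \<le> 3 * ?E" using c_mono by simp
        finally show ?thesis .
      qed
    qed
    let ?J = "joint p (p + w) (q' w) Y t"
    have "measure_pmf.prob ?J {(d, ns). of_int (run ns (psum d) Y) < cc}
        \<le> measure_pmf.prob ?J {(d, ns). - 1 * of_int (run ns (psum d) Y) \<ge>
            - 1 * (real t * \<eta> + real Y * \<mu>) + 2 * e * real t}"
      by (rule prob_mono_pmf) (auto simp: cc_def)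
    also have "\<dots> \<le> 2 * exp (- c0 * real t)" using t by (intro dev) auto
    also have "\<dots> \<le> 2 * ?E" using c_mono by simp
    finally have A1: "measure_pmf.prob ?J {(d, ns). of_int (run ns (psum d) Y) < cc} \<le> 2 * ?E" .
    have A2: "measure_pmf.prob ?J {(d, ns). of_int (psum d j) > real j * \<mu> + e * real t} \<le> ?E"
      if "j \<le> Y" for j
    proof -
      have "measure_pmf.prob ?J {(d, ns). of_int (psum d j) > real j * \<mu> + e * real t}
         \<le> measure_pmf.prob ?J {(d, ns). 1 * of_int (psum d j) \<ge> 1 * (real j * \<mu>) + e * real t}"
        by (rule prob_mono_pmf) auto
      also have "\<dots> \<le> exp (- c0 * real t)" using that t by (intro dev) auto
      also have "\<dots> \<le> ?E" by (rule c_mono)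
      finally show ?thesis .
    qed
    have "measure_pmf.prob (replicate_pmf T (rnoise p Y))
       {ns. of_int (run ns (pt j0 0 C) (j0 + n)) < \<kappa> * real T}
      \<le> measure_pmf.prob (replicate_pmf (s + t) (rnoise p Y))
       {ns. of_int (run ns (pt j0 0 C) Y) < cc - of_int (kk j0)}"
      unfolding t(1) j0 using thr by (intro prob_mono_pmf) auto
    also have "\<dots> \<le> measure_pmf.prob ?J {(d, ns). of_int (run ns (psum d) Y) < cc}
      + (\<Sum>j\<le>Y. measure_pmf.prob ?J {(d, ns). of_int (psum d j) > real j * \<mu> + e * real t})
      + (\<Sum>j\<in>{..Y} - {j0..j0 + s}. measure_pmf.prob (replicate_pmf t (rnoise p Y))
         {ns. of_int (run ns (pt j (kk j) (C - kk j0)) Y) \<ge> cc})"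
      unfolding kk_def j0_def by (intro exit_decomposition) (use nT sn t(4) \<mu>0 in \<open>auto simp: Y_def\<close>)
    also have "\<dots> \<le> 2 * ?E + (\<Sum>j\<le>Y. ?E) + (\<Sum>j\<in>{..Y} - {j0..j0 + s}. 3 * ?E)"
      by (intro add_mono sum_mono A1 A2 far) auto
    also have "\<dots> \<le> 2 * ?E + (\<Sum>j\<le>Y. ?E) + (\<Sum>j\<le>Y. 3 * ?E)"
      by (intro add_mono sum_mono2 order_refl) auto
    also have "\<dots> = (4 * real T + 10) * ?E" by (simp add: Y_def algebra_simps)
    also have "\<dots> \<le> (4 * real T + 10) * exp (- (c / 2) * real T)"
    proof (intro mult_left_mono)
      have "c * (real T / 2) \<le> c * real t" using t(3) c by (intro mult_left_mono) auto
      then show "?E \<le> exp (- (c / 2) * real T)" by simp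
    qed simp
    finally show ?thesis using C(1) unfolding n_def by blast
  qed
  have "expsmall (\<lambda>T. exp (- (c / 2) * real T))"
    unfolding expsmall_def using c by (intro exI[of _ "c / 2"]) auto
  then have "expsmall (\<lambda>T. (4 * real T + 10) * exp (- (c / 2) * real T))"
    by (rule expsmall_linear_mult) auto
  then obtain c' where c': "c' > 0"
    "\<forall>\<^sub>F T in sequentially. (4 * real T + 10) * exp (- (c / 2) * real T) \<le> exp (- c' * real T)"
    by (auto simp: expsmall_def)
  have "filterlim (\<lambda>T. real T * \<sigma>) at_top sequentially" using \<sigma>(1) by real_asymp
  then have "\<forall>\<^sub>F T in sequentially. 8 \<le> real T * \<sigma>" by (simp add: filterlim_at_top)
  with c'(2) eventually_ge_at_top[of 2] have "\<forall>\<^sub>F T in sequentially. \<exists>j Y C. int T < C \<and>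
     measure_pmf.prob (replicate_pmf T (rnoise p Y))
       {ns. of_int (run ns (pt j 0 C) (j + nat \<lfloor>a * real T\<rfloor>)) < \<kappa> * real T} \<le> exp (- c' * real T)"
  proof eventually_elim
    case (elim T)
    then show ?case using bound[of T] by (meson order_trans)
  qed
  with c'(1) show ?thesis unfolding row_speed_def by blast
qed

section \<open>The site dynamics and its couplings with the row process\<close>

definition touch :: "site set \<Rightarrow> site \<Rightarrow> bool" where
  "touch A z \<longleftrightarrow> (\<exists>u\<in>hex_nbhd. z + u \<in> A)"

definition sure :: "site set \<Rightarrow> site \<Rightarrow> bool" where
  "sure A z \<longleftrightarrow> z \<in> A \<or> z + (- 1, 0) \<in> A \<or> z + (1, 0) \<in> A \<or>
     (z + (1, - 1) \<in> A \<and> z + (0, - 1) \<in> A) \<or> (z + (- 1, 1) \<in> A \<and> z + (0, 1) \<in> A)"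

lemma sure_imp_touch: "sure A z \<Longrightarrow> touch A z"
  by (cases z) (auto simp: sure_def touch_def hex_nbhd_def)

lemma mem_local_config: "u \<in> local_config hex_nbhd A z \<longleftrightarrow> u \<in> hex_nbhd \<and> z + u \<in> A"
  by (force simp: local_config_def)

lemma hex_rule_local_config:
  "hex_rule p (local_config hex_nbhd A z) = (if touch A z then if sure A z then 1 else p else 0)"
proof -
  let ?S = "local_config hex_nbhd A z"
  have "?S = {} \<longleftrightarrow> \<not> touch A z" by (auto simp: touch_def mem_local_config)
  moreover have "(0, 0) \<in> ?S \<or> (-1, 0) \<in> ?S \<or> (1, 0) \<in> ?S \<or>
              {(1, -1), (0, -1)} \<subseteq> ?S \<or> {(-1, 1), (0, 1)} \<subseteq> ?S \<longleftrightarrow> sure A z"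
    unfolding sure_def insert_subset mem_local_config by (cases z) (simp add: hex_nbhd_def)
  ultimately show ?thesis unfolding hex_rule_def by auto
qed

lemma touch_Pair: "touch A (x, y) \<longleftrightarrow> (x, y) \<in> A \<or> (x + 1, y) \<in> A \<or> (x - 1, y) \<in> A \<or>
    (x, y + 1) \<in> A \<or> (x, y - 1) \<in> A \<or> (x + 1, y - 1) \<in> A \<or> (x - 1, y + 1) \<in> A"
  by (simp add: touch_def hex_nbhd_def)

lemma sure_Pair: "sure A (x, y) \<longleftrightarrow> (x, y) \<in> A \<or> (x - 1, y) \<in> A \<or> (x + 1, y) \<in> A \<or>
    ((x + 1, y - 1) \<in> A \<and> (x, y - 1) \<in> A) \<or> ((x - 1, y + 1) \<in> A \<and> (x, y + 1) \<in> A)"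
  by (simp add: sure_def)

text \<open>Every site has a coin, which matters only where the rule has probability p.\<close>

definition sstep :: "site set \<Rightarrow> (site \<Rightarrow> bool) \<Rightarrow> site set" where
  "sstep A b = {z. sure A z \<or> (touch A z \<and> b z)}"

definition nb :: "site set \<Rightarrow> site set" where
  "nb A = {z. touch A z}"

lemma finite_nb:
  assumes "finite A"
  shows "finite (nb A)"
proof -
  have "nb A \<subseteq> (\<lambda>(a, u). a - u) ` (A \<times> hex_nbhd)"
  proof
    fix z assume "z \<in> nb A"
    then obtain u where "u \<in> hex_nbhd" "z + u \<in> A" by (auto simp: nb_def touch_def)
    then show "z \<in> (\<lambda>(a, u). a - u) ` (A \<times> hex_nbhd)"
      by (intro image_eqI[of _ _ "(z + u, u)"]) auto
  qed
  then show ?thesis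
    by (rule finite_subset) (use assms in \<open>simp add: hex_nbhd_def\<close>)
qed

lemma sstep_bounds: "A \<subseteq> sstep A b" "sstep A b \<subseteq> nb A"
  using sure_imp_touch by (auto simp: sstep_def nb_def sure_def)

lemma finite_sstep: "finite A \<Longrightarrow> finite (sstep A b)"
  using finite_subset[OF sstep_bounds(2) finite_nb] .

text \<open>Coins outside \<open>nb A\<close> decide nothing; leaving them out keeps the law
  discrete.\<close>

definition kern :: "real \<Rightarrow> site set \<Rightarrow> site set pmf" where
  "kern p A = map_pmf (sstep A) (bern p (nb A))"

primrec slaw :: "real \<Rightarrow> nat \<Rightarrow> site set \<Rightarrow> site set pmf" where
  "slaw p 0 A = return_pmf A"
| "slaw p (Suc t) A = bind_pmf (kern p A) (slaw p t)"

lemma slaw_add: "slaw p (s + t) A = bind_pmf (slaw p s A) (slaw p t)"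
  by (induction s arbitrary: A) (auto intro!: bind_pmf_cong simp: bind_return_pmf bind_assoc_pmf)

lemma slaw_1: "slaw p (Suc 0) = kern p"
proof
  fix A
  have "slaw p 0 = return_pmf" by (rule ext) simp
  then show "slaw p (Suc 0) A = kern p A" by (simp add: bind_return_pmf')
qed

lemma slaw_Suc': "slaw p (Suc t) A = bind_pmf (slaw p t A) (kern p)"
  using slaw_add[of p t "Suc 0" A] by (simp only: slaw_1 add_Suc_right add_0_right)

text \<open>Spare coins leave the law unchanged. The coupling needs them for sites that it reads
  outside \<open>nb A\<close>.\<close>

lemma kern_window:
  assumes "finite W" "nb A \<subseteq> W"
  shows "kern p A = map_pmf (sstep A) (bern p W)"
proof -
  have "sstep A (\<lambda>x. if x \<in> nb A then f x else False) = sstep A f" for f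
    by (auto simp: sstep_def nb_def)
  then show ?thesis
    by (simp add: kern_def bern_def Pi_pmf_subset[OF assms] map_pmf_comp)
qed

lemma bern_sample:
  fixes s :: "'i \<Rightarrow> 'j"
  assumes "finite W" "finite R" "inj_on s R" "s ` R \<subseteq> W" "infinite (UNIV :: 'j set)"
  shows "map_pmf (\<lambda>b i. i \<in> R \<and> b (s i)) (bern p W) = bern p R"
proof -
  obtain z where z: "z \<notin> s ` R" using assms(2,5) ex_new_if_finite[of "s ` R"] by auto
  define h where "h i = (if i \<in> R then s i else z)" for i
  have "bij_betw h R (s ` R)"
    using assms(3) by (auto simp: bij_betw_def inj_on_def h_def)
  then have "bern p R = map_pmf (\<lambda>g. g \<circ> h) (bern p (s ` R))"
    unfolding bern_def using assms(2) z by (intro Pi_pmf_bij_betw) (auto simp: h_def)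
  also have "\<dots> = map_pmf (\<lambda>b i. i \<in> R \<and> b (s i)) (bern p W)"
    unfolding bern_def using z
    by (subst Pi_pmf_subset[OF assms(1,4)]) (auto simp: map_pmf_comp fun_eq_iff h_def intro!: map_pmf_cong)
  finally show ?thesis ..
qed

lemma finite_slaw: "A' \<in> set_pmf (slaw p t A) \<Longrightarrow> finite A \<Longrightarrow> finite A'"
proof (induction t arbitrary: A)
  case (Suc t)
  then obtain b where "A' \<in> set_pmf (slaw p t (sstep A b))" by (auto simp: kern_def)
  from Suc.IH[OF this] show ?case using Suc.prems(2) finite_sstep by blast
qed simp

text \<open>A coupling of the site dynamics with the row process. The row process reads, for row \<open>i\<close>,
  the coin at the site \<open>f D i\<close>; the sites lie in different rows and are chosen before the coins
  are inspected, so that the coins read are again independent.\<close>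

lemma slaw_row_coupling:
  assumes f: "\<And>D. inj (f D)"
    and step: "\<And>s A D b. Q s A D \<Longrightarrow> finite A \<Longrightarrow> s < T \<Longrightarrow>
       Q (Suc s) (sstep A b) (rstep (1, \<lambda>i. i \<in> {1..Y} \<and> b (f D i)) D)"
    and "Q s A D" "finite A" "s + t = T"
  shows "rel_pmf (Q T) (slaw p t A) (map_pmf (\<lambda>ns. run ns D) (replicate_pmf t (rnoise p Y)))"
  using assms(3-5)
proof (induction t arbitrary: s A D)
  case (Suc t)
  define W where "W = nb A \<union> f D ` {1..Y}"
  have W: "finite W" "nb A \<subseteq> W" "f D ` {1..Y} \<subseteq> W"
    using finite_nb[OF Suc.prems(2)] by (auto simp: W_def)
  have inf: "infinite (UNIV :: site set)"
    by (simp add: finite_prod)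
  have noise: "rnoise p Y = map_pmf (\<lambda>b. (1, \<lambda>i. i \<in> {1..Y} \<and> b (f D i))) (bern p W)"
  proof -
    have "map_pmf (\<lambda>b i. i \<in> {1..Y} \<and> b (f D i)) (bern p W) = bern p {1..Y}"
      using f W inf by (intro bern_sample) (auto intro: inj_on_subset)
    from this[symmetric] show ?thesis unfolding rnoise_def by (simp add: map_pmf_comp)
  qed
  have "rel_pmf (\<lambda>A' D'. Q (Suc s) A' D' \<and> finite A') (kern p A) (map_pmf (\<lambda>n. rstep n D) (rnoise p Y))"
    unfolding kern_window[OF W(1,2)] noise pmf.rel_map
    using Suc.prems finite_sstep by (intro rel_pmf_reflI conjI step finite_sstep) auto
  moreover have "rel_pmf (Q T) (slaw p t A') (map_pmf (\<lambda>ns. run ns D') (replicate_pmf t (rnoise p Y)))"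
    if "Q (Suc s) A' D' \<and> finite A'" for A' D'
    using that Suc.prems(3) by (intro Suc.IH) auto
  ultimately have "rel_pmf (Q T) (slaw p (Suc t) A)
      (bind_pmf (map_pmf (\<lambda>n. rstep n D) (rnoise p Y)) (\<lambda>D'. map_pmf (\<lambda>ns. run ns D') (replicate_pmf t (rnoise p Y))))"
    unfolding slaw.simps by (rule rel_pmf_bindI)
  also have "bind_pmf (map_pmf (\<lambda>n. rstep n D) (rnoise p Y)) (\<lambda>D'. map_pmf (\<lambda>ns. run ns D') (replicate_pmf t (rnoise p Y)))
      = map_pmf (\<lambda>ns. run ns D) (replicate_pmf (Suc t) (rnoise p Y))"
    by (simp add: map_bind_pmf bind_map_pmf) (simp add: map_pmf_def)
  finally show ?case .
qed simp

text \<open>In rows up to \<open>k\<close> the natural number is 0, so row 0 of the profile bounds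
  all of them.\<close>

definition region :: "int \<Rightarrow> (nat \<Rightarrow> int) \<Rightarrow> site set" where
  "region k D = {(x, y). - D (nat (y - k)) \<le> x}"

text \<open>As the profile decreases with height, a row is passed by at most one site from itself or
  from above. Anything further comes from the row below, and only the site just beyond the end of
  that row is random: there the coin is read. The height condition provides coins for every row
  reached by time \<open>t\<close>.\<close>

lemma upper_coupling:
  assumes "finite A" "A \<subseteq> region k D" "\<And>i. D (Suc i) \<le> D i"
    and "\<And>x y. (x, y) \<in> A \<Longrightarrow> y + int t \<le> k + int Y"
  shows "rel_pmf (\<lambda>A D. A \<subseteq> region k D) (slaw p t A)
    (map_pmf (\<lambda>ns. run ns D) (replicate_pmf t (rnoise p Y)))"
proof -
  define Q where "Q s A D \<longleftrightarrow> A \<subseteq> region k D \<and> (\<forall>i. D (Suc i) \<le> D i) \<and>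
     (\<forall>x y. (x, y) \<in> A \<longrightarrow> y + int t \<le> k + int Y + int s)" for s :: nat and A D
  define f :: "(nat \<Rightarrow> int) \<Rightarrow> nat \<Rightarrow> site" where "f D i = (- D (i - 1) - 1, k + int i)" for D i
  have "rel_pmf (Q t) (slaw p t A) (map_pmf (\<lambda>ns. run ns D) (replicate_pmf t (rnoise p Y)))"
  proof (rule slaw_row_coupling[where f = f and s = 0])
    show "inj (f D)" for D by (auto simp: inj_def f_def)
    show "Q 0 A D" using assms by (auto simp: Q_def)
  next
    fix s A D b assume Q: "Q s A D" "s < t"
    let ?D = "rstep (1, \<lambda>i. i \<in> {1..Y} \<and> b (f D i)) D"
    have reg: "- D (nat (y - k)) \<le> x" and height: "y + int t \<le> k + int Y + int s" if "(x, y) \<in> A" for x y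
      using that Q(1) by (auto simp: Q_def region_def)
    have anti: "D (Suc i) \<le> D i" for i using Q(1) by (simp add: Q_def)
    have D1: "D i + 1 \<le> ?D i" for i by (cases i) auto
    have "?D (Suc i) \<le> ?D i" for i
    proof -
      have "?D (Suc i) \<le> D i + 1" using anti[of i] by auto
      then show ?thesis using D1[of i] by linarith
    qed
    moreover have "y + int t \<le> k + int Y + int (Suc s)" if "(x, y) \<in> sstep A b" for x y
    proof -
      have "touch A (x, y)" using sstep_bounds(2)[of A b] that by (auto simp: nb_def)
      then show ?thesis by (auto simp: touch_Pair dest: height)
    qed
    moreover have "sstep A b \<subseteq> region k ?D"
    proof (clarify)
      fix x y assume z: "(x, y) \<in> sstep A b"
      let ?i = "nat (y - k)"
      have "- ?D ?i \<le> x"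
      proof (cases "- D ?i - 1 \<le> x")
        case True
        then show ?thesis using D1[of ?i] by linarith
      next
        case False
        have above: "x' \<ge> - D ?i" if "(x', y + 1) \<in> A" for x'
        proof -
          have "D (nat (y + 1 - k)) \<le> D ?i"
          proof (cases "y \<ge> k")
            case True
            then have "nat (y + 1 - k) = Suc ?i" by simp
            then show ?thesis using anti[of ?i] by simp
          qed simp
          then show ?thesis using reg[OF that] by linarith
        qed
        have A': "(x, y) \<notin> A" "(x + 1, y) \<notin> A" "(x - 1, y) \<notin> A" "(x, y + 1) \<notin> A" "(x - 1, y + 1) \<notin> A"
          using False reg[of x y] reg[of "x + 1" y] reg[of "x - 1" y] above[of x] above[of "x - 1"] by auto
        have below: "(x, y - 1) \<in> A \<or> (x + 1, y - 1) \<in> A"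
          using z A' sure_imp_touch[of A "(x, y)"] by (auto simp: sstep_def touch_Pair)
        have "y > k"
        proof (rule ccontr)
          assume "\<not> y > k"
          then have "nat (y - 1 - k) = ?i" by simp
          then show False using below reg[of x "y - 1"] reg[of "x + 1" "y - 1"] False by auto
        qed
        define j where "j = nat (y - 1 - k)"
        have j: "?i = Suc j" "nat (y - 1 - k) = j" "y = k + int (Suc j)"
          using \<open>y > k\<close> by (simp_all add: j_def)
        have Y: "Suc j \<le> Y" using below height[of x "y - 1"] height[of "x + 1" "y - 1"] j Q(2) by auto
        show ?thesis
        proof (cases "- D j \<le> x")
          case True
          then show ?thesis unfolding j(1) by (auto simp: max_def)
        next
          case False2: False
          then have "(x, y - 1) \<notin> A" using reg[of x "y - 1"] j by auto
          with below have B: "(x + 1, y - 1) \<in> A" by simp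
          with reg[of "x + 1" "y - 1"] j False2 have x: "x = - D j - 1" by auto
          have "b (x, y)" using z A' \<open>(x, y - 1) \<notin> A\<close> by (auto simp: sstep_def sure_Pair)
          then have "b (f D (Suc j))" by (simp add: f_def x j(3))
          then show ?thesis unfolding j(1) using Y x by simp
        qed
      qed
      then show "(x, y) \<in> region k ?D" by (simp add: region_def)
    qed
    ultimately show "Q (Suc s) (sstep A b) ?D" by (auto simp: Q_def)
  qed (use assms in auto)
  then show ?thesis
    by (rule pmf.rel_mono_strong) (simp add: Q_def)
qed

text \<open>Two adjacent occupied sites force the sites above them, so row \<open>y + i\<close>
  contains \<open>{l..r - i}\<close> after \<open>i\<close> steps without any luck. By
  \<open>int T \<le> r - l\<close> this base persists for all \<open>T\<close> steps, and the left
  ends can be followed without regard to the right ends.\<close>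

lemma lower_coupling:
  assumes "finite A" "\<And>x. l \<le> x \<Longrightarrow> x \<le> r \<Longrightarrow> (x, y) \<in> A" "int T \<le> r - l" "int T < C"
  shows "rel_pmf (\<lambda>A D. \<forall>i\<le>T. \<forall>x. l - D (j + i) \<le> x \<and> x \<le> r - int i \<longrightarrow> (x, y + int i) \<in> A)
    (slaw p T A) (map_pmf (\<lambda>ns. run ns (pt j 0 C)) (replicate_pmf T (rnoise p Y)))"
proof -
  \<comment> \<open>The last clause says that rows not yet reached are negative, so they push no
    edge forward.\<close>
  define Q where "Q s A D \<longleftrightarrow>
    (\<forall>i\<le>s. \<forall>x. l \<le> x \<and> x \<le> r - int i \<longrightarrow> (x, y + int i) \<in> A) \<and>
    (\<forall>i\<le>s. \<forall>x. l - D (j + i) \<le> x \<and> x \<le> l \<longrightarrow> (x, y + int i) \<in> A) \<and>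
    (\<forall>i\<le>s. 0 \<le> D (j + i)) \<and> (\<forall>i. i < j \<or> j + s < i \<longrightarrow> D i \<le> int s - C)"
    for s :: nat and A and D :: "nat \<Rightarrow> int"
  define f :: "(nat \<Rightarrow> int) \<Rightarrow> nat \<Rightarrow> site" where
    "f D i = (l - D (i - 1) - 1, y - int j + int i)" for D i
  have "rel_pmf (Q T) (slaw p T A) (map_pmf (\<lambda>ns. run ns (pt j 0 C)) (replicate_pmf T (rnoise p Y)))"
  proof (rule slaw_row_coupling[where f = f and s = 0])
    show "inj (f D)" for D by (auto simp: inj_def f_def)
    show "Q 0 A (pt j 0 C)" using assms by (auto simp: Q_def pt_def)
  next
    fix s A D b assume Q: "Q s A D" and s: "s < T"
    let ?D = "rstep (1, \<lambda>i. i \<in> {1..Y} \<and> b (f D i)) D"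
    have Q1: "\<And>i x. i \<le> s \<Longrightarrow> l \<le> x \<Longrightarrow> x \<le> r - int i \<Longrightarrow> (x, y + int i) \<in> A"
      and Q2: "\<And>i x. i \<le> s \<Longrightarrow> l - D (j + i) \<le> x \<Longrightarrow> x \<le> l \<Longrightarrow> (x, y + int i) \<in> A"
      and Q3: "\<And>i. i \<le> s \<Longrightarrow> 0 \<le> D (j + i)"
      and Q4: "\<And>i. i < j \<or> j + s < i \<Longrightarrow> D i \<le> int s - C"
      using Q unfolding Q_def by auto
    have low: "D i + 1 \<le> 0" if "i < j \<or> j + s < i" for i
      using Q4[OF that] s assms(4) by linarith
    have sureI: "(x, y) \<in> sstep A b" if "sure A (x, y)" for x y using that by (simp add: sstep_def)
    have S1: "(x, y + int i) \<in> sstep A b" if i: "i \<le> Suc s" and x: "l \<le> x" "x \<le> r - int i" for i x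
    proof (cases "i \<le> s")
      case True
      then show ?thesis using Q1 x sstep_bounds(1) by blast
    next
      case False
      then have i: "i = Suc s" using that by simp
      have "(x, y + int s) \<in> A" "(x + 1, y + int s) \<in> A" using x i by (auto intro!: Q1)
      then show ?thesis using i by (intro sureI) (simp add: sure_Pair)
    qed
    have S2: "(x, y + int i) \<in> sstep A b" if i: "i \<le> Suc s" and x: "l - ?D (j + i) \<le> x" "x \<le> l" for i x
    proof (cases "x = l")
      case True
      then show ?thesis using S1[of i l] i s assms(3) by simp
    next
      case xl: False
      have horizontal: ?thesis if "l - (D (j + i) + 1) \<le> x"
      proof (cases "i \<le> s")
        case True
        have "(x + 1, y + int i) \<in> A" using True that x xl by (intro Q2) auto
        then show ?thesis by (intro sureI) (simp add: sure_Pair)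
      next
        case False
        then have "D (j + i) + 1 \<le> 0" by (intro low) auto
        then show ?thesis using that x xl by simp
      qed
      show ?thesis
      proof (cases "l - (D (j + i) + 1) \<le> x")
        case False
        obtain m where m: "j + i = Suc m"
          using x(1) False by (cases "j + i") auto
        have x': "l - (D m + of_bool (Suc m \<in> {1..Y} \<and> b (f D (Suc m)))) \<le> x"
          using x(1) False unfolding m by (auto simp: max_def split: if_splits)
        have "\<not> m < j"
        proof
          assume "m < j"
          then have "D m + 1 \<le> 0" by (intro low) simp
          moreover have "of_bool (Suc m \<in> {1..Y} \<and> b (f D (Suc m))) \<le> (1 :: int)" by simp
          ultimately show False using x' x(2) xl by linarith
        qed
        then obtain i' where i': "i = Suc i'" "m = j + i'" using m by (cases i) auto
        then have "i' \<le> s" using i by simp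
        show ?thesis
        proof (cases "l - D m \<le> x")
          case True
          have "(x, y + int i') \<in> A" using True i' \<open>i' \<le> s\<close> x(2) by (intro Q2) auto
          moreover have "(x + 1, y + int i') \<in> A" using True i' \<open>i' \<le> s\<close> x(2) xl by (intro Q2) auto
          ultimately show ?thesis using i'(1) by (intro sureI) (simp add: sure_Pair)
        next
          case False
          have x'': "x = l - D m - 1 \<and> b (f D (Suc m))"
          proof (cases "Suc m \<in> {1..Y} \<and> b (f D (Suc m))")
            case True
            then show ?thesis using x' False by simp
          next
            case no_coin: False
            then have "(Suc m \<in> {1..Y} \<and> b (f D (Suc m))) = False" by simp
            from x'[unfolded this] False show ?thesis by simp
          qed
          have "(x + 1, y + int i') \<in> A" using x'' i' \<open>i' \<le> s\<close> x(2) xl by (intro Q2) auto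
          moreover have "b (x, y + int i)" using x'' i' by (auto simp: f_def)
          ultimately show ?thesis using i'(1) by (simp add: sstep_def touch_Pair)
        qed
      qed (rule horizontal)
    qed
    have S3: "0 \<le> ?D (j + i)" if "i \<le> Suc s" for i
    proof (cases "i \<le> s")
      case True
      then show ?thesis using Q3[of i] by (cases "j + i") auto
    next
      case False
      then have "i = Suc s" using that by simp
      then show ?thesis using Q3[of s] by (simp add: le_max_iff_disj)
    qed
    have S4: "?D i \<le> int (Suc s) - C" if "i < j \<or> j + Suc s < i" for i
      using that Q4[of i] Q4[of "i - 1"] by (cases i) auto
    show "Q (Suc s) (sstep A b) ?D"
      unfolding Q_def using S1 S2 S3 S4 by blast
  qed (use assms in auto)
  then show ?thesis
  proof (rule pmf.rel_mono_strong, intro allI impI)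
    fix A D i x assume "Q T A D" "i \<le> T" "l - D (j + i) \<le> x \<and> x \<le> r - int i"
    then show "(x, y + int i) \<in> A"
      unfolding Q_def by (cases "x \<le> l") (auto dest: spec)
  qed
qed

section \<open>Symmetries and growing segments\<close>

text \<open>For an involution images and preimages agree, which makes membership in an image
  explicit.\<close>

definition is_symmetry :: "(site \<Rightarrow> site) \<Rightarrow> bool" where
  "is_symmetry \<sigma> \<longleftrightarrow> (\<forall>z. \<sigma> (\<sigma> z) = z) \<and>
     (\<forall>A z. touch (\<sigma> ` A) (\<sigma> z) = touch A z \<and> sure (\<sigma> ` A) (\<sigma> z) = sure A z)"

lemma mem_image_involution:
  assumes "\<And>z. \<sigma> (\<sigma> z) = z"
  shows "w \<in> \<sigma> ` A \<longleftrightarrow> \<sigma> w \<in> A"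
  using assms by (metis image_iff)

text \<open>This exchanges \<open>(1, -1)\<close> with \<open>(0, -1)\<close> and
  \<open>(-1, 1)\<close> with \<open>(0, 1)\<close>, hence left ends of rows with right
  ends.\<close>

definition reflect :: "site \<Rightarrow> site" where
  "reflect z = (- fst z - snd z, snd z)"

lemma mem_reflect: "(x, y) \<in> reflect ` A \<longleftrightarrow> (- x - y, y) \<in> A"
  using mem_image_involution[of reflect "(x, y)" A] by (simp add: reflect_def)

lemma is_symmetry_reflect: "is_symmetry reflect"
proof -
  have reflect: "reflect (x, y) = (- x - y, y)" for x y by (simp add: reflect_def)
  have "touch (reflect ` A) (reflect z) = touch A z \<and> sure (reflect ` A) (reflect z) = sure A z" for A z
    by (cases z) (auto simp: reflect touch_Pair sure_Pair mem_reflect algebra_simps)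
  then show ?thesis by (simp add: is_symmetry_def) (simp add: reflect_def)
qed

lemma is_symmetry_uminus: "is_symmetry uminus"
proof -
  have mem: "(x, y) \<in> uminus ` A \<longleftrightarrow> (- x, - y) \<in> A" for x y and A :: "site set"
    using mem_image_involution[of uminus "(x, y)" A] by simp
  have "touch (uminus ` A) (- z) = touch A z \<and> sure (uminus ` A) (- z) = sure A z" for A and z :: site
    by (cases z) (auto simp: touch_Pair sure_Pair mem algebra_simps)
  then show ?thesis by (simp add: is_symmetry_def)
qed

text \<open>The coins are relabelled by the symmetry, which preserves their law.\<close>

lemma kern_symmetry:
  assumes "is_symmetry \<sigma>" "finite A"
  shows "kern p (\<sigma> ` A) = map_pmf (image \<sigma>) (kern p A)"
proof -
  have inv: "\<And>z. \<sigma> (\<sigma> z) = z" and inv_touch: "\<And>A z. touch (\<sigma> ` A) (\<sigma> z) = touch A z"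
    and inv_sure: "\<And>A z. sure (\<sigma> ` A) (\<sigma> z) = sure A z"
    using assms(1) by (auto simp: is_symmetry_def)
  have mem: "w \<in> \<sigma> ` B \<longleftrightarrow> \<sigma> w \<in> B" for w B by (rule mem_image_involution[OF inv])
  have t: "touch (\<sigma> ` A) z = touch A (\<sigma> z)" and s: "sure (\<sigma> ` A) z = sure A (\<sigma> z)" for z
    using inv_touch[of A "\<sigma> z"] inv_sure[of A "\<sigma> z"] inv by simp_all
  have nb: "nb (\<sigma> ` A) = \<sigma> ` nb A"
    by (auto simp: set_eq_iff mem nb_def t)
  have st: "\<sigma> ` sstep A (g \<circ> \<sigma>) = sstep (\<sigma> ` A) g" for g
    by (auto simp: set_eq_iff mem sstep_def t s inv)
  have "bij_betw \<sigma> (nb A) (\<sigma> ` nb A)"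
    unfolding bij_betw_def inj_on_def using inv by metis
  then have "bern p (nb A) = map_pmf (\<lambda>g. g \<circ> \<sigma>) (bern p (\<sigma> ` nb A))"
    unfolding bern_def using finite_nb[OF assms(2)]
    by (intro Pi_pmf_bij_betw) (auto simp: mem inv)
  then show ?thesis by (simp add: kern_def nb map_pmf_comp st)
qed

lemma slaw_symmetry:
  assumes "is_symmetry \<sigma>" "finite A"
  shows "slaw p t (\<sigma> ` A) = map_pmf (image \<sigma>) (slaw p t A)"
  using assms(2)
proof (induction t arbitrary: A)
  case (Suc t)
  have "slaw p (Suc t) (\<sigma> ` A) = bind_pmf (kern p A) (\<lambda>B. slaw p t (\<sigma> ` B))"
    by (simp add: kern_symmetry[OF assms(1) Suc.prems] bind_map_pmf)
  also have "\<dots> = bind_pmf (kern p A) (\<lambda>B. map_pmf (image \<sigma>) (slaw p t B))"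
    using finite_sstep[OF Suc.prems]
    by (intro bind_pmf_cong refl Suc.IH) (auto simp: kern_def)
  finally show ?case by (simp add: map_bind_pmf)
qed simp

section \<open>Blocks that carry a segment upwards\<close>

definition seg :: "int \<Rightarrow> int \<Rightarrow> int \<Rightarrow> site set" where
  "seg l r y = {l..r} \<times> {y}"

lemma prob_bind_le:
  assumes "\<And>x. x \<in> set_pmf P \<Longrightarrow> x \<notin> G \<Longrightarrow> measure_pmf.prob (f x) B \<le> e" "0 \<le> e"
  shows "measure_pmf.prob (bind_pmf P f) B \<le> measure_pmf.prob P G + e"
proof -
  have "ennreal (measure_pmf.prob (bind_pmf P f) B) = (\<integral>\<^sup>+x. ennreal (measure_pmf.prob (f x) B) \<partial>P)"
    by (simp flip: measure_pmf.emeasure_eq_measure)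
  also have "\<dots> \<le> (\<integral>\<^sup>+x. indicator G x + ennreal e \<partial>P)"
  proof (rule nn_integral_mono_AE, unfold AE_measure_pmf_iff, intro ballI)
    fix x assume "x \<in> set_pmf P"
    then show "ennreal (measure_pmf.prob (f x) B) \<le> indicator G x + ennreal e"
    proof (cases "x \<in> G")
      case True
      have "ennreal (measure_pmf.prob (f x) B) \<le> 1" by simp
      also have "\<dots> \<le> indicator G x + ennreal e" using True by simp
      finally show ?thesis .
    qed (use assms(1) in \<open>auto intro: ennreal_leI\<close>)
  qed
  also have "\<dots> = ennreal (measure_pmf.prob P G + e)"
    by (simp add: nn_integral_add measure_pmf.emeasure_eq_measure assms(2))
  finally show ?thesis using assms(2) by (subst (asm) ennreal_le_iff) auto
qed

text \<open>Only the left end is followed; the right end retreats by one site per row, as the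
  deterministic base does.\<close>

lemma block_left:
  assumes "row_speed p a \<kappa>" "0 \<le> a" "a \<le> 1"
  obtains c where "c > 0" "\<forall>\<^sub>F T in sequentially. \<forall>A l r y. finite A \<longrightarrow> seg l r y \<subseteq> A \<longrightarrow> int T \<le> r - l \<longrightarrow>
    measure_pmf.prob (slaw p T A) {A'. \<not> seg (l - \<lfloor>\<kappa> * real T\<rfloor>) (r - \<lfloor>a * real T\<rfloor>) (y + \<lfloor>a * real T\<rfloor>) \<subseteq> A'}
    \<le> exp (- c * real T)"
proof -
  obtain c where c: "c > 0" "\<forall>\<^sub>F T in sequentially. \<exists>j Y C. int T < C \<and>
     measure_pmf.prob (replicate_pmf T (rnoise p Y))
       {ns. of_int (run ns (pt j 0 C) (j + nat \<lfloor>a * real T\<rfloor>)) < \<kappa> * real T} \<le> exp (- c * real T)"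
    using assms(1) unfolding row_speed_def by blast
  show thesis
  proof (rule that[OF c(1)], rule eventually_mono[OF c(2)], intro allI impI)
    fix T :: nat and A l r y
    assume ex: "\<exists>j Y C. int T < C \<and> measure_pmf.prob (replicate_pmf T (rnoise p Y))
       {ns. of_int (run ns (pt j 0 C) (j + nat \<lfloor>a * real T\<rfloor>)) < \<kappa> * real T} \<le> exp (- c * real T)"
      and A: "finite A" "seg l r y \<subseteq> A" "int T \<le> r - l"
    obtain j Y C where C: "int T < C" and le: "measure_pmf.prob (replicate_pmf T (rnoise p Y))
       {ns. of_int (run ns (pt j 0 C) (j + nat \<lfloor>a * real T\<rfloor>)) < \<kappa> * real T} \<le> exp (- c * real T)"
      using ex by blast
    define n where "n = nat \<lfloor>a * real T\<rfloor>"
    have "a * real T \<le> 1 * real T" using assms by (intro mult_right_mono) auto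
    then have n: "n \<le> T" "int n = \<lfloor>a * real T\<rfloor>" using assms by (simp_all add: n_def) linarith
    let ?Bad = "{A'. \<not> seg (l - \<lfloor>\<kappa> * real T\<rfloor>) (r - \<lfloor>a * real T\<rfloor>) (y + \<lfloor>a * real T\<rfloor>) \<subseteq> A'}"
    let ?R = "\<lambda>A D. \<forall>i\<le>T. \<forall>x. l - D (j + i) \<le> x \<and> x \<le> r - int i \<longrightarrow> (x, y + int i) \<in> A"
    have rel: "rel_pmf (\<lambda>A D. \<forall>i\<le>T. \<forall>x. l - D (j + i) \<le> x \<and> x \<le> r - int i \<longrightarrow> (x, y + int i) \<in> A)
      (slaw p T A) (map_pmf (\<lambda>ns. run ns (pt j 0 C)) (replicate_pmf T (rnoise p Y)))"
      using A C by (intro lower_coupling) (auto simp: seg_def)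
    let ?run = "map_pmf (\<lambda>ns. run ns (pt j 0 C)) (replicate_pmf T (rnoise p Y))"
    have "measure_pmf.prob (slaw p T A) ?Bad \<le> measure_pmf.prob ?run {D. \<exists>B\<in>?Bad. ?R B D}"
      by (rule rel_pmf_measureD[OF rel])
    also have "\<dots> \<le> measure_pmf.prob ?run {D. of_int (D (j + n)) < \<kappa> * real T}"
    proof (rule prob_mono_pmf, elim CollectE bexE, intro CollectI)
      fix D :: "nat \<Rightarrow> int" and B
      assume B: "\<not> seg (l - \<lfloor>\<kappa> * real T\<rfloor>) (r - \<lfloor>a * real T\<rfloor>) (y + \<lfloor>a * real T\<rfloor>) \<subseteq> B"
        and R: "\<forall>i\<le>T. \<forall>x. l - D (j + i) \<le> x \<and> x \<le> r - int i \<longrightarrow> (x, y + int i) \<in> B"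
      show "of_int (D (j + n)) < \<kappa> * real T"
      proof (rule ccontr)
        assume "\<not> of_int (D (j + n)) < \<kappa> * real T"
        then have "\<lfloor>\<kappa> * real T\<rfloor> \<le> D (j + n)" by linarith
        then have "seg (l - \<lfloor>\<kappa> * real T\<rfloor>) (r - int n) (y + int n) \<subseteq> B"
          using R n(1) by (auto simp: seg_def)
        with B n(2) show False by simp
      qed
    qed
    also have "\<dots> \<le> exp (- c * real T)" using le by (simp add: n_def vimage_def)
    finally show "measure_pmf.prob (slaw p T A) {A'. \<not> seg (l - \<lfloor>\<kappa> * real T\<rfloor>) (r - \<lfloor>a * real T\<rfloor>) (y + \<lfloor>a * real T\<rfloor>) \<subseteq> A'}
      \<le> exp (- c * real T)" .
  qed
qed

text \<open>The one-sided estimate is joined with its mirror image. The two segments overlap because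
  at most \<open>T\<close> rows are climbed and the initial length is at least
  \<open>T\<close>.\<close>

lemma block:
  assumes "row_speed p a \<kappa>" "0 \<le> a" "a \<le> 1"
  obtains c where "c > 0" "\<forall>\<^sub>F T in sequentially. \<forall>A l r y. finite A \<longrightarrow> seg l r y \<subseteq> A \<longrightarrow> int T \<le> r - l \<longrightarrow>
    measure_pmf.prob (slaw p T A) {A'. \<not> seg (l - \<lfloor>\<kappa> * real T\<rfloor>) (r + (\<lfloor>\<kappa> * real T\<rfloor> - \<lfloor>a * real T\<rfloor>)) (y + \<lfloor>a * real T\<rfloor>) \<subseteq> A'}
    \<le> 2 * exp (- c * real T)"
proof -
  obtain c where c: "c > 0" "\<forall>\<^sub>F T in sequentially. \<forall>A l r y. finite A \<longrightarrow> seg l r y \<subseteq> A \<longrightarrow> int T \<le> r - l \<longrightarrow>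
    measure_pmf.prob (slaw p T A) {A'. \<not> seg (l - \<lfloor>\<kappa> * real T\<rfloor>) (r - \<lfloor>a * real T\<rfloor>) (y + \<lfloor>a * real T\<rfloor>) \<subseteq> A'}
    \<le> exp (- c * real T)"
    using block_left[OF assms] by blast
  show thesis
  proof (rule that[OF c(1)], rule eventually_mono[OF c(2)], intro allI impI)
    fix T :: nat and A l r y
    assume bl: "\<forall>A l r y. finite A \<longrightarrow> seg l r y \<subseteq> A \<longrightarrow> int T \<le> r - l \<longrightarrow>
      measure_pmf.prob (slaw p T A) {A'. \<not> seg (l - \<lfloor>\<kappa> * real T\<rfloor>) (r - \<lfloor>a * real T\<rfloor>) (y + \<lfloor>a * real T\<rfloor>) \<subseteq> A'}
      \<le> exp (- c * real T)"
      and A: "finite A" "seg l r y \<subseteq> A" "int T \<le> r - l"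
    let ?k = "\<lfloor>\<kappa> * real T\<rfloor>" and ?n = "\<lfloor>a * real T\<rfloor>"
    have "a * real T \<le> 1 * real T" using assms by (intro mult_right_mono) auto
    then have n: "0 \<le> ?n" "?n \<le> int T" using assms by (simp, linarith)
    have inv: "\<And>z. reflect (reflect z) = z" by (simp add: reflect_def)
    have "seg (- r - y) (- l - y) y \<subseteq> reflect ` A"
    proof
      fix z assume "z \<in> seg (- r - y) (- l - y) y"
      then have "reflect z \<in> seg l r y" by (auto simp: seg_def reflect_def)
      then show "z \<in> reflect ` A" using A(2) inv by (metis image_eqI subsetD)
    qed
    then have "measure_pmf.prob (slaw p T (reflect ` A)) {A'. \<not> seg (- r - y - ?k) (- l - y - ?n) (y + ?n) \<subseteq> A'}
      \<le> exp (- c * real T)"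
      using A by (intro bl[rule_format]) auto
    moreover have "seg (- r - y - ?k) (- l - y - ?n) (y + ?n) \<subseteq> reflect ` B \<longleftrightarrow> seg l (r + (?k - ?n)) (y + ?n) \<subseteq> B" for B
    proof -
      have "seg (- r - y - ?k) (- l - y - ?n) (y + ?n) = reflect ` seg l (r + (?k - ?n)) (y + ?n)"
      proof (intro set_eqI)
        fix z :: site
        show "z \<in> seg (- r - y - ?k) (- l - y - ?n) (y + ?n) \<longleftrightarrow> z \<in> reflect ` seg l (r + (?k - ?n)) (y + ?n)"
          by (cases z) (auto simp: mem_reflect seg_def)
      qed
      moreover have "inj reflect" using inv by (metis injI)
      ultimately show ?thesis by (simp add: inj_image_subset_iff)
    qed
    ultimately have right: "measure_pmf.prob (slaw p T A) {A'. \<not> seg l (r + (?k - ?n)) (y + ?n) \<subseteq> A'} \<le> exp (- c * real T)"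
      by (simp add: slaw_symmetry[OF is_symmetry_reflect A(1)] vimage_def)
    have left: "measure_pmf.prob (slaw p T A) {A'. \<not> seg (l - ?k) (r - ?n) (y + ?n) \<subseteq> A'} \<le> exp (- c * real T)"
      using A by (intro bl[rule_format]) auto
    have un: "seg (l - ?k) (r + (?k - ?n)) (y + ?n) \<subseteq> seg (l - ?k) (r - ?n) (y + ?n) \<union> seg l (r + (?k - ?n)) (y + ?n)"
      using A(3) n by (auto simp: seg_def)
    have "measure_pmf.prob (slaw p T A) {A'. \<not> seg (l - ?k) (r + (?k - ?n)) (y + ?n) \<subseteq> A'}
      \<le> measure_pmf.prob (slaw p T A) ({A'. \<not> seg (l - ?k) (r - ?n) (y + ?n) \<subseteq> A'} \<union> {A'. \<not> seg l (r + (?k - ?n)) (y + ?n) \<subseteq> A'})"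
      using un by (intro prob_mono_pmf) blast
    also have "\<dots> \<le> exp (- c * real T) + exp (- c * real T)"
      by (rule order_trans[OF prob_Un_le add_mono[OF left right]])
    finally show "measure_pmf.prob (slaw p T A) {A'. \<not> seg (l - ?k) (r + (?k - ?n)) (y + ?n) \<subseteq> A'} \<le> 2 * exp (- c * real T)"
      by simp
  qed
qed

text \<open>\<open>n \<le> 2 * k\<close> says that a block does not shorten the segment, so the next
  block can start from it.\<close>

lemma many_blocks:
  assumes blk: "\<And>A l r y. finite A \<Longrightarrow> seg l r y \<subseteq> A \<Longrightarrow> int T \<le> r - l \<Longrightarrow>
      measure_pmf.prob (slaw p T A) {A'. \<not> seg (l - k) (r + (k - n)) (y + n) \<subseteq> A'} \<le> e"
    and "n \<le> 2 * k" "finite A" "seg l r y \<subseteq> A" "int T \<le> r - l" "0 \<le> e"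
  shows "measure_pmf.prob (slaw p (m * T) A)
    {A'. \<not> seg (l - int m * k) (r + int m * (k - n)) (y + int m * n) \<subseteq> A'} \<le> real m * e"
proof (induction m)
  case 0
  then show ?case using assms by simp
next
  case (Suc m)
  let ?l = "l - int m * k" and ?r = "r + int m * (k - n)" and ?y = "y + int m * n"
  have "int m * n \<le> int m * (2 * k)" using assms(2) by (intro mult_left_mono) auto
  then have len: "int T \<le> ?r - ?l" using assms(5) by (simp add: algebra_simps)
  have next_seg: "seg (l - int (Suc m) * k) (r + int (Suc m) * (k - n)) (y + int (Suc m) * n)
      = seg (?l - k) (?r + (k - n)) (?y + n)" by (simp add: algebra_simps)
  have "slaw p (Suc m * T) A = bind_pmf (slaw p (m * T) A) (slaw p T)"
    unfolding slaw_add[symmetric] by (simp add: add.commute)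
  then have "measure_pmf.prob (slaw p (Suc m * T) A) {A'. \<not> seg (?l - k) (?r + (k - n)) (?y + n) \<subseteq> A'}
      \<le> measure_pmf.prob (slaw p (m * T) A) {A'. \<not> seg ?l ?r ?y \<subseteq> A'} + e"
    by (simp only:) (intro prob_bind_le blk; use assms(3,6) len finite_slaw in auto)
  also have "\<dots> \<le> real m * e + e" using Suc by simp
  finally show ?case unfolding next_seg by (simp add: algebra_simps)
qed

lemma horizontal_growth:
  assumes "(x, y) \<in> A" "A' \<in> set_pmf (slaw p s A)"
  shows "seg (x - int s) (x + int s) y \<subseteq> A'"
proof -
  have step: "seg (l - 1) (r + 1) y \<subseteq> sstep B b" if "seg l r y \<subseteq> B" "l \<le> r" for l r B b
  proof
    fix z assume z: "z \<in> seg (l - 1) (r + 1) y"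
    then obtain x where x: "z = (x, y)" "l - 1 \<le> x" "x \<le> r + 1" by (auto simp: seg_def)
    have mem: "(x', y) \<in> B" if "l \<le> x'" "x' \<le> r" for x'
      using \<open>seg l r y \<subseteq> B\<close> that by (auto simp: seg_def)
    have "(x, y) \<in> B \<or> (x + 1, y) \<in> B \<or> (x - 1, y) \<in> B"
      using mem[of x] mem[of "x + 1"] mem[of "x - 1"] x that(2) by linarith
    then show "z \<in> sstep B b" using x(1) by (auto simp: sstep_def sure_Pair)
  qed
  have "seg (l - int s) (r + int s) y \<subseteq> A'" if "seg l r y \<subseteq> A" "l \<le> r" "A' \<in> set_pmf (slaw p s A)" for l r A
    using that
  proof (induction s arbitrary: l r A)
    case (Suc s)
    then obtain b where "A' \<in> set_pmf (slaw p s (sstep A b))" by (auto simp: kern_def)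
    from Suc.IH[OF step[OF Suc.prems(1,2)] _ this] Suc.prems(2) show ?case by (simp add: algebra_simps)
  qed simp
  from this[of x x A] assms show ?thesis by (auto simp: seg_def)
qed

lemma slaw_bounded:
  assumes "\<And>x y. (x, y) \<in> A \<Longrightarrow> \<bar>x\<bar> \<le> k \<and> \<bar>y\<bar> \<le> k" "A' \<in> set_pmf (slaw p t A)" "(x, y) \<in> A'"
  shows "\<bar>x\<bar> \<le> k + int t \<and> \<bar>y\<bar> \<le> k + int t"
  using assms
proof (induction t arbitrary: A k)
  case (Suc t)
  then obtain b where b: "A' \<in> set_pmf (slaw p t (sstep A b))" by (auto simp: kern_def)
  have "\<bar>x\<bar> \<le> k + 1 \<and> \<bar>y\<bar> \<le> k + 1" if "(x, y) \<in> sstep A b" for x y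
  proof -
    have "touch A (x, y)" using sstep_bounds(2)[of A b] that by (auto simp: nb_def)
    then show ?thesis using Suc.prems(1) unfolding touch_Pair by fastforce
  qed
  from Suc.IH[OF this b Suc.prems(3)] show ?case by simp
qed auto

section \<open>Reached points and forbidden half-planes\<close>

lemma dist_le_sum_abs:
  fixes a b c d :: real
  shows "dist (a, b) (c, d) \<le> \<bar>a - c\<bar> + \<bar>b - d\<bar>"
  using sqrt_sum_squares_le_sum_abs[of "a - c" "b - d"] by (simp add: dist_Pair_Pair dist_real_def)

text \<open>The grown segment at time \<open>t\<close>: horizontal growth for time \<open>t - m T\<close>, then \<open>m\<close> blocks of
  length \<open>T\<close> climbing with slope \<open>a\<close>. Every constant here is up to an error of order \<open>m + t / m\<close>.\<close>

lemma segment_hits_ball: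
  fixes a \<kappa> \<theta> x \<epsilon> :: real and x\<^sub>0 y\<^sub>0 :: int and m t T :: nat
  assumes a: "0 \<le> a" "a \<le> 1" and \<kappa>: "a < 2 * \<kappa>" "\<kappa> \<le> 1" and \<theta>: "0 < \<theta>" "\<theta> \<le> 1"
    and x: "- (1 - \<theta>) - \<theta> * \<kappa> \<le> x" "x \<le> (1 - \<theta>) + \<theta> * (\<kappa> - a)"
    and T: "real T \<le> \<theta> * real t / real (m + 2)" "\<theta> * real t / real (m + 2) < real T + 1"
    and t: "0 < t" "(\<bar>real_of_int x\<^sub>0\<bar> + \<bar>real_of_int y\<^sub>0\<bar> + 3 * real m + 2) / real t + 2 / real (m + 2) < \<epsilon>"
  defines "k \<equiv> \<lfloor>\<kappa> * real T\<rfloor>" and "n \<equiv> \<lfloor>a * real T\<rfloor>" and "s \<equiv> int t - int m * int T"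
  assumes len: "x\<^sub>0 - s - int m * k \<le> x\<^sub>0 + s + int m * (k - n)"
    and B: "seg (x\<^sub>0 - s - int m * k) (x\<^sub>0 + s + int m * (k - n)) (y\<^sub>0 + int m * n) \<subseteq> B"
  shows "scaled t B \<inter> ball (x, \<theta> * a) \<epsilon> \<noteq> {}"
proof -
  define lo hi Yv where "lo = x\<^sub>0 - s - int m * k" and "hi = x\<^sub>0 + s + int m * (k - n)" and "Yv = y\<^sub>0 + int m * n"
  \<comment> \<open>The wanted abscissa, clamped to the segment; \<open>lo\<close> and
    \<open>hi\<close> overshoot it by bounded amounts only.\<close>
  define X where "X = max lo (min hi \<lfloor>x * real t\<rfloor>)"
  have k: "\<kappa> * real T - 1 \<le> real_of_int k" "real_of_int k \<le> \<kappa> * real T" unfolding k_def by linarith+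
  have n: "a * real T - 1 \<le> real_of_int n" "real_of_int n \<le> a * real T" unfolding n_def by linarith+
  have mT: "real m * real T \<le> \<theta> * real t"
  proof -
    have "real (m + 2) * real T \<le> \<theta> * real t" using T(1) by (simp add: field_simps)
    then show ?thesis by (simp add: algebra_simps)
  qed
  have mT': "\<theta> * real t - 2 * (\<theta> * real t / real (m + 2)) - real m \<le> real m * real T"
  proof -
    have "real m * (\<theta> * real t / real (m + 2)) \<le> real m * (real T + 1)"
      using T(2) by (intro mult_left_mono) auto
    moreover have "real m * (\<theta> * real t / real (m + 2)) + 2 * (\<theta> * real t / real (m + 2)) = \<theta> * real t"
    proof -
      have "real m * z + 2 * z = real (m + 2) * z" for z by (simp add: algebra_simps)
      moreover have "real (m + 2) * (\<theta> * real t / real (m + 2)) = \<theta> * real t"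
        by (rule nonzero_mult_div_cancel_left[THEN trans[OF times_divide_eq_right]]) simp
      ultimately show ?thesis by (simp only:)
    qed
    ultimately show ?thesis by (simp add: algebra_simps)
  qed
  have mk: "real m * (\<kappa> * real T) - real m \<le> real m * real_of_int k" "real m * real_of_int k \<le> real m * (\<kappa> * real T)"
    using mult_left_mono[OF k(1), of "real m"] mult_left_mono[OF k(2), of "real m"] by (simp_all add: algebra_simps)
  have mn: "real m * (a * real T) - real m \<le> real m * real_of_int n" "real m * real_of_int n \<le> real m * (a * real T)"
    using mult_left_mono[OF n(1), of "real m"] mult_left_mono[OF n(2), of "real m"] by (simp_all add: algebra_simps)
  have lo: "real_of_int lo \<le> x * real t + \<bar>real_of_int x\<^sub>0\<bar> + real m"
  proof -
    have "(1 - \<kappa>) * (real m * real T) \<le> (1 - \<kappa>) * (\<theta> * real t)"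
      using \<kappa> mT by (intro mult_left_mono) auto
    moreover have "(- (1 - \<theta>) - \<theta> * \<kappa>) * real t \<le> x * real t" using x by (intro mult_right_mono) auto
    moreover have "real_of_int lo = of_int x\<^sub>0 - real t + real m * real T - real m * real_of_int k"
      by (simp add: lo_def s_def)
    ultimately show ?thesis using mk by (simp add: algebra_simps)
  qed
  have hi: "x * real t - \<bar>real_of_int x\<^sub>0\<bar> - real m \<le> real_of_int hi"
  proof -
    have "(1 + a - \<kappa>) * (real m * real T) \<le> (1 + a - \<kappa>) * (\<theta> * real t)"
      using \<kappa> a mT by (intro mult_left_mono) auto
    moreover have "x * real t \<le> ((1 - \<theta>) + \<theta> * (\<kappa> - a)) * real t" using x by (intro mult_right_mono) auto
    moreover have "real_of_int hi = of_int x\<^sub>0 + real t - real m * real T + real m * real_of_int k - real m * real_of_int n"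
      by (simp add: hi_def s_def algebra_simps)
    ultimately show ?thesis using mk mn by (simp add: algebra_simps)
  qed
  have X: "\<bar>real_of_int X - x * real t\<bar> \<le> \<bar>real_of_int x\<^sub>0\<bar> + real m + 1"
    using lo hi unfolding X_def by (auto simp: max_def min_def abs_if; linarith)
  have Y: "\<bar>real_of_int Yv - \<theta> * a * real t\<bar> \<le> \<bar>real_of_int y\<^sub>0\<bar> + 2 * real m + 2 * real t / real (m + 2)"
  proof -
    have "a * (real m * real T) \<le> a * (\<theta> * real t)" using a mT by (intro mult_left_mono) auto
    moreover have "a * (\<theta> * real t) - a * (2 * (\<theta> * real t / real (m + 2)) + real m) \<le> a * (real m * real T)"
      using mult_left_mono[OF mT' a(1)] by (simp add: algebra_simps)
    moreover have "a * (2 * (\<theta> * real t / real (m + 2)) + real m) \<le> 1 * (2 * (1 * real t / real (m + 2)) + real m)"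
      using a \<theta> by (intro mult_mono add_mono divide_right_mono mult_left_mono order_refl) auto
    moreover have "real_of_int Yv = of_int y\<^sub>0 + real m * real_of_int n" by (simp add: Yv_def)
    ultimately show ?thesis using mn by (simp add: algebra_simps abs_if)
  qed
  have "dist (real_of_int X / real t, real_of_int Yv / real t) (x, \<theta> * a)
      \<le> \<bar>real_of_int X / real t - x\<bar> + \<bar>real_of_int Yv / real t - \<theta> * a\<bar>"
    by (rule dist_le_sum_abs)
  also have "\<dots> = (\<bar>real_of_int X - x * real t\<bar> + \<bar>real_of_int Yv - \<theta> * a * real t\<bar>) / real t"
  proof -
    have "\<bar>z / real t - u\<bar> = \<bar>z - u * real t\<bar> / real t" for z u
    proof -
      have "z / real t - u = (z - u * real t) / real t" using t(1) by (simp add: field_simps)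
      then show ?thesis using t(1) by (simp add: abs_divide)
    qed
    then show ?thesis by (simp add: add_divide_distrib)
  qed
  also have "\<dots> \<le> (\<bar>real_of_int x\<^sub>0\<bar> + \<bar>real_of_int y\<^sub>0\<bar> + 3 * real m + 2 + 2 * real t / real (m + 2)) / real t"
    using X Y by (intro divide_right_mono) auto
  also have "\<dots> = (\<bar>real_of_int x\<^sub>0\<bar> + \<bar>real_of_int y\<^sub>0\<bar> + 3 * real m + 2) / real t + 2 / real (m + 2)"
    using t(1) by (simp add: add_divide_distrib)
  also note t(2)
  finally have "(real_of_int X / real t, real_of_int Yv / real t) \<in> ball (x, \<theta> * a) \<epsilon>"
    by (simp add: dist_commute)
  moreover have "(X, Yv) \<in> B"
    using B len unfolding seg_def X_def Yv_def lo_def hi_def by auto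
  then have "(real_of_int X / real t, real_of_int Yv / real t) \<in> scaled t B"
    unfolding scaled_def by force
  ultimately show ?thesis by blast
qed

text \<open>A share \<open>1 - \<theta>\<close> of the time is spent on horizontal growth at speed
  1, the share \<open>\<theta>\<close> on climbing with slope \<open>a\<close>. The range of
  \<open>x\<close> is the row obtained in this way at height \<open>\<theta> * a\<close>.\<close>

lemma point_reached:
  assumes speed: "row_speed p a \<kappa>" and a: "0 \<le> a" "a \<le> 1" and \<kappa>: "a < 2 * \<kappa>" "\<kappa> \<le> 1"
    and \<theta>: "0 < \<theta>" "\<theta> \<le> 1"
    and x: "- (1 - \<theta>) - \<theta> * \<kappa> \<le> x" "x \<le> (1 - \<theta>) + \<theta> * (\<kappa> - a)"
    and A: "finite A" "A \<noteq> {}" and \<epsilon>: "0 < \<epsilon>"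
  shows "expsmall (\<lambda>t. measure_pmf.prob (slaw p t A) {B. scaled t B \<inter> ball (x, \<theta> * a) \<epsilon> = {}})"
proof -
  obtain x\<^sub>0 y\<^sub>0 where z0: "(x\<^sub>0, y\<^sub>0) \<in> A" using A(2) by auto
  obtain c where c: "c > 0" "\<forall>\<^sub>F T in sequentially. \<forall>A l r y. finite A \<longrightarrow> seg l r y \<subseteq> A \<longrightarrow> int T \<le> r - l \<longrightarrow>
    measure_pmf.prob (slaw p T A) {A'. \<not> seg (l - \<lfloor>\<kappa> * real T\<rfloor>) (r + (\<lfloor>\<kappa> * real T\<rfloor> - \<lfloor>a * real T\<rfloor>)) (y + \<lfloor>a * real T\<rfloor>) \<subseteq> A'}
    \<le> 2 * exp (- c * real T)"
    using block[OF speed a] by blast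
  obtain m where m: "4 / \<epsilon> < real m" using reals_Archimedean2 by blast
  have m2: "2 / real (m + 2) < \<epsilon> / 2"
  proof -
    have "4 < real m * \<epsilon>" using m \<epsilon> by (simp add: field_simps)
    then have "4 < real (m + 2) * \<epsilon>" using \<epsilon> by (simp add: algebra_simps)
    then show ?thesis by (simp add: field_simps)
  qed
  \<comment> \<open>Dividing by \<open>m + 2\<close> rather than \<open>m\<close> keeps the time of
    two blocks for the horizontal start, which must reach length \<open>T t\<close> even if
    \<open>\<theta> = 1\<close>. As \<open>m\<close> is fixed, blocks grow linearly with
    \<open>t\<close> and their errors are exponentially small.\<close>
  define T where "T t = nat \<lfloor>\<theta> * real t / real (m + 2)\<rfloor>" for t :: nat
  have T: "real (T t) \<le> \<theta> * real t / real (m + 2)" "\<theta> * real t / real (m + 2) < real (T t) + 1" for t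
    using nat_floor_bounds[of "\<theta> * real t / real (m + 2)"] \<theta> by (simp_all add: T_def)
  have lin: "\<forall>\<^sub>F t in sequentially. \<theta> / (2 * real (m + 2)) * real t \<le> real (T t)"
  proof -
    have "filterlim (\<lambda>t. \<theta> / (2 * real (m + 2)) * real t) at_top sequentially"
      using \<theta> by real_asymp
    then have "\<forall>\<^sub>F t in sequentially. 1 \<le> \<theta> / (2 * real (m + 2)) * real t"
      unfolding filterlim_at_top by blast
    then show ?thesis
    proof eventually_elim
      case (elim t)
      have "\<theta> * real t / real (m + 2) = 2 * (\<theta> / (2 * real (m + 2)) * real t)"
        by (simp add: field_simps)
      then show ?case using T(2)[of t] elim by linarith
    qed
  qed
  have pos: "0 < \<theta> / (2 * real (m + 2))" using \<theta> by simp
  have "filterlim (\<lambda>t. real (T t)) at_top sequentially"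
  proof (rule filterlim_at_top_mono[OF _ lin])
    show "filterlim (\<lambda>t. \<theta> / (2 * real (m + 2)) * real t) at_top sequentially"
      using \<theta> by real_asymp
  qed
  then have T_lim: "filterlim T at_top sequentially"
    using filterlim_sequentially_iff_filterlim_real by blast
  have "filterlim (\<lambda>n. real n * (2 * \<kappa> - a)) at_top sequentially" using \<kappa>(1) by real_asymp
  then have ev1: "\<forall>\<^sub>F n in sequentially. 2 \<le> real n * (2 * \<kappa> - a)" by (simp add: filterlim_at_top)
  let ?K = "\<bar>real_of_int x\<^sub>0\<bar> + \<bar>real_of_int y\<^sub>0\<bar> + 3 * real m + 2"
  have "((\<lambda>t. ?K / real t + 2 / real (m + 2)) \<longlongrightarrow> 0 + 2 / real (m + 2)) sequentially"
    by (intro tendsto_intros lim_const_over_n)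
  then have ev2: "\<forall>\<^sub>F t in sequentially. ?K / real t + 2 / real (m + 2) < \<epsilon>"
    by (rule order_tendstoD) (use m2 \<epsilon> in simp)
  have "\<forall>\<^sub>F t in sequentially. measure_pmf.prob (slaw p t A) {B. scaled t B \<inter> ball (x, \<theta> * a) \<epsilon> = {}}
      \<le> real m * (2 * exp (- c * real (T t)))"
    using eventually_compose_filterlim[OF c(2) T_lim] eventually_compose_filterlim[OF ev1 T_lim] ev2
      eventually_gt_at_top[of 0]
  proof eventually_elim
    case (elim t)
    let ?k = "\<lfloor>\<kappa> * real (T t)\<rfloor>" and ?n = "\<lfloor>a * real (T t)\<rfloor>"
    define s where "s = t - m * T t"
    have mT: "2 * T t + m * T t \<le> t"
    proof -
      have "real (m + 2) * real (T t) \<le> \<theta> * real t" using T(1)[of t] by (simp add: field_simps)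
      also have "\<dots> \<le> 1 * real t" using \<theta> by (intro mult_right_mono) auto
      finally have "real ((m + 2) * T t) \<le> real t" unfolding of_nat_mult by (simp only: mult_1)
      then have "(m + 2) * T t \<le> t" by (simp only: of_nat_le_iff)
      then show ?thesis by (simp add: algebra_simps)
    qed
    have t: "t = s + m * T t" "int s = int t - int m * int (T t)" "2 * T t \<le> s"
      using mT by (auto simp: s_def of_nat_diff)
    have nk: "?n \<le> 2 * ?k"
    proof -
      have "real_of_int ?n \<le> a * real (T t)" "\<kappa> * real (T t) - 1 < real_of_int ?k" by linarith+
      moreover have "real (T t) * (2 * \<kappa> - a) = 2 * (\<kappa> * real (T t)) - a * real (T t)"
        by (simp add: algebra_simps)
      ultimately have "real_of_int ?n \<le> 2 * real_of_int ?k" using elim(2) by linarith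
      then show ?thesis by linarith
    qed
    have len: "x\<^sub>0 - int s - int m * ?k \<le> x\<^sub>0 + int s + int m * (?k - ?n)"
      using mult_left_mono[OF nk, of "int m"] by (simp add: algebra_simps)
    have "measure_pmf.prob (slaw p t A) {B. scaled t B \<inter> ball (x, \<theta> * a) \<epsilon> = {}}
      \<le> measure_pmf.prob (slaw p t A) {B. \<not> seg (x\<^sub>0 - int s - int m * ?k) (x\<^sub>0 + int s + int m * (?k - ?n)) (y\<^sub>0 + int m * ?n) \<subseteq> B}"
    proof (rule prob_mono_pmf, elim CollectE, intro CollectI notI)
      fix B assume e: "scaled t B \<inter> ball (x, \<theta> * a) \<epsilon> = {}"
        and B: "seg (x\<^sub>0 - int s - int m * ?k) (x\<^sub>0 + int s + int m * (?k - ?n)) (y\<^sub>0 + int m * ?n) \<subseteq> B"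
      have "scaled t B \<inter> ball (x, \<theta> * a) \<epsilon> \<noteq> {}"
        using elim(3,4) len B unfolding t(2)
        by (intro segment_hits_ball[OF a \<kappa> \<theta> x T]) auto
      with e show False by contradiction
    qed
    also have "\<dots> = measure_pmf.prob (bind_pmf (slaw p s A) (slaw p (m * T t)))
        {B. \<not> seg (x\<^sub>0 - int s - int m * ?k) (x\<^sub>0 + int s + int m * (?k - ?n)) (y\<^sub>0 + int m * ?n) \<subseteq> B}"
      by (subst (1) t(1)) (simp only: slaw_add)
    also have "\<dots> \<le> measure_pmf.prob (slaw p s A) {} + real m * (2 * exp (- c * real (T t)))"
    proof (rule prob_bind_le)
      fix B assume B: "B \<in> set_pmf (slaw p s A)"
      show "measure_pmf.prob (slaw p (m * T t) B)
        {B. \<not> seg (x\<^sub>0 - int s - int m * ?k) (x\<^sub>0 + int s + int m * (?k - ?n)) (y\<^sub>0 + int m * ?n) \<subseteq> B}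
        \<le> real m * (2 * exp (- c * real (T t)))"
      proof (rule many_blocks[OF _ nk])
        show "finite B" using B A(1) by (rule finite_slaw)
        show "seg (x\<^sub>0 - int s) (x\<^sub>0 + int s) y\<^sub>0 \<subseteq> B" using z0 B by (rule horizontal_growth)
        show "int (T t) \<le> x\<^sub>0 + int s - (x\<^sub>0 - int s)" using t(3) by simp
      qed (use elim(1) in auto)
    qed simp
    finally show ?case by simp
  qed
  moreover have "expsmall (\<lambda>t. real m * (2 * exp (- c * real (T t))))"
  proof -
    have "expsmall (\<lambda>n. exp (- c * real n))"
      unfolding expsmall_def using c(1) by (intro exI[of _ c]) auto
    then have "expsmall (\<lambda>n. (0 * real n + 2 * real m) * exp (- c * real n))"
      by (rule expsmall_linear_mult) auto
    then have "expsmall (\<lambda>n. real m * (2 * exp (- c * real n)))" by (simp add: mult_ac)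
    from expsmall_compose[OF this pos lin] show ?thesis .
  qed
  ultimately show ?thesis by (rule expsmall_mono[rotated])
qed

text \<open>A stationary profile based at row \<open>k\<close> and shifted by \<open>k\<close>
  contains \<open>A\<close>. For fixed increments the coupling bounds the site dynamics by a run
  without source; averaging over the increments, drawn independently, gives the stationary
  law.\<close>

lemma half_plane_bound:
  assumes bal: "balanced p v q" and A: "finite A" and \<epsilon>: "0 < \<epsilon>"
  defines "\<eta> \<equiv> 1 / (1 - q)"
  shows "expsmall (\<lambda>t. measure_pmf.prob (slaw p t A)
    {B. \<exists>x y. (x, y) \<in> B \<and> 0 \<le> y \<and> real t * \<eta> + of_int y * (v - \<eta>) + \<epsilon> * real t \<le> - of_int x})"
proof -
  define \<mu> where "\<mu> = v - \<eta>"
  have "1 \<le> \<eta>" "v \<le> 1" using bal by (auto simp: \<eta>_def balanced_def)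
  then have \<mu>: "\<mu> \<le> 0" by (simp add: \<mu>_def)
  obtain c where c: "c > 0"
    and dev: "\<And>t Y y s. y \<le> Y \<Longrightarrow> y \<le> 3 * t \<Longrightarrow> s \<in> {1, -1} \<Longrightarrow>
       measure_pmf.prob (joint p v q Y t) {(d, ns). s * of_int (run ns (psum d) y) \<ge>
         s * (real t * \<eta> + real y * \<mu>) + 2 * (\<epsilon> / 4) * real t}
       \<le> 2 * exp (- c * real t)"
    using stationary_run_deviation[OF bal, of "\<epsilon> / 4"] \<epsilon> unfolding \<eta>_def \<mu>_def by (metis zero_less_divide_iff zero_less_numeral)
  obtain k where k: "\<And>x y. (x, y) \<in> A \<Longrightarrow> \<bar>x\<bar> \<le> k \<and> \<bar>y\<bar> \<le> k" "0 \<le> k"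
  proof -
    let ?K = "(\<Sum>z\<in>A. \<bar>fst z\<bar> + \<bar>snd z\<bar>)"
    have "\<bar>x\<bar> \<le> ?K \<and> \<bar>y\<bar> \<le> ?K" if "(x, y) \<in> A" for x y
      using member_le_sum[of "(x, y)" A "\<lambda>z. \<bar>fst z\<bar> + \<bar>snd z\<bar>"] A that by auto
    moreover have "0 \<le> ?K" by (intro sum_nonneg) auto
    ultimately show ?thesis using that by blast
  qed
  have "((\<lambda>t. of_int k * (1 - \<mu>) / real t) \<longlongrightarrow> 0) sequentially"
    by (rule lim_const_over_n)
  then have "\<forall>\<^sub>F t in sequentially. of_int k * (1 - \<mu>) / real t < \<epsilon> / 2"
    by (rule order_tendstoD) (use \<epsilon> in simp)
  then have "\<forall>\<^sub>F t in sequentially. measure_pmf.prob (slaw p t A)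
    {B. \<exists>x y. (x, y) \<in> B \<and> 0 \<le> y \<and> real t * \<eta> + of_int y * (v - \<eta>) + \<epsilon> * real t \<le> - of_int x}
    \<le> (2 * real t + 2) * exp (- c * real t)"
    using eventually_gt_at_top[of 0]
  proof eventually_elim
    case (elim t)
    have kt: "of_int k * (1 - \<mu>) \<le> \<epsilon> / 2 * real t" using elim by (simp add: field_simps)
    let ?D = "\<lambda>d i. psum d i + k"
    let ?R = "replicate_pmf t (rnoise p t)"
    let ?Bad = "{B. \<exists>x y. (x, y) \<in> B \<and> 0 \<le> y \<and> real t * \<eta> + of_int y * (v - \<eta>) + \<epsilon> * real t \<le> - of_int x}"
    let ?bound = "\<lambda>i. real t * \<eta> + real i * \<mu> + 2 * (\<epsilon> / 4) * real t"
    have height: "nat (y - k) \<le> t" if "B \<in> set_pmf (slaw p t A)" "(x, y) \<in> B" for B x y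
      using slaw_bounded[OF k(1) that] k(2) by auto
    have fixed: "measure_pmf.prob (slaw p t A) ?Bad
        \<le> measure_pmf.prob ?R {ns. \<exists>i\<le>t. ?bound i \<le> of_int (run ns (psum d) i)}"
      if d: "d \<in> set_pmf (incs v q t)" for d
    proof -
      \<comment> \<open>\<open>dval\<close> is never positive, which supplies the monotone profile
        that the coupling demands.\<close>
      have "d i \<le> 0" for i
      proof (cases "i \<in> {1..t}")
        case True
        have "d i \<in> set_pmf (map_pmf dval (uv v q))"
          using d True by (auto simp: incs_def set_Pi_pmf PiE_dflt_def)
        then show ?thesis by (auto simp: dval_def)
      next
        case False
        then show ?thesis using d by (auto simp: incs_def set_Pi_pmf PiE_dflt_def)
      qed
      then have anti: "?D d (Suc i) \<le> ?D d i" for i by simp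
      have "rel_pmf (\<lambda>B D. B \<subseteq> region k D) (slaw p t A) (map_pmf (\<lambda>ns. run ns (?D d)) ?R)"
      proof (rule upper_coupling[OF A])
        show "A \<subseteq> region k (?D d)"
        proof (clarify)
          fix x y assume "(x, y) \<in> A"
          then have "\<bar>x\<bar> \<le> k" "nat (y - k) = 0" using k(1)[of x y] by auto
          then show "(x, y) \<in> region k (?D d)" by (simp add: region_def)
        qed
        show "y + int t \<le> k + int t" if "(x, y) \<in> A" for x y using k(1)[OF that] by arith
      qed (rule anti)
      then have rel: "rel_pmf (\<lambda>B D. B \<subseteq> region k D \<and> B \<in> set_pmf (slaw p t A)) (slaw p t A) (map_pmf (\<lambda>ns. run ns (?D d)) ?R)"
        by (rule pmf.rel_mono_strong) auto
      have "measure_pmf.prob (slaw p t A) ?Bad \<le> measure_pmf.prob (map_pmf (\<lambda>ns. run ns (?D d)) ?R)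
          {D. \<exists>B\<in>?Bad. B \<subseteq> region k D \<and> B \<in> set_pmf (slaw p t A)}"
        by (rule rel_pmf_measureD[OF rel])
      also have "\<dots> \<le> measure_pmf.prob (map_pmf (\<lambda>ns. run ns (?D d)) ?R)
          {D. \<exists>i\<le>t. ?bound i + of_int k \<le> of_int (D i)}"
      proof (rule prob_mono_pmf, elim CollectE bexE conjE exE, intro CollectI)
        fix D B x y
        assume B: "B \<subseteq> region k D" "B \<in> set_pmf (slaw p t A)" "(x, y) \<in> B" and y: "0 \<le> y"
          and far: "real t * \<eta> + of_int y * (v - \<eta>) + \<epsilon> * real t \<le> - of_int x"
        let ?i = "nat (y - k)"
        have "- x \<le> D ?i" using B by (auto simp: region_def)
        moreover have "real ?i * \<mu> + of_int k * \<mu> \<le> of_int y * \<mu>"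
        proof -
          have "of_int y \<le> real ?i + of_int k" by simp
          from mult_right_mono_neg[OF this \<mu>] show ?thesis by (simp add: algebra_simps)
        qed
        ultimately have "?bound ?i + of_int k \<le> of_int (D ?i)"
          using far kt unfolding \<mu>_def[symmetric] by (simp add: algebra_simps)
        then show "\<exists>i\<le>t. ?bound i + of_int k \<le> of_int (D i)" using height[OF B(2,3)] by blast
      qed
      also have "\<dots> = measure_pmf.prob ?R {ns. \<exists>i\<le>t. ?bound i \<le> of_int (run ns (psum d) i)}"
        by (simp add: vimage_def run_shift)
      finally show ?thesis .
    qed
    have "measure_pmf.prob (slaw p t A) ?Bad = measure_pmf.prob (bind_pmf (incs v q t) (\<lambda>_. slaw p t A)) ?Bad"
      by simp
    also have "\<dots> \<le> measure_pmf.prob (bind_pmf (incs v q t) (\<lambda>d. map_pmf (Pair d) ?R))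
       {(d, ns). \<exists>i\<le>t. ?bound i \<le> of_int (run ns (psum d) i)}"
    proof -
      have "(\<integral>\<^sup>+d. emeasure (slaw p t A) ?Bad \<partial>incs v q t)
          \<le> (\<integral>\<^sup>+d. emeasure (map_pmf (Pair d) ?R) {(d, ns). \<exists>i\<le>t. ?bound i \<le> of_int (run ns (psum d) i)} \<partial>incs v q t)"
        by (rule nn_integral_mono_AE)
           (use fixed in \<open>auto simp: AE_measure_pmf_iff measure_pmf.emeasure_eq_measure vimage_def\<close>)
      then have "emeasure (bind_pmf (incs v q t) (\<lambda>_. slaw p t A)) ?Bad
          \<le> emeasure (bind_pmf (incs v q t) (\<lambda>d. map_pmf (Pair d) ?R)) {(d, ns). \<exists>i\<le>t. ?bound i \<le> of_int (run ns (psum d) i)}"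
        unfolding emeasure_bind_pmf .
      then show ?thesis by (simp only: measure_pmf.emeasure_eq_measure ennreal_le_iff measure_nonneg)
    qed
    also have "bind_pmf (incs v q t) (\<lambda>d. map_pmf (Pair d) ?R) = map_pmf (\<lambda>(d, ns). (d, map unsourced ns)) (joint p v q t t)"
    proof -
      have "?R = map_pmf (map unsourced) (replicate_pmf t (source p q t))"
        by (simp add: map_replicate_pmf map_unsourced_source)
      then show ?thesis
        by (simp add: joint_def pair_pmf_def map_pmf_def bind_assoc_pmf bind_return_pmf)
    qed
    also have "measure_pmf.prob (map_pmf (\<lambda>(d, ns). (d, map unsourced ns)) (joint p v q t t))
       {(d, ns). \<exists>i\<le>t. ?bound i \<le> of_int (run ns (psum d) i)}
      \<le> measure_pmf.prob (joint p v q t t) (\<Union>i\<le>t. {(d, ns). 1 * of_int (run ns (psum d) i) \<ge>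
         1 * (real t * \<eta> + real i * \<mu>) + 2 * (\<epsilon> / 4) * real t})"
      unfolding measure_map_pmf
    proof (rule prob_mono_pmf)
      fix z
      assume z: "z \<in> set_pmf (joint p v q t t)" and bad: "z \<in> (\<lambda>(d, ns). (d, map unsourced ns)) -`
        {(d, ns). \<exists>i\<le>t. ?bound i \<le> of_int (run ns (psum d) i)}"
      obtain d ns where dn: "z = (d, ns)" by fastforce
      note j = z[unfolded dn]
      obtain i where i: "i \<le> t" "?bound i \<le> of_int (run (map unsourced ns) (psum d) i)" using bad dn by auto
      have "run (map unsourced ns) (psum d) i \<le> run ns (psum d) i"
        by (rule run_unsourced_le) (rule set_joint(2)[OF j])
      with i show "z \<in> (\<Union>i\<le>t. {(d, ns). 1 * of_int (run ns (psum d) i) \<ge>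
         1 * (real t * \<eta> + real i * \<mu>) + 2 * (\<epsilon> / 4) * real t})"
        unfolding dn by (intro UN_I[of i]) auto
    qed
    also have "\<dots> \<le> (\<Sum>i\<le>t. 2 * exp (- c * real t))"
      by (rule order_trans[OF prob_UN_le], simp) (intro sum_mono dev; simp)
    also have "\<dots> = (2 * real t + 2) * exp (- c * real t)" by (simp add: algebra_simps)
    finally show ?case .
  qed
  moreover have "expsmall (\<lambda>n. exp (- c * real n))"
    unfolding expsmall_def using c(1) by (intro exI[of _ c]) auto
  then have "expsmall (\<lambda>t. (2 * real t + 2) * exp (- c * real t))"
    by (rule expsmall_linear_mult) auto
  ultimately show ?thesis by (rule expsmall_mono[rotated])
qed

section \<open>Transfer to arbitrary realizations\<close>

text \<open>Finitely many coins decide each step, so that the law at a fixed time can be handled by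
  finite sums.\<close>

lemma finite_set_slaw: "finite A \<Longrightarrow> finite (set_pmf (slaw p t A))"
proof (induction t arbitrary: A)
  case (Suc t)
  have "finite (set_pmf (bern p (nb A)))"
    unfolding bern_def set_Pi_pmf[OF finite_nb[OF Suc.prems]]
    by (intro finite_PiE_dflt finite_nb[OF Suc.prems]) auto
  then have "finite (set_pmf (kern p A))" by (simp add: kern_def)
  moreover have "finite (set_pmf (slaw p t B))" if "B \<in> set_pmf (kern p A)" for B
    using that finite_sstep[OF Suc.prems] by (intro Suc.IH) (auto simp: kern_def)
  ultimately show ?case by simp
qed simp

definition rate :: "real \<Rightarrow> site set \<Rightarrow> site \<Rightarrow> real" where
  "rate p A x = hex_rule p (local_config hex_nbhd A x)"

text \<open>The event factorizes over the sites of \<open>nb A\<close>: each site prescribes its own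
  coin, or leaves it free, or is impossible.\<close>

lemma pmf_kern:
  assumes p: "0 \<le> p" "p \<le> 1" and "finite A" "S \<subseteq> nb A"
  shows "pmf (kern p A) S = (\<Prod>x\<in>S. rate p A x) * (\<Prod>x\<in>nb A - S. 1 - rate p A x)"
proof -
  define B where "B x = {b. (sure A x \<or> b) = (x \<in> S)}" for x
  have fin: "finite (nb A)" by (rule finite_nb) fact
  have "sstep A b = S \<longleftrightarrow> (\<forall>z\<in>nb A. (sure A z \<or> b z) = (z \<in> S))" for b
  proof -
    have "z \<in> sstep A b \<longleftrightarrow> z \<in> S" if "z \<notin> nb A" for z
      using that assms(4) sstep_bounds(2) by blast
    then have "sstep A b = S \<longleftrightarrow> (\<forall>z\<in>nb A. (z \<in> sstep A b) = (z \<in> S))" by blast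
    moreover have "z \<in> sstep A b \<longleftrightarrow> sure A z \<or> b z" if "z \<in> nb A" for z
      using that by (simp only: sstep_def nb_def mem_Collect_eq simp_thms)
    ultimately show ?thesis by simp
  qed
  then have eq: "sstep A -` {S} = Pi (nb A) B"
    by (simp only: B_def vimage_def Pi_def mem_Collect_eq singleton_iff) blast
  have B: "measure_pmf.prob (bernoulli_pmf p) (B x) = (if x \<in> S then rate p A x else 1 - rate p A x)"
    if "x \<in> nb A" for x
  proof -
    have r: "rate p A x = (if sure A x then 1 else p)"
      using that by (simp add: rate_def hex_rule_local_config nb_def)
    have "B x = (if sure A x then (if x \<in> S then UNIV else {}) else {x \<in> S})"
      by (auto simp: B_def)
    then show ?thesis using p by (simp add: r measure_pmf_single)
  qed
  have "pmf (kern p A) S = measure_pmf.prob (bern p (nb A)) (Pi (nb A) B)"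
    by (simp add: kern_def pmf_map eq)
  also have "\<dots> = (\<Prod>x\<in>nb A. measure_pmf.prob (bernoulli_pmf p) (B x))"
    unfolding bern_def using fin by (rule measure_Pi_pmf_Pi)
  also have "\<dots> = (\<Prod>x\<in>nb A. if x \<in> S then rate p A x else 1 - rate p A x)"
    using B by (intro prod.cong) auto
  also have "\<dots> = (\<Prod>x\<in>S. rate p A x) * (\<Prod>x\<in>nb A - S. 1 - rate p A x)"
    using fin assms(4) by (simp add: prod.If_cases Int_absorb1 Diff_eq)
  finally show ?thesis .
qed

section \<open>The law of an arbitrary realization at a fixed time\<close>

context
  fixes p :: real and A0 :: "site set" and M :: "'w measure" and A :: "nat \<Rightarrow> 'w \<Rightarrow> site set"
  assumes p: "0 \<le> p" "p \<le> 1" and fin: "finite A0"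
    and growth: "growth_process hex_nbhd (hex_rule p) A0 M A"
begin

interpretation prob_space M
  using growth by (simp add: growth_process_def)

lemma growth_sets: "{\<omega> \<in> space M. x \<in> A t \<omega>} \<in> sets M"
  using growth unfolding growth_process_def by blast

text \<open>Equality of sets of sites is a countable conjunction, so this is an admissible event
  \<open>E\<close> of the past in \<open>growth_process\<close>.\<close>

lemma growth_state_history: "{\<omega> \<in> space M. A t \<omega> = S} \<in> history M A t"
proof -
  interpret H: sigma_algebra "space M" "history M A t"
    unfolding history_def by (rule sigma_algebra_sigma_sets) auto
  have basic: "{\<omega> \<in> space M. x \<in> A t \<omega>} \<in> history M A t" for x
    unfolding history_def by (rule sigma_sets.Basic) blast
  have "{\<omega> \<in> space M. (x \<in> A t \<omega>) = (x \<in> S)} \<in> history M A t" for x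
    using basic[of x] H.sets_Collect_neg[OF basic[of x]] by (cases "x \<in> S") auto
  then have "{\<omega> \<in> space M. \<forall>x. (x \<in> A t \<omega>) = (x \<in> S)} \<in> history M A t"
    by (rule H.sets_Collect_countable_All)
  then show ?thesis by (simp add: set_eq_iff)
qed

lemma growth_state_sets [measurable]: "{\<omega> \<in> space M. A t \<omega> = S} \<in> sets M"
proof -
  have "history M A t \<subseteq> sets M"
    unfolding history_def using growth_sets by (intro sets.sigma_sets_subset) auto
  then show ?thesis using growth_state_history by blast
qed

lemma growth_superset_sets: "{\<omega> \<in> space M. \<forall>x\<in>X. x \<in> A t \<omega>} \<in> sets M"
proof -
  have "{\<omega> \<in> space M. x \<in> X \<longrightarrow> x \<in> A t \<omega>} \<in> sets M" for x
    using growth_sets[of x t] by (cases "x \<in> X") auto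
  then have "{\<omega> \<in> space M. \<forall>x. x \<in> X \<longrightarrow> x \<in> A t \<omega>} \<in> sets M"
    by (rule sets.sets_Collect_countable_All)
  then show ?thesis by (simp add: Ball_def)
qed

lemma growth_disjoint_sets: "{\<omega> \<in> space M. \<forall>x\<in>X. x \<notin> A t \<omega>} \<in> sets M"
proof -
  have "{\<omega> \<in> space M. x \<in> X \<longrightarrow> x \<notin> A t \<omega>} \<in> sets M" for x
    using sets.sets_Collect_neg[OF growth_sets[of x t]] by (cases "x \<in> X") auto
  then have "{\<omega> \<in> space M. \<forall>x. x \<in> X \<longrightarrow> x \<notin> A t \<omega>} \<in> sets M"
    by (rule sets.sets_Collect_countable_All)
  then show ?thesis by (simp add: Ball_def)
qed

lemma growth_step_superset:
  assumes "finite X"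
  shows "prob ({\<omega> \<in> space M. A t \<omega> = S'} \<inter> {\<omega> \<in> space M. X \<subseteq> A (Suc t) \<omega>})
    = prob {\<omega> \<in> space M. A t \<omega> = S'} * (\<Prod>x\<in>X. rate p S' x)"
proof -
  let ?E = "{\<omega> \<in> space M. A t \<omega> = S'}"
  have "prob (?E \<inter> {\<omega> \<in> space M. X \<subseteq> A (Suc t) \<omega>})
      = (LINT \<omega>:?E|M. (\<Prod>x\<in>X. rate p (A t \<omega>) x))"
    using growth assms growth_state_history[of t S'] unfolding growth_process_def rate_def by blast
  also have "\<dots> = (\<integral>\<omega>. indicator ?E \<omega> * (\<Prod>x\<in>X. rate p S' x) \<partial>M)"
    unfolding set_lebesgue_integral_def
    by (intro Bochner_Integration.integral_cong) (auto simp: indicator_def)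
  also have "\<dots> = prob ?E * (\<Prod>x\<in>X. rate p S' x)" by simp
  finally show ?thesis .
qed

text \<open>The dynamics is specified through inclusions only. Excluded sites are added one by one,
  each time subtracting the event that the new site is occupied.\<close>

lemma growth_step_exact:
  assumes "finite Z" "finite X" "X \<inter> Z = {}"
  shows "prob {\<omega> \<in> space M. A t \<omega> = S' \<and> (\<forall>x\<in>X. x \<in> A (Suc t) \<omega>) \<and> (\<forall>z\<in>Z. z \<notin> A (Suc t) \<omega>)}
    = prob {\<omega> \<in> space M. A t \<omega> = S'} * (\<Prod>x\<in>X. rate p S' x) * (\<Prod>z\<in>Z. 1 - rate p S' z)"
  using assms
proof (induction Z arbitrary: X rule: finite_induct)
  case empty
  have "{\<omega> \<in> space M. A t \<omega> = S' \<and> (\<forall>x\<in>X. x \<in> A (Suc t) \<omega>) \<and> (\<forall>z\<in>{}. z \<notin> A (Suc t) \<omega>)}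
    = {\<omega> \<in> space M. A t \<omega> = S'} \<inter> {\<omega> \<in> space M. X \<subseteq> A (Suc t) \<omega>}" by auto
  then show ?case using growth_step_superset[OF empty(1)] by simp
next
  case (insert z Z)
  let ?F = "\<lambda>X Z. {\<omega> \<in> space M. A t \<omega> = S' \<and> (\<forall>x\<in>X. x \<in> A (Suc t) \<omega>) \<and> (\<forall>z\<in>Z. z \<notin> A (Suc t) \<omega>)}"
  have sets: "?F X Z \<in> sets M" for X Z
    by (intro sets.sets_Collect_conj growth_state_sets growth_superset_sets growth_disjoint_sets)
  have split: "?F X (insert z Z) = ?F X Z - ?F (insert z X) Z" by auto
  have "prob (?F X (insert z Z)) = prob (?F X Z) - prob (?F (insert z X) Z)"
    unfolding split by (rule finite_measure_Diff[OF sets sets]) blast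
  also have "\<dots> = prob {\<omega> \<in> space M. A t \<omega> = S'} * (\<Prod>x\<in>X. rate p S' x) * (\<Prod>z\<in>Z. 1 - rate p S' z)
      - prob {\<omega> \<in> space M. A t \<omega> = S'} * (\<Prod>x\<in>insert z X. rate p S' x) * (\<Prod>z\<in>Z. 1 - rate p S' z)"
    using insert.prems insert.hyps by (intro arg_cong2[of _ _ _ _ "(-)"] insert.IH) auto
  also have "\<dots> = prob {\<omega> \<in> space M. A t \<omega> = S'} * (\<Prod>x\<in>X. rate p S' x) * (\<Prod>z\<in>insert z Z. 1 - rate p S' z)"
    using insert by (simp add: algebra_simps)
  finally show ?case .
qed

text \<open>Sites outside \<open>nb S'\<close> have rate 0 and almost surely stay empty, so the next
  state is decided by finitely many sites.\<close>

lemma growth_step: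
  assumes "finite S'"
  shows "prob {\<omega> \<in> space M. A t \<omega> = S' \<and> A (Suc t) \<omega> = S}
    = prob {\<omega> \<in> space M. A t \<omega> = S'} * pmf (kern p S') S"
proof -
  have out: "prob {\<omega> \<in> space M. A t \<omega> = S' \<and> x \<in> A (Suc t) \<omega>} = 0" if "x \<notin> nb S'" for x
  proof -
    have "rate p S' x = 0" using that by (simp add: rate_def hex_rule_local_config nb_def)
    then show ?thesis using growth_step_exact[of "{}" "{x}" t S'] by simp
  qed
  have sets1: "{\<omega> \<in> space M. A t \<omega> = S' \<and> x \<in> A (Suc t) \<omega>} \<in> sets M" for x
    by (intro sets.sets_Collect_conj growth_state_sets growth_sets)
  show ?thesis
  proof (cases "S \<subseteq> nb S'")
    case True
    have finS: "finite S" "finite (nb S' - S)"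
      using True finite_nb[OF assms] finite_subset by auto
    have "prob {\<omega> \<in> space M. A t \<omega> = S' \<and> A (Suc t) \<omega> = S}
      = prob {\<omega> \<in> space M. A t \<omega> = S' \<and> (\<forall>x\<in>S. x \<in> A (Suc t) \<omega>) \<and> (\<forall>z\<in>nb S' - S. z \<notin> A (Suc t) \<omega>)}"
    proof (rule measure_eq_AE)
      have "AE \<omega> in M. \<not> (A t \<omega> = S' \<and> x \<in> A (Suc t) \<omega>)" if "x \<notin> nb S'" for x
        using out[OF that] sets1[of x]
        by (intro AE_I[where N = "{\<omega> \<in> space M. A t \<omega> = S' \<and> x \<in> A (Suc t) \<omega>}"])
           (auto simp: emeasure_eq_measure)
      then have "AE \<omega> in M. \<forall>x. x \<notin> nb S' \<longrightarrow> \<not> (A t \<omega> = S' \<and> x \<in> A (Suc t) \<omega>)"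
        unfolding AE_all_countable by auto
      then show "AE \<omega> in M. \<omega> \<in> {\<omega> \<in> space M. A t \<omega> = S' \<and> A (Suc t) \<omega> = S} \<longleftrightarrow>
        \<omega> \<in> {\<omega> \<in> space M. A t \<omega> = S' \<and> (\<forall>x\<in>S. x \<in> A (Suc t) \<omega>) \<and> (\<forall>z\<in>nb S' - S. z \<notin> A (Suc t) \<omega>)}"
        by (rule AE_mp) (intro AE_I2 impI, use True in blast)
      show "{\<omega> \<in> space M. A t \<omega> = S' \<and> A (Suc t) \<omega> = S} \<in> sets M"
        by (intro sets.sets_Collect_conj growth_state_sets)
      show "{\<omega> \<in> space M. A t \<omega> = S' \<and> (\<forall>x\<in>S. x \<in> A (Suc t) \<omega>) \<and> (\<forall>z\<in>nb S' - S. z \<notin> A (Suc t) \<omega>)} \<in> sets M"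
        by (intro sets.sets_Collect_conj growth_state_sets growth_superset_sets growth_disjoint_sets)
    qed
    also have "\<dots> = prob {\<omega> \<in> space M. A t \<omega> = S'} * pmf (kern p S') S"
      using finS by (subst growth_step_exact) (auto simp: pmf_kern[OF p assms True])
    finally show ?thesis .
  next
    case False
    then obtain x where x: "x \<in> S" "x \<notin> nb S'" by blast
    have "prob {\<omega> \<in> space M. A t \<omega> = S' \<and> A (Suc t) \<omega> = S} \<le> prob {\<omega> \<in> space M. A t \<omega> = S' \<and> x \<in> A (Suc t) \<omega>}"
      using x sets1 by (intro finite_measure_mono) auto
    then have "prob {\<omega> \<in> space M. A t \<omega> = S' \<and> A (Suc t) \<omega> = S} = 0"
      using out[OF x(2)] by (simp add: measure_le_0_iff)
    moreover have "S \<notin> set_pmf (kern p S')"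
      using sstep_bounds(2) False by (auto simp: kern_def)
    ultimately show ?thesis by (simp add: set_pmf_iff)
  qed
qed

text \<open>The atoms in the finite support already carry total mass 1, so almost surely the process
  is in one of them.\<close>

lemma growth_marginal_pred_aux:
  assumes law: "\<And>S. prob {\<omega> \<in> space M. A t \<omega> = S} = pmf (slaw p t A0) S"
    and Q: "{\<omega> \<in> space M. Q \<omega>} \<in> sets M"
  shows "prob {\<omega> \<in> space M. Q \<omega>} = (\<Sum>S\<in>set_pmf (slaw p t A0). prob {\<omega> \<in> space M. A t \<omega> = S \<and> Q \<omega>})"
proof -
  let ?supp = "set_pmf (slaw p t A0)"
  have f: "finite ?supp" using fin by (rule finite_set_slaw)
  have sets: "{\<omega> \<in> space M. A t \<omega> = S \<and> Q \<omega>} \<in> sets M" for S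
    by (intro sets.sets_Collect_conj growth_state_sets Q)
  have un_sets: "(\<Union>S\<in>?supp. {\<omega> \<in> space M. A t \<omega> = S}) \<in> sets M"
    using f by (intro sets.finite_UN) auto
  have "prob (\<Union>S\<in>?supp. {\<omega> \<in> space M. A t \<omega> = S}) = (\<Sum>S\<in>?supp. prob {\<omega> \<in> space M. A t \<omega> = S})"
    using f by (intro finite_measure_finite_Union) (auto simp: disjoint_family_on_def)
  also have "\<dots> = 1" unfolding law using f by (rule sum_pmf_eq_1) simp
  finally have "AE \<omega> in M. A t \<omega> \<in> ?supp"
    using prob_eq_1[OF un_sets] by (auto elim: AE_mp)
  then have "prob {\<omega> \<in> space M. Q \<omega>} = prob (\<Union>S\<in>?supp. {\<omega> \<in> space M. A t \<omega> = S \<and> Q \<omega>})"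
    using Q sets f by (intro measure_eq_AE) auto
  also have "\<dots> = (\<Sum>S\<in>?supp. prob {\<omega> \<in> space M. A t \<omega> = S \<and> Q \<omega>})"
    using f sets by (intro finite_measure_finite_Union) (auto simp: disjoint_family_on_def)
  finally show ?thesis .
qed

lemma growth_law: "prob {\<omega> \<in> space M. A t \<omega> = S} = pmf (slaw p t A0) S"
proof (induction t arbitrary: S)
  case 0
  have "\<And>\<omega>. \<omega> \<in> space M \<Longrightarrow> A 0 \<omega> = A0" using growth by (simp add: growth_process_def)
  then have "{\<omega> \<in> space M. A 0 \<omega> = S} = (if S = A0 then space M else {})" by auto
  then show ?case by (simp add: prob_space)
next
  case (Suc t)
  have "prob {\<omega> \<in> space M. A (Suc t) \<omega> = S}
      = (\<Sum>S'\<in>set_pmf (slaw p t A0). prob {\<omega> \<in> space M. A t \<omega> = S' \<and> A (Suc t) \<omega> = S})"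
    by (rule growth_marginal_pred_aux[OF Suc growth_state_sets])
  also have "\<dots> = (\<Sum>S'\<in>set_pmf (slaw p t A0). pmf (kern p S') S * pmf (slaw p t A0) S')"
    using finite_slaw[OF _ fin] by (intro sum.cong) (simp_all add: growth_step Suc)
  also have "\<dots> = pmf (slaw p (Suc t) A0) S"
    unfolding slaw_Suc' pmf_bind
    using finite_set_slaw[OF fin] by (subst integral_measure_pmf_real) auto
  finally show ?case .
qed

lemma growth_marginal:
  assumes "{\<omega> \<in> space M. Q (A t \<omega>)} \<in> sets M"
  shows "prob {\<omega> \<in> space M. Q (A t \<omega>)} = measure_pmf.prob (slaw p t A0) {S. Q S}"
proof -
  let ?supp = "set_pmf (slaw p t A0)"
  have f: "finite ?supp" using fin by (rule finite_set_slaw)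
  have "prob {\<omega> \<in> space M. Q (A t \<omega>)} = (\<Sum>S\<in>?supp. prob {\<omega> \<in> space M. A t \<omega> = S \<and> Q (A t \<omega>)})"
    by (rule growth_marginal_pred_aux[OF growth_law assms])
  also have "\<dots> = (\<Sum>S\<in>?supp. if Q S then pmf (slaw p t A0) S else 0)"
  proof (intro sum.cong refl)
    fix S
    have "{\<omega> \<in> space M. A t \<omega> = S \<and> Q (A t \<omega>)} = (if Q S then {\<omega> \<in> space M. A t \<omega> = S} else {})" by auto
    then show "prob {\<omega> \<in> space M. A t \<omega> = S \<and> Q (A t \<omega>)} = (if Q S then pmf (slaw p t A0) S else 0)"
      by (simp add: growth_law)
  qed
  also have "\<dots> = sum (pmf (slaw p t A0)) (?supp \<inter> {S. Q S})"
    using f by (simp add: sum.inter_restrict)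
  also have "\<dots> = measure_pmf.prob (slaw p t A0) (?supp \<inter> {S. Q S})"
    using f by (simp add: measure_measure_pmf_finite)
  also have "\<dots> = measure_pmf.prob (slaw p t A0) {S. Q S}"
    by (simp add: measure_Int_set_pmf Int_commute)
  finally show ?thesis .
qed

text \<open>Borel-Cantelli, fed with the laws at single times.\<close>

lemma growth_eventually:
  assumes "\<And>t. {\<omega> \<in> space M. Q t (A t \<omega>)} \<in> sets M"
    and "expsmall (\<lambda>t. measure_pmf.prob (slaw p t A0) {S. Q t S})"
  shows "AE \<omega> in M. \<forall>\<^sub>F t in sequentially. \<not> Q t (A t \<omega>)"
proof -
  have "summable (\<lambda>t. measure_pmf.prob (slaw p t A0) {S. Q t S})"
    using assms(2) by (rule expsmall_summable) simp
  then have "AE \<omega> in M. \<forall>\<^sub>F t in sequentially. \<omega> \<in> space M - {\<omega> \<in> space M. Q t (A t \<omega>)}"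
    using assms(1) by (intro borel_cantelli_AE1) (auto simp: growth_marginal emeasure_eq_measure)
  then show ?thesis by eventually_elim (auto elim: eventually_mono)
qed

lemma growth_eventually_avoids:
  assumes "expsmall (\<lambda>t. measure_pmf.prob (slaw p t A0) {S. \<exists>z\<in>Z t. z \<in> S})"
  shows "AE \<omega> in M. \<forall>\<^sub>F t in sequentially. \<forall>z\<in>Z t. z \<notin> A t \<omega>"
proof -
  have "{\<omega> \<in> space M. \<exists>z\<in>Z t. z \<in> A t \<omega>} \<in> sets M" for t
    using sets.sets_Collect_neg[OF growth_disjoint_sets[of "Z t" t]] by simp
  from growth_eventually[OF this assms] show ?thesis by simp
qed

lemma growth_eventually_meets:
  assumes "expsmall (\<lambda>t. measure_pmf.prob (slaw p t A0) {S. \<forall>z\<in>Z t. z \<notin> S})"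
  shows "AE \<omega> in M. \<forall>\<^sub>F t in sequentially. \<exists>z\<in>Z t. z \<in> A t \<omega>"
  using growth_eventually[OF growth_disjoint_sets assms] by simp

end

section \<open>Geometry of the shape\<close>

lemma sum_square_sqrt:
  fixes u v :: real
  assumes "0 \<le> u" "0 \<le> v"
  shows "2 * sqrt (u * v) \<le> u + v"
  using arith_geo_mean_sqrt[OF assms] by simp

lemma \<phi>_le_1:
  assumes "0 \<le> p" "p \<le> 1" "0 \<le> y" "y \<le> 1"
  shows "\<phi> p y \<le> 1"
proof -
  have "2 * sqrt ((p * (1 - y)) * ((1 - p) * y)) \<le> p * (1 - y) + (1 - p) * y"
    using assms by (intro sum_square_sqrt) auto
  then show ?thesis by (simp add: \<phi>_def algebra_simps)
qed

text \<open>The two descriptions of the edge meet at height p.\<close>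

lemma \<phi>_p:
  assumes "0 \<le> p" "p \<le> 1"
  shows "\<phi> p p = 1"
proof -
  have "p * (1 - p) * p * (1 - p) = (p * (1 - p))\<^sup>2" by (simp add: power2_eq_square)
  then have "sqrt (p * (1 - p) * p * (1 - p)) = p * (1 - p)" using assms by simp
  then show ?thesis by (simp add: \<phi>_def algebra_simps)
qed

lemma continuous_on_\<phi>: "continuous_on UNIV (\<phi> p)"
  unfolding \<phi>_def by (intro continuous_intros)

section \<open>The cutoff height for p < 1/2\<close>

context
  fixes p s :: real
  assumes p: "0 \<le> p" "p < 1 / 2"
  defines "s \<equiv> sqrt (8 * p)"
begin

lemma s_bounds: "0 \<le> s" "s < 2" "s\<^sup>2 = 8 * p" "4 * p \<le> s" "s < 1 + 2 * p"
proof -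
  show s0: "0 \<le> s" and s2: "s\<^sup>2 = 8 * p" using p by (simp_all add: s_def)
  show "s < 2" by (rule power_less_imp_less_base[of _ 2]) (use s2 p in auto)
  have "p * (16 * p) \<le> p * 8" using p by (intro mult_left_mono) auto
  then have "(4 * p)\<^sup>2 \<le> s\<^sup>2" unfolding s2 by (simp add: power2_eq_square)
  then show "4 * p \<le> s" using s0 by (rule power2_le_imp_le)
  have "0 < (1 - 2 * p)\<^sup>2" using p by (simp add: power2_eq_square)
  then have "s\<^sup>2 < (1 + 2 * p)\<^sup>2" unfolding s2 by (simp add: power2_eq_square algebra_simps)
  from power_less_imp_less_base[OF this] show "s < 1 + 2 * p" using p by simp
qed

lemma y0_eq: "y0 p = 2 * (1 - p) / (3 - s)"
  using p by (simp add: y0_def s_def)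

lemma y0_bounds_small: "p < y0 p" "y0 p < 1"
proof -
  have d: "0 < 3 - s" using s_bounds by simp
  have "0 < 2 - 5 * p + 4 * p * p"
  proof -
    have "0 \<le> (2 * p - 5 / 4)\<^sup>2" by simp
    then show ?thesis by (simp add: power2_eq_square algebra_simps)
  qed
  moreover have "p * (3 - s) \<le> p * (3 - 4 * p)" using s_bounds p by (intro mult_left_mono) auto
  ultimately have "p * (3 - s) < 2 * (1 - p)" by (simp add: algebra_simps)
  then show "p < y0 p" using d by (simp add: y0_eq pos_less_divide_eq)
  show "y0 p < 1" using d s_bounds by (simp add: y0_eq pos_divide_less_eq)
qed

text \<open>The left side comes from isolating the root in \<open>y = 2 * \<phi> p y\<close> and
  squaring. Its zeros are \<open>2 * (1 - p) / (3 - s)\<close>, which is \<open>y0 p\<close>, and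
  \<open>2 * (1 - p) / (3 + s)\<close>.\<close>

lemma quadratic_factor:
  "((3 / 2 - 2 * p) * y - (1 - p))\<^sup>2 - 4 * (p * (1 - p) * y * (1 - y))
   = ((3 - s) * y - 2 * (1 - p)) * ((3 + s) * y - 2 * (1 - p)) / 4"
proof -
  have "((3 - s) * y - 2 * (1 - p)) * ((3 + s) * y - 2 * (1 - p)) / 4
      = ((9 - s\<^sup>2) * y\<^sup>2 - 12 * (1 - p) * y + 4 * (1 - p)\<^sup>2) / 4"
    by (simp add: power2_eq_square algebra_simps)
  also have "\<dots> = ((3 / 2 - 2 * p) * y - (1 - p))\<^sup>2 - 4 * (p * (1 - p) * y * (1 - y))"
    unfolding s_bounds(3) by (simp add: power2_eq_square field_simps)
  finally show ?thesis ..
qed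

lemma y_le_y0_iff: "y \<le> y0 p \<longleftrightarrow> (3 - s) * y \<le> 2 * (1 - p)" "y < y0 p \<longleftrightarrow> (3 - s) * y < 2 * (1 - p)"
  using s_bounds by (simp_all add: y0_eq pos_le_divide_eq pos_less_divide_eq mult.commute)

text \<open>Above \<open>y0 p\<close> both factors are positive, and by \<open>4 * p \<le> s\<close>
  so is the isolated side before squaring. The comparison of squares therefore passes to the
  roots.\<close>

lemma le_y0I_small:
  assumes "0 \<le> y" "y \<le> 1" "y \<le> 2 * \<phi> p y"
  shows "y \<le> y0 p"
proof (rule ccontr)
  assume "\<not> y \<le> y0 p"
  then have 1: "2 * (1 - p) < (3 - s) * y" using y_le_y0_iff by simp
  moreover have "(3 - s) * y \<le> (3 + s) * y" using s_bounds assms by (intro mult_right_mono) auto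
  ultimately have 2: "2 * (1 - p) < (3 + s) * y" by simp
  have "(3 - s) * y \<le> (3 - 4 * p) * y" using s_bounds assms by (intro mult_right_mono) auto
  with 1 have B: "0 < (3 / 2 - 2 * p) * y - (1 - p)" by (simp add: algebra_simps)
  have "0 < ((3 - s) * y - 2 * (1 - p)) * ((3 + s) * y - 2 * (1 - p)) / 4" using 1 2 by simp
  then have "4 * (p * (1 - p) * y * (1 - y)) < ((3 / 2 - 2 * p) * y - (1 - p))\<^sup>2"
    unfolding quadratic_factor[symmetric] by simp
  then have "sqrt (4 * (p * (1 - p) * y * (1 - y))) < (3 / 2 - 2 * p) * y - (1 - p)"
    using B by (intro real_less_lsqrt) auto
  then have "2 * sqrt (p * (1 - p) * y * (1 - y)) < (3 / 2 - 2 * p) * y - (1 - p)"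
    by (simp add: real_sqrt_mult)
  then show False using assms(3) by (simp add: \<phi>_def algebra_simps)
qed

text \<open>A failure below \<open>y0 p\<close> would place \<open>y\<close> at or below the smaller
  zero, which squaring has introduced. There the isolated side is negative if p > 0; if p = 0, the
  two zeros coincide with \<open>y0 p\<close>.\<close>

lemma less_y0D_small:
  assumes "p < y" "y < y0 p"
  shows "y < 2 * \<phi> p y"
proof (rule ccontr)
  assume "\<not> y < 2 * \<phi> p y"
  then have le: "2 * sqrt (p * (1 - p) * y * (1 - y)) \<le> (3 / 2 - 2 * p) * y - (1 - p)"
    by (simp add: \<phi>_def algebra_simps)
  have y: "0 < y" "y < 1" using assms p y0_bounds_small by auto
  have nonneg: "0 \<le> p * (1 - p) * y * (1 - y)" using p y by simp
  have "(2 * sqrt (p * (1 - p) * y * (1 - y)))\<^sup>2 \<le> ((3 / 2 - 2 * p) * y - (1 - p))\<^sup>2"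
    using le nonneg by (intro power_mono) auto
  then have "0 \<le> ((3 - s) * y - 2 * (1 - p)) * ((3 + s) * y - 2 * (1 - p))"
    using quadratic_factor[of y] nonneg by (simp add: power_mult_distrib)
  moreover have "(3 - s) * y - 2 * (1 - p) < 0" using assms y_le_y0_iff by simp
  ultimately have up: "(3 + s) * y \<le> 2 * (1 - p)" by (simp add: zero_le_mult_iff)
  have "0 \<le> 2 * sqrt (p * (1 - p) * y * (1 - y))" using nonneg by simp
  with le have "0 \<le> (3 / 2 - 2 * p) * y - (1 - p)" by linarith
  then have B: "2 * (1 - p) \<le> (3 - 4 * p) * y" by (simp add: algebra_simps)
  with up have "(3 + s) * y \<le> (3 - 4 * p) * y" by simp
  then have "3 + s \<le> 3 - 4 * p" using y by simp
  then have "p = 0" "s = 0" using s_bounds p by auto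
  with B assms(2)[unfolded y_le_y0_iff(2)] show False by simp
qed

end

lemma y0_bounds:
  assumes "0 \<le> p" "p \<le> 1"
  shows "p \<le> y0 p" "y0 p \<le> 1" "p < 1 \<Longrightarrow> p < y0 p"
proof -
  have "p \<le> y0 p \<and> y0 p \<le> 1 \<and> (p < 1 \<longrightarrow> p < y0 p)"
  proof (cases "p < 1 / 2")
    case True
    then show ?thesis using assms y0_bounds_small[of p] by auto
  next
    case False
    then have "y0 p = 1" by (simp add: y0_def)
    then show ?thesis using assms by simp
  qed
  then show "p \<le> y0 p" "y0 p \<le> 1" "p < 1 \<Longrightarrow> p < y0 p" by auto
qed

text \<open>\<open>y \<le> 2 * \<phi> p y\<close> says that the interval from
  \<open>- \<phi> p y\<close> to \<open>\<phi> p y - y\<close> is nonempty.\<close>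

lemma le_y0I:
  assumes "0 \<le> p" "0 \<le> y" "y \<le> 1" "y \<le> 2 * \<phi> p y"
  shows "y \<le> y0 p"
proof (cases "p < 1 / 2")
  case True
  then show ?thesis using assms le_y0I_small by blast
next
  case False
  then show ?thesis using assms by (simp add: y0_def)
qed

lemma less_y0D:
  assumes "0 \<le> p" "p < y" "y < y0 p"
  shows "y < 2 * \<phi> p y"
proof (cases "p < 1 / 2")
  case True
  then show ?thesis using assms less_y0D_small by blast
next
  case False
  then have y: "y < 1" using assms by (simp add: y0_def)
  have "0 < p * (1 - p) * y * (1 - y)" using assms y False by simp
  then have "0 < sqrt (p * (1 - p) * y * (1 - y))" by simp
  moreover have "(3 - 4 * p) * y \<le> 2 * (1 - p)"
  proof (cases "3 - 4 * p \<le> 0")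
    case True
    then have "(3 - 4 * p) * y \<le> 0" using assms by (intro mult_nonpos_nonneg) auto
    then show ?thesis using assms y by simp
  next
    case F: False
    then have "(3 - 4 * p) * y \<le> (3 - 4 * p) * 1" using y by (intro mult_left_mono) auto
    then show ?thesis using False by simp
  qed
  moreover have "y < 2 * (1 - p - (1 - 2 * p) * y + 2 * S)"
    if "0 < S" "(3 - 4 * p) * y \<le> 2 * (1 - p)" for S
    using that by (simp add: algebra_simps)
  ultimately show ?thesis unfolding \<phi>_def by blast
qed

section \<open>The top half and its supporting half-planes\<close>

definition top_half :: "real \<Rightarrow> (real \<times> real) set" where
  "top_half p = {(x, y). (p \<le> y \<and> y \<le> y0 p \<and> - \<phi> p y \<le> x \<and> x \<le> \<phi> p y - y) \<or>
               (0 \<le> y \<and> y \<le> p \<and> - 1 \<le> x \<and> x \<le> 1 - y)}"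

lemma compact_top_half:
  assumes "0 \<le> p" "p \<le> 1"
  shows "compact (top_half p)"
proof -
  have c: "continuous_on UNIV (\<lambda>z::real \<times> real. \<phi> p (snd z))"
    by (intro continuous_on_compose2[OF continuous_on_\<phi>] continuous_intros) auto
  have "top_half p = {z. (p \<le> snd z \<and> snd z \<le> y0 p \<and> - \<phi> p (snd z) \<le> fst z \<and> fst z \<le> \<phi> p (snd z) - snd z)} \<union>
      {z. 0 \<le> snd z \<and> snd z \<le> p \<and> - 1 \<le> fst z \<and> fst z \<le> 1 - snd z}"
    by (auto simp: top_half_def)
  also have "closed \<dots>"
    using c by (intro closed_Un closed_Collect_conj closed_Collect_le continuous_intros)
  finally have "closed (top_half p)" .
  moreover have "top_half p \<subseteq> {-1..1} \<times> {0..1}"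
  proof
    fix z assume "z \<in> top_half p"
    then obtain x y where z: "z = (x, y)" and "(p \<le> y \<and> y \<le> y0 p \<and> - \<phi> p y \<le> x \<and> x \<le> \<phi> p y - y) \<or>
               (0 \<le> y \<and> y \<le> p \<and> - 1 \<le> x \<and> x \<le> 1 - y)"
      by (auto simp: top_half_def)
    then show "z \<in> {-1..1} \<times> {0..1}"
      using assms y0_bounds[OF assms] \<phi>_le_1[OF assms, of y] by auto
  qed
  then have "bounded (top_half p)"
    by (rule bounded_subset[rotated]) (intro bounded_Times bounded_closed_interval)
  ultimately show ?thesis by (simp add: compact_eq_bounded_closed)
qed

text \<open>The top half is cut out by the half-planes coming from the stationary parameters.\<close>

lemma balanced_minimizer:
  assumes p: "0 \<le> p" "p \<le> 1" and y: "0 \<le> y" "y \<le> 1" and e: "0 < e"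
  obtains v q where "balanced p v q"
    "1 / (1 - q) + y * (v - 1 / (1 - q)) < (if y \<le> p then 1 else \<phi> p y) + e"
proof -
  consider "y \<le> p" | "p = 0" "p < y" | "0 < p" "p < y" "y < 1" | "0 < p" "p < 1" "y = 1"
    using p y by fastforce
  then show thesis
  proof cases
    case 1
    then show thesis using p e by (intro that[of 1 0]) (auto simp: balanced_def)
  next
    case 2
    then show thesis using e by (intro that[of 0 0]) (auto simp: balanced_def \<phi>_def)
  next
    case 3
    define w where "w = sqrt (p * (1 - p) / (y / (1 - y)))"
    define q where "q = p * (1 - (p + w)) / ((p + w) * (1 - p))"
    note w = characteristic_parameter[OF 3, folded w_def]
    have b: "balanced p (p + w) q" "1 / (1 - q) = 1 - p + p * (1 - p) / w"
      using balanced_params[of p w] 3 w unfolding q_def by simp_all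
    have "1 / (1 - q) + y * (p + w - 1 / (1 - q)) = \<phi> p y"
    proof -
      have "E + y * (V - E) = (1 - y) * E + y * V" for E V by (simp add: algebra_simps)
      then show ?thesis unfolding b(2) w(5)[symmetric] .
    qed
    then show thesis using b(1) 3 e by (intro that[of "p + w" q]) auto
  next
    \<comment> \<open>At \<open>y = 1\<close> the bound is \<open>v\<close> itself. Its infimum p is
      not attained, since \<open>w = 0\<close> would mean \<open>q = 1\<close>; this is where the
      slack \<open>e\<close> is spent.\<close>
    case 4
    define w where "w = min (e / 2) (1 - p)"
    define q where "q = p * (1 - (p + w)) / ((p + w) * (1 - p))"
    have w: "0 < w" "w \<le> 1 - p" "w < e" using 4 e by (auto simp: w_def)
    have "balanced p (p + w) q" unfolding q_def using balanced_params(1)[of p w] 4 w by simp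
    then show thesis using 4 w by (intro that[of "p + w" q]) (auto simp: \<phi>_def)
  qed
qed

text \<open>The height limit \<open>y0 p\<close> needs no half-plane of its own: it follows from the
  compatibility of the left and right bounds.\<close>

lemma mem_top_halfI:
  assumes p: "0 \<le> p" "p \<le> 1" and y: "0 \<le> y" "y \<le> 1"
    and le: "\<And>v q. balanced p v q \<Longrightarrow> - x \<le> 1 / (1 - q) + y * (v - 1 / (1 - q)) \<and>
      x + y \<le> 1 / (1 - q) + y * (v - 1 / (1 - q))"
  shows "(x, y) \<in> top_half p"
proof -
  let ?F = "if y \<le> p then 1 else \<phi> p y"
  have "- x \<le> ?F" "x + y \<le> ?F"
  proof -
    have "- x \<le> ?F + e \<and> x + y \<le> ?F + e" if "0 < e" for e
      using balanced_minimizer[OF p y that] le by (metis less_imp_le order_trans)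
    then show "- x \<le> ?F" "x + y \<le> ?F" by (meson field_le_epsilon)+
  qed
  then show ?thesis
    using y le_y0I[OF p(1) y] by (auto simp: top_half_def split: if_splits)
qed

text \<open>Compactness: every point of the box away from the top half violates some constraint with
  room to spare. A finite subcover leaves finitely many half-planes with a common margin, so
  finitely many probabilities can be added. The bound on the height is a separate constraint because
  \<open>mem_top_halfI\<close> asks for \<open>y \<le> 1\<close>.\<close>

lemma half_plane_cover:
  assumes p: "0 \<le> p" "p \<le> 1" and \<epsilon>: "0 < \<epsilon>"
  obtains F \<delta> where "finite F" "0 < \<delta>" "\<And>v q. (v, q) \<in> F \<Longrightarrow> balanced p v q"
    "\<forall>x y. \<bar>x\<bar> \<le> 2 \<and> 0 \<le> y \<and> y \<le> 2 \<and> y \<le> 1 + \<delta> \<and>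
       (\<forall>(v, q)\<in>F. - x \<le> 1 / (1 - q) + y * (v - 1 / (1 - q)) + \<delta> \<and>
         x + y \<le> 1 / (1 - q) + y * (v - 1 / (1 - q)) + \<delta>) \<longrightarrow>
      (\<exists>w\<in>top_half p. dist (x, y) w < \<epsilon>)"
proof -
  define f where "f v q y = 1 / (1 - q) + y * (v - 1 / (1 - q))" for v q y :: real
  define I :: "(real \<times> real \<times> real) set" where "I = {(v, q, \<delta>). balanced p v q \<and> 0 < \<delta>}"
  define U where "U i = (case i of (v, q, \<delta>) \<Rightarrow> {z :: real \<times> real. 1 + \<delta> < snd z} \<union>
     {z. f v q (snd z) + \<delta> < - fst z} \<union> {z. f v q (snd z) + \<delta> < fst z + snd z})" for i
  define K where "K = {-2..2} \<times> {0..2} - (\<Union>w\<in>top_half p. ball w \<epsilon>)"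
  have "compact K"
    unfolding K_def by (intro compact_diff compact_Times compact_Icc open_UN) auto
  moreover have "open (U i)" for i
    unfolding U_def f_def by (cases i) (auto intro!: open_Un open_Collect_less continuous_intros)
  moreover have "K \<subseteq> (\<Union>i\<in>I. U i)"
  proof
    fix z assume z: "z \<in> K"
    obtain x y where xy: "z = (x, y)" by fastforce
    have out: "(x, y) \<notin> top_half p"
    proof
      assume "(x, y) \<in> top_half p"
      then have "z \<in> (\<Union>w\<in>top_half p. ball w \<epsilon>)" using \<epsilon> xy by (intro UN_I[of "(x, y)"]) auto
      then show False using z by (simp add: K_def)
    qed
    have y0: "0 \<le> y" using z xy by (simp add: K_def)
    show "z \<in> (\<Union>i\<in>I. U i)"
    proof (cases "y \<le> 1")
      case False
      have "(1, 0, (y - 1) / 2) \<in> I" using p False by (simp add: I_def balanced_def)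
      moreover have "z \<in> U (1, 0, (y - 1) / 2)" using False xy by (simp add: U_def field_simps)
      ultimately show ?thesis by blast
    next
      case True
      obtain v q where b: "balanced p v q" and "f v q y < - x \<or> f v q y < x + y"
        using mem_top_halfI[OF p y0 True, of x] out unfolding f_def by fastforce
      then consider "f v q y < - x" | "f v q y < x + y" by blast
      then show ?thesis
      proof cases
        case 1
        then have "(v, q, (- x - f v q y) / 2) \<in> I" using b by (simp add: I_def)
        moreover have "z \<in> U (v, q, (- x - f v q y) / 2)"
          using 1 xy by (auto simp: U_def field_simps)
        ultimately show ?thesis by blast
      next
        case 2
        then have "(v, q, (x + y - f v q y) / 2) \<in> I" using b by (simp add: I_def)
        moreover have "z \<in> U (v, q, (x + y - f v q y) / 2)"
          using 2 xy by (auto simp: U_def field_simps)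
        ultimately show ?thesis by blast
      qed
    qed
  qed
  ultimately obtain J where J: "J \<subseteq> I" "finite J" "K \<subseteq> (\<Union>i\<in>J. U i)"
    by (rule compactE_image) auto
  define \<delta> where "\<delta> = Min (insert 1 ((snd \<circ> snd) ` J))"
  have \<delta>: "0 < \<delta>" using J by (auto simp: \<delta>_def I_def)
  have \<delta>_le: "\<delta> \<le> d" if "(v, q, d) \<in> J" for v q d
    unfolding \<delta>_def using J that by (intro Min_le) (auto intro!: image_eqI[of _ _ "(v, q, d)"])
  show thesis
  proof (rule that[of "(\<lambda>(v, q, d). (v, q)) ` J" \<delta>])
    show "balanced p v q" if "(v, q) \<in> (\<lambda>(v, q, d). (v, q)) ` J" for v q
      using that J by (auto simp: I_def)
  next
    show "\<forall>x y. \<bar>x\<bar> \<le> 2 \<and> 0 \<le> y \<and> y \<le> 2 \<and> y \<le> 1 + \<delta> \<and>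
       (\<forall>(v, q)\<in>(\<lambda>(v, q, d). (v, q)) ` J. - x \<le> 1 / (1 - q) + y * (v - 1 / (1 - q)) + \<delta> \<and>
         x + y \<le> 1 / (1 - q) + y * (v - 1 / (1 - q)) + \<delta>) \<longrightarrow>
      (\<exists>w\<in>top_half p. dist (x, y) w < \<epsilon>)"
    proof (intro allI impI, elim conjE)
      fix x y :: real
      assume xy: "\<bar>x\<bar> \<le> 2" "0 \<le> y" "y \<le> 2" "y \<le> 1 + \<delta>"
        and le: "\<forall>(v, q)\<in>(\<lambda>(v, q, d). (v, q)) ` J.
           - x \<le> 1 / (1 - q) + y * (v - 1 / (1 - q)) + \<delta> \<and>
           x + y \<le> 1 / (1 - q) + y * (v - 1 / (1 - q)) + \<delta>"
      have "(x, y) \<notin> U (v, q, d)" if "(v, q, d) \<in> J" for v q d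
      proof -
        have "(v, q) \<in> (\<lambda>(v, q, d). (v, q)) ` J" using that by force
        from bspec[OF le this] show ?thesis using \<delta>_le[OF that] xy(4) by (auto simp: U_def f_def)
      qed
      then have "(x, y) \<notin> K" using J(3) by fastforce
      then have "(x, y) \<in> (\<Union>w\<in>top_half p. ball w \<epsilon>)" using xy by (auto simp: K_def abs_le_iff)
      then show "\<exists>w\<in>top_half p. dist (x, y) w < \<epsilon>" by (auto simp: dist_commute)
    qed
  qed (use J \<delta> in auto)
qed

section \<open>The shape theorem\<close>

definition rescale :: "nat \<Rightarrow> site \<Rightarrow> real \<times> real" where
  "rescale t z = (real_of_int (fst z) / real t, real_of_int (snd z) / real t)"

lemma scaled_eq: "scaled t A = rescale t ` A"
  by (simp add: scaled_def rescale_def case_prod_unfold)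

lemma prob_symmetry:
  assumes "is_symmetry \<sigma>" "finite A"
  shows "measure_pmf.prob (slaw p t A) {B. \<exists>z\<in>B. Q (\<sigma> z)}
    = measure_pmf.prob (slaw p t (\<sigma> ` A)) {B. \<exists>z\<in>B. Q z}"
  unfolding slaw_symmetry[OF assms] by (simp add: vimage_def)

text \<open>The half-plane bound for \<open>A\<close> controls \<open>- x\<close>, and for the
  mirror image of \<open>A\<close> it controls \<open>x + y\<close>. The box of
  \<open>half_plane_cover\<close> comes from the speed limit 1.\<close>

lemma stays_near_top_half:
  assumes p: "0 \<le> p" "p \<le> 1" and A: "finite A" and \<epsilon>: "0 < \<epsilon>"
  shows "expsmall (\<lambda>t. measure_pmf.prob (slaw p t A)
    {B. \<exists>z\<in>B. 0 \<le> snd z \<and> \<not> (\<exists>w\<in>top_half p. dist (rescale t z) w < \<epsilon>)})"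
proof -
  obtain F \<delta> where F: "finite F" "0 < \<delta>" "\<And>v q. (v, q) \<in> F \<Longrightarrow> balanced p v q"
    "\<forall>x y. \<bar>x\<bar> \<le> 2 \<and> 0 \<le> y \<and> y \<le> 2 \<and> y \<le> 1 + \<delta> \<and>
       (\<forall>(v, q)\<in>F. - x \<le> 1 / (1 - q) + y * (v - 1 / (1 - q)) + \<delta> \<and>
         x + y \<le> 1 / (1 - q) + y * (v - 1 / (1 - q)) + \<delta>) \<longrightarrow>
      (\<exists>w\<in>top_half p. dist (x, y) w < \<epsilon>)"
    by (rule half_plane_cover[OF p \<epsilon>]) (rule that; assumption)
  define beyond where "beyond i t z \<longleftrightarrow> (case i of (v, q) \<Rightarrow> 0 \<le> snd z \<and>
     real t * (1 / (1 - q)) + of_int (snd z) * (v - 1 / (1 - q)) + \<delta> * real t \<le> - of_int (fst z))"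
    for i :: "real \<times> real" and t :: nat and z :: site
  have beyond: "expsmall (\<lambda>t. measure_pmf.prob (slaw p t A) {B. \<exists>z\<in>B. beyond i t z})"
    if "finite A" "i \<in> F" for A i
  proof -
    obtain v q where i: "i = (v, q)" by fastforce
    have "(\<exists>z\<in>B. beyond i t z) \<longleftrightarrow> (\<exists>x y. (x, y) \<in> B \<and> 0 \<le> y \<and>
      real t * (1 / (1 - q)) + of_int y * (v - 1 / (1 - q)) + \<delta> * real t \<le> - of_int x)" for B t
      unfolding i beyond_def by force
    then show ?thesis using half_plane_bound[OF F(3)[OF that(2)[unfolded i]] that(1) F(2)] by simp
  qed
  let ?b = "\<lambda>t. \<Sum>i\<in>F. measure_pmf.prob (slaw p t A) {B. \<exists>z\<in>B. beyond i t z} +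
      measure_pmf.prob (slaw p t A) {B. \<exists>z\<in>B. beyond i t (reflect z)}"
  have "expsmall ?b"
    using A by (intro expsmall_sum F(1) expsmall_add beyond)
      (simp_all add: prob_symmetry[OF is_symmetry_reflect] beyond)
  moreover have "\<forall>\<^sub>F t in sequentially. measure_pmf.prob (slaw p t A)
    {B. \<exists>z\<in>B. 0 \<le> snd z \<and> \<not> (\<exists>w\<in>top_half p. dist (rescale t z) w < \<epsilon>)} \<le> ?b t"
  proof -
    let ?K = "\<Sum>z\<in>A. \<bar>fst z\<bar> + \<bar>snd z\<bar>"
    have k: "\<bar>x\<bar> \<le> ?K \<and> \<bar>y\<bar> \<le> ?K" if "(x, y) \<in> A" for x y
      using member_le_sum[of "(x, y)" A "\<lambda>z. \<bar>fst z\<bar> + \<bar>snd z\<bar>"] A that by auto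
    have "(\<lambda>t. real_of_int ?K / real t) \<longlonglongrightarrow> 0" by (rule lim_const_over_n)
    then have "\<forall>\<^sub>F t in sequentially. real_of_int ?K / real t < min \<delta> 1"
      by (rule order_tendstoD) (use F(2) in simp)
    then show ?thesis
      using eventually_gt_at_top[of 0]
    proof eventually_elim
      case (elim t)
      have K: "real_of_int ?K \<le> \<delta> * real t" "real_of_int ?K \<le> real t"
        using elim by (simp_all add: pos_divide_less_eq)
      have "measure_pmf.prob (slaw p t A)
          {B. \<exists>z\<in>B. 0 \<le> snd z \<and> \<not> (\<exists>w\<in>top_half p. dist (rescale t z) w < \<epsilon>)}
        \<le> measure_pmf.prob (slaw p t A) (\<Union>i\<in>F. {B. \<exists>z\<in>B. beyond i t z} \<union> {B. \<exists>z\<in>B. beyond i t (reflect z)})"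
      proof (rule prob_mono_pmf, elim CollectE bexE conjE, rule ccontr)
        fix B z assume B: "B \<in> set_pmf (slaw p t A)" "z \<in> B" and z: "0 \<le> snd z"
          and far: "\<not> (\<exists>w\<in>top_half p. dist (rescale t z) w < \<epsilon>)"
          and n: "B \<notin> (\<Union>i\<in>F. {B. \<exists>z\<in>B. beyond i t z} \<union> {B. \<exists>z\<in>B. beyond i t (reflect z)})"
        obtain x y where xy: "z = (x, y)" by fastforce
        define X Y where "X = real_of_int x / real t" and "Y = real_of_int y / real t"
        have XY: "real_of_int x = X * real t" "real_of_int y = Y * real t"
          using elim by (simp_all add: X_def Y_def)
        have "\<bar>x\<bar> \<le> ?K + int t" "\<bar>y\<bar> \<le> ?K + int t"
          using slaw_bounded[OF k B(1), of x y] B(2) xy by auto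
        then have "\<bar>real_of_int x\<bar> \<le> real_of_int ?K + real t" "\<bar>real_of_int y\<bar> \<le> real_of_int ?K + real t"
          by linarith+
        then have "\<bar>X\<bar> * real t \<le> real_of_int ?K + real t" "\<bar>Y\<bar> * real t \<le> real_of_int ?K + real t"
          unfolding XY by (simp_all only: abs_mult abs_of_nat)
        moreover have "Y * real t \<le> \<bar>Y\<bar> * real t" by (intro mult_right_mono) auto
        ultimately have abs: "\<bar>X\<bar> * real t \<le> real_of_int ?K + real t" "Y * real t \<le> real_of_int ?K + real t"
          by linarith+
        have box: "\<bar>X\<bar> \<le> 2" "Y \<le> 2" "Y \<le> 1 + \<delta>" "0 \<le> Y"
        proof -
          have "\<bar>X\<bar> * real t \<le> 2 * real t" "Y * real t \<le> 2 * real t" "Y * real t \<le> (1 + \<delta>) * real t"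
            using abs K unfolding distrib_right by linarith+
          then show "\<bar>X\<bar> \<le> 2" "Y \<le> 2" "Y \<le> 1 + \<delta>" using elim by auto
          show "0 \<le> Y" using z xy by (simp add: Y_def)
        qed
        have "\<exists>w\<in>top_half p. dist (X, Y) w < \<epsilon>"
        proof (intro F(4)[rule_format] conjI box; clarify)
          fix v q assume i: "(v, q) \<in> F"
          let ?f = "1 / (1 - q) + Y * (v - 1 / (1 - q)) + \<delta>"
          have nb: "\<not> beyond (v, q) t z" "\<not> beyond (v, q) t (reflect z)" using n i B(2) by blast+
          have "- X * real t \<le> ?f * real t" "(X + Y) * real t \<le> ?f * real t"
            using nb z xy by (simp_all add: beyond_def reflect_def XY algebra_simps)
          then show "- X \<le> ?f \<and> X + Y \<le> ?f" using elim by (simp only: mult_le_cancel_right_pos of_nat_0_less_iff)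
        qed
        then show False using far xy by (simp add: rescale_def X_def Y_def)
      qed
      also have "\<dots> \<le> ?b t"
        by (rule order_trans[OF prob_UN_le[OF F(1)]]) (intro sum_mono prob_Un_le)
      finally show ?case .
    qed
  qed
  ultimately show ?thesis by (rule expsmall_mono)
qed

lemma row_speed_below_\<phi>:
  assumes "0 \<le> p" "p < a" "a < 1" "\<kappa> < \<phi> p a"
  shows "row_speed p a \<kappa>"
proof (cases "p = 0")
  case True
  then show ?thesis using assms by (auto simp: \<phi>_def intro: row_speed_0)
qed (use assms row_speed_interior in auto)

text \<open>Heights up to p are to be reached at full speed. A slope just above p has speed close to
  \<phi>(p) = 1 and can be diluted by horizontal growth. At p = 1 the deterministic slope 1 takes
  its place.\<close>

lemma near_speed_one:
  assumes p: "0 \<le> p" "p \<le> 1" and e: "0 < e"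
  obtains a \<kappa> where "row_speed p a \<kappa>" "p \<le> a" "0 < a" "a \<le> 1" "a < 2 * \<kappa>" "\<kappa> \<le> 1" "1 - \<kappa> < e"
proof (cases "p < 1")
  case False
  then show thesis using p e row_speed_1[of 1 1] by (intro that[of 1 1]) auto
next
  case True
  have "(\<phi> p \<longlongrightarrow> \<phi> p p) (at_right p)"
    using continuous_on_\<phi>[of p] by (auto simp: continuous_on_def intro: tendsto_within_subset)
  then have "\<forall>\<^sub>F a in at_right p. 1 - e < \<phi> p a"
    by (rule order_tendstoD) (simp add: \<phi>_p p e)
  moreover have "\<forall>\<^sub>F a in at_right p. a \<in> {p<..<y0 p}"
    using y0_bounds(3)[OF p True] by (rule eventually_at_right_real)
  ultimately have "\<forall>\<^sub>F a in at_right p. 1 - e < \<phi> p a \<and> a \<in> {p<..<y0 p}"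
    by eventually_elim simp
  from eventually_happens'[OF trivial_limit_at_right_real this]
  obtain a where a: "1 - e < \<phi> p a" "p < a" "a < y0 p" by auto
  have "a / 2 < \<phi> p a" using less_y0D[OF p(1) a(2,3)] by simp
  then obtain \<kappa> where \<kappa>: "max (1 - e) (a / 2) < \<kappa>" "\<kappa> < \<phi> p a"
    using a(1) dense[of "max (1 - e) (a / 2)" "\<phi> p a"] by auto
  have a1: "a < 1" using a(3) y0_bounds(2)[OF p] by simp
  have "\<phi> p a \<le> 1" using p a a1 by (intro \<phi>_le_1) auto
  then show thesis
    using p a a1 \<kappa> by (intro that[of a \<kappa>] row_speed_below_\<phi>) auto
qed

lemma clamp_dist:
  fixes x l r e :: real
  assumes "l \<le> r" "l - e \<le> x" "x \<le> r + e" "0 \<le> e"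
  shows "\<exists>x'\<ge>l. x' \<le> r \<and> \<bar>x' - x\<bar> \<le> e"
  using assms by (intro exI[of _ "max l (min r x)"]) (auto simp: max_def min_def abs_if)

lemma top_half_approx:
  assumes p: "0 \<le> p" "p \<le> 1" and xy: "(x, y) \<in> top_half p" and \<epsilon>: "0 < \<epsilon>"
  obtains a \<kappa> \<theta> x' where "row_speed p a \<kappa>" "0 \<le> a" "a \<le> 1" "a < 2 * \<kappa>" "\<kappa> \<le> 1" "0 < \<theta>" "\<theta> \<le> 1"
    "- (1 - \<theta>) - \<theta> * \<kappa> \<le> x'" "x' \<le> (1 - \<theta>) + \<theta> * (\<kappa> - a)" "dist (x', \<theta> * a) (x, y) < \<epsilon>"
proof (cases "y \<le> p")
  case True
  define e where "e = min 1 (\<epsilon> / 4)"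
  have e: "0 < e" "e \<le> 1" "e \<le> \<epsilon> / 4" using \<epsilon> by (simp_all add: e_def)
  obtain a \<kappa> where a: "row_speed p a \<kappa>" "p \<le> a" "0 < a" "a \<le> 1" "a < 2 * \<kappa>" "\<kappa> \<le> 1" "1 - \<kappa> < e"
    using near_speed_one[OF p e(1)] by blast
  have xy': "0 \<le> y" "- 1 \<le> x" "x \<le> 1 - y"
    using xy True p \<phi>_p[OF p] by (auto simp: top_half_def)
  \<comment> \<open>The share \<open>y / a\<close> of climbing leads to height \<open>y\<close>; the
    maximum keeps it positive when \<open>y = 0\<close>.\<close>
  define \<theta> where "\<theta> = max (y / a) e"
  have \<theta>: "0 < \<theta>" "\<theta> \<le> 1" using e a True by (auto simp: \<theta>_def)
  have \<theta>a: "y \<le> \<theta> * a" "\<theta> * a \<le> y + e"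
  proof -
    have "(y / a) * a \<le> \<theta> * a" using a by (intro mult_right_mono) (auto simp: \<theta>_def)
    then show "y \<le> \<theta> * a" using a by simp
    have "\<theta> * a = max y (e * a)" using a by (simp add: \<theta>_def max_mult_distrib_right)
    moreover have "e * a \<le> e * 1" using a e by (intro mult_left_mono) auto
    then have "e * a \<le> y + e" using xy' by linarith
    ultimately show "\<theta> * a \<le> y + e" using e by simp
  qed
  have \<theta>\<kappa>: "0 \<le> \<theta> * (1 - \<kappa>)" "\<theta> * (1 - \<kappa>) \<le> 1 - \<kappa>"
    using \<theta> a mult_right_mono[of \<theta> 1 "1 - \<kappa>"] by auto
  have "0 \<le> \<theta> * (2 * \<kappa> - a)" using \<theta> a by (intro mult_nonneg_nonneg) auto
  moreover have "\<theta> * (2 * \<kappa> - a) = \<theta> * \<kappa> + \<theta> * (\<kappa> - a)" by (simp add: algebra_simps)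
  ultimately have "- (1 - \<theta>) - \<theta> * \<kappa> \<le> (1 - \<theta>) + \<theta> * (\<kappa> - a)" using \<theta> by linarith
  then have "\<exists>x'\<ge>- (1 - \<theta>) - \<theta> * \<kappa>. x' \<le> (1 - \<theta>) + \<theta> * (\<kappa> - a) \<and> \<bar>x' - x\<bar> \<le> 2 * e"
  proof (rule clamp_dist)
    show "- (1 - \<theta>) - \<theta> * \<kappa> - 2 * e \<le> x" using xy' \<theta>\<kappa> a e by (simp add: algebra_simps)
    show "x \<le> (1 - \<theta>) + \<theta> * (\<kappa> - a) + 2 * e" using xy' \<theta>\<kappa> \<theta>a a by (simp add: algebra_simps)
  qed (use e in simp)
  then obtain x' where x': "- (1 - \<theta>) - \<theta> * \<kappa> \<le> x'" "x' \<le> (1 - \<theta>) + \<theta> * (\<kappa> - a)" "\<bar>x' - x\<bar> \<le> 2 * e"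
    by blast
  have "dist (x', \<theta> * a) (x, y) \<le> \<bar>x' - x\<bar> + \<bar>\<theta> * a - y\<bar>" by (rule dist_le_sum_abs)
  also have "\<dots> \<le> 3 * e" using x' \<theta>a by simp
  also have "\<dots> < \<epsilon>" using e \<epsilon> by simp
  finally show thesis using a \<theta> x' by (intro that[of a \<kappa> \<theta> x']) auto
next
  case False
  then have xy': "p < y" "y \<le> y0 p" "- \<phi> p y \<le> x" "x \<le> \<phi> p y - y"
    using xy by (auto simp: top_half_def)
  define e where "e = \<epsilon> / 4"
  have e: "0 < e" using \<epsilon> by (simp add: e_def)
  \<comment> \<open>A slope slightly below \<open>y\<close> stays strictly below
    \<open>y0 p\<close>, so that the strict inequality required for the blocks is available even at
    \<open>y = y0 p\<close>.\<close>
  have "(\<phi> p \<longlongrightarrow> \<phi> p y) (at_left y)"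
    using continuous_on_\<phi>[of p] by (auto simp: continuous_on_def intro: tendsto_within_subset)
  then have "\<forall>\<^sub>F a in at_left y. dist (\<phi> p a) (\<phi> p y) < e / 2" using e by (intro tendstoD) auto
  moreover have "\<forall>\<^sub>F a in at_left y. a \<in> {max p (y - e / 2)<..<y}"
    using xy' e by (intro eventually_at_left_real) auto
  ultimately have "\<forall>\<^sub>F a in at_left y. dist (\<phi> p a) (\<phi> p y) < e / 2 \<and> a \<in> {max p (y - e / 2)<..<y}"
    by eventually_elim simp
  from eventually_happens'[OF trivial_limit_at_left_real this]
  obtain a where a: "dist (\<phi> p a) (\<phi> p y) < e / 2" "p < a" "y - e / 2 < a" "a < y" by auto
  have a1: "0 \<le> a" "a < 1" using a xy' p y0_bounds(2)[OF p] by auto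
  have "a / 2 < \<phi> p a" using less_y0D[OF p(1) a(2)] a xy' by simp
  then obtain \<kappa> where \<kappa>: "max (\<phi> p a - e / 2) (a / 2) < \<kappa>" "\<kappa> < \<phi> p a"
    using e dense[of "max (\<phi> p a - e / 2) (a / 2)" "\<phi> p a"] by auto
  have \<phi>: "\<phi> p a \<le> 1" using p a1 by (intro \<phi>_le_1) auto
  have near: "\<phi> p y < \<phi> p a + e / 2" using a(1) by (simp add: dist_real_def abs_if split: if_splits)
  have "- \<kappa> \<le> \<kappa> - a" "- \<kappa> - 2 * e \<le> x" "x \<le> (\<kappa> - a) + 2 * e"
    using \<kappa> near xy' a e by auto
  from clamp_dist[OF this] e obtain x' where x': "- \<kappa> \<le> x'" "x' \<le> \<kappa> - a" "\<bar>x' - x\<bar> \<le> 2 * e"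
    by auto
  have "dist (x', 1 * a) (x, y) \<le> \<bar>x' - x\<bar> + \<bar>1 * a - y\<bar>" by (rule dist_le_sum_abs)
  also have "\<dots> \<le> 3 * e" using x' a e by simp
  also have "\<dots> < \<epsilon>" using \<epsilon> by (simp add: e_def)
  finally show thesis
    using a a1 \<kappa> \<phi> x' p by (intro that[of a \<kappa> 1 x'] row_speed_below_\<phi>) auto
qed

lemma reaches_top_half:
  assumes p: "0 \<le> p" "p \<le> 1" and w: "w \<in> top_half p" and \<epsilon>: "0 < \<epsilon>" and A: "finite A" "A \<noteq> {}"
  shows "expsmall (\<lambda>t. measure_pmf.prob (slaw p t A) {B. \<forall>z\<in>B. \<not> dist (rescale t z) w < \<epsilon>})"
proof -
  obtain x y where xy: "w = (x, y)" by fastforce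
  obtain a \<kappa> \<theta> x' where a: "row_speed p a \<kappa>" "0 \<le> a" "a \<le> 1" "a < 2 * \<kappa>" "\<kappa> \<le> 1" "0 < \<theta>" "\<theta> \<le> 1"
    "- (1 - \<theta>) - \<theta> * \<kappa> \<le> x'" "x' \<le> (1 - \<theta>) + \<theta> * (\<kappa> - a)" "dist (x', \<theta> * a) (x, y) < \<epsilon> / 2"
    using top_half_approx[OF p w[unfolded xy], of "\<epsilon> / 2"] \<epsilon> by (metis half_gt_zero)
  have "expsmall (\<lambda>t. measure_pmf.prob (slaw p t A) {B. scaled t B \<inter> ball (x', \<theta> * a) (\<epsilon> / 2) = {}})"
    using a A \<epsilon> by (intro point_reached) auto
  then show ?thesis
  proof (rule expsmall_mono, intro always_eventually allI prob_mono_pmf, elim CollectE, intro CollectI)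
    fix t B assume far: "\<forall>z\<in>B. \<not> dist (rescale t z) w < \<epsilon>"
    have "dist (rescale t z) w < \<epsilon>" if "rescale t z \<in> ball (x', \<theta> * a) (\<epsilon> / 2)" for z
    proof -
      have "dist (rescale t z) w \<le> dist (rescale t z) (x', \<theta> * a) + dist (x', \<theta> * a) w"
        by (rule dist_triangle)
      then show ?thesis using that a(10) xy by (simp add: dist_commute)
    qed
    with far show "scaled t B \<inter> ball (x', \<theta> * a) (\<epsilon> / 2) = {}"
      unfolding scaled_eq by blast
  qed
qed

section \<open>Almost sure Hausdorff convergence\<close>

lemma hausdorff_distance_le:
  assumes "\<And>a. a \<in> S \<Longrightarrow> \<exists>b\<in>T. dist a b < \<epsilon>" "\<And>b. b \<in> T \<Longrightarrow> \<exists>a\<in>S. dist a b < \<epsilon>"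
  shows "hausdorff_distance S T \<le> ennreal \<epsilon>"
  unfolding hausdorff_distance_def
proof (intro max.boundedI SUP_least)
  fix a assume "a \<in> S"
  then obtain b where "b \<in> T" "dist a b < \<epsilon>" using assms(1) by blast
  then show "(INF b\<in>T. ennreal (dist a b)) \<le> ennreal \<epsilon>" by (intro INF_lower2[of b] ennreal_leI) auto
next
  fix b assume "b \<in> T"
  then obtain a where "a \<in> S" "dist a b < \<epsilon>" using assms(2) by blast
  then show "(INF a\<in>S. ennreal (dist a b)) \<le> ennreal \<epsilon>" by (intro INF_lower2[of a] ennreal_leI) auto
qed

lemma fills_space_nonempty:
  assumes "fills_space hex_nbhd (hex_rule p) A"
  shows "A \<noteq> {}"
proof
  assume "A = {}"
  have "det_step hex_nbhd (hex_rule p) {} = {}"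
    by (simp add: det_step_def det_rule_def hex_rule_def)
  then have "(det_step hex_nbhd (hex_rule p) ^^ t) {} = {}" for t by (induction t) auto
  then show False using assms \<open>A = {}\<close> by (simp add: fills_space_def)
qed

lemma rescale_uminus: "rescale t (- z) = - rescale t z"
  by (simp add: rescale_def)

lemma dist_uminus_uminus: "dist (- a) (- b) = dist a (b :: 'a :: real_normed_vector)"
  by (metis dist_minus minus_minus)

text \<open>The lower half is the upper half of the dynamics started from the negated set. A finite
  net of the top half with mesh \<open>\<epsilon> / 2\<close> reduces the points to be approached to
  finitely many.\<close>

lemma eventually_close_to_shape:
  assumes p: "0 \<le> p" "p \<le> 1" and A0: "finite A0" "A0 \<noteq> {}"
    and growth: "growth_process hex_nbhd (hex_rule p) A0 M A" and \<epsilon>: "0 < \<epsilon>"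
  defines "L \<equiv> top_half p \<union> uminus ` top_half p"
  shows "AE \<omega> in M. \<forall>\<^sub>F t in sequentially. hausdorff_distance (scaled t (A t \<omega>)) L \<le> ennreal \<epsilon>"
proof -
  note avoids = growth_eventually_avoids[OF p A0(1) growth]
  note meets = growth_eventually_meets[OF p A0(1) growth]
  define far where "far t z \<longleftrightarrow> 0 \<le> snd z \<and> \<not> (\<exists>w\<in>top_half p. dist (rescale t z) w < \<epsilon>)" for t z
  have "expsmall (\<lambda>t. measure_pmf.prob (slaw p t B) {S. \<exists>z\<in>S. far t z})" if "finite B" for B
    unfolding far_def using stays_near_top_half[OF p that \<epsilon>] .
  from this[OF A0(1)] this[of "uminus ` A0"]
  have "expsmall (\<lambda>t. measure_pmf.prob (slaw p t A0) {S. \<exists>z\<in>S. far t z})"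
    "expsmall (\<lambda>t. measure_pmf.prob (slaw p t A0) {S. \<exists>z\<in>S. far t (- z)})"
    using A0(1) by (simp_all add: prob_symmetry[OF is_symmetry_uminus])
  then have "expsmall (\<lambda>t. measure_pmf.prob (slaw p t A0) {S. \<exists>z\<in>{z. far t z}. z \<in> S})"
    "expsmall (\<lambda>t. measure_pmf.prob (slaw p t A0) {S. \<exists>z\<in>{z. far t (- z)}. z \<in> S})"
    by (simp_all add: Bex_def conj_commute)
  note up = avoids[OF this(1)] avoids[OF this(2)]
  obtain W where W: "finite W" "W \<subseteq> top_half p" "top_half p \<subseteq> (\<Union>w\<in>W. ball w (\<epsilon> / 2))"
    using compactE_image[OF compact_top_half[OF p], of "top_half p" "\<lambda>w. ball w (\<epsilon> / 2)"] \<epsilon>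
    by (metis UN_I centre_in_ball half_gt_zero open_ball subsetI)
  have reach: "expsmall (\<lambda>t. measure_pmf.prob (slaw p t B) {S. \<forall>z\<in>S. \<not> dist (rescale t z) w < \<epsilon> / 2})"
    if "finite B" "B \<noteq> {}" "w \<in> W" for B w
    using that W \<epsilon> by (intro reaches_top_half p) auto
  have "AE \<omega> in M. \<forall>w\<in>W. \<forall>\<^sub>F t in sequentially. \<exists>z\<in>{z. dist (rescale t z) w < \<epsilon> / 2}. z \<in> A t \<omega>"
  proof (rule AE_finite_allI[OF W(1)])
    fix w assume w: "w \<in> W"
    have "expsmall (\<lambda>t. measure_pmf.prob (slaw p t A0) {S. \<forall>z\<in>{z. dist (rescale t z) w < \<epsilon> / 2}. z \<notin> S})"
      by (rule expsmall_mono[OF reach[OF A0 w]]) (auto intro!: always_eventually prob_mono_pmf)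
    then show "AE \<omega> in M. \<forall>\<^sub>F t in sequentially. \<exists>z\<in>{z. dist (rescale t z) w < \<epsilon> / 2}. z \<in> A t \<omega>"
      by (rule meets)
  qed
  moreover have "AE \<omega> in M. \<forall>w\<in>W. \<forall>\<^sub>F t in sequentially. \<exists>z\<in>{z. dist (rescale t (- z)) w < \<epsilon> / 2}. z \<in> A t \<omega>"
  proof (rule AE_finite_allI[OF W(1)])
    fix w assume w: "w \<in> W"
    have "measure_pmf.prob (slaw p t A0) {S. \<forall>z\<in>{z. dist (rescale t (- z)) w < \<epsilon> / 2}. z \<notin> S}
      \<le> measure_pmf.prob (slaw p t (uminus ` A0)) {S. \<forall>z\<in>S. \<not> dist (rescale t z) w < \<epsilon> / 2}" for t
      unfolding slaw_symmetry[OF is_symmetry_uminus A0(1)] measure_map_pmf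
      by (rule prob_mono_pmf) auto
    then have "expsmall (\<lambda>t. measure_pmf.prob (slaw p t A0) {S. \<forall>z\<in>{z. dist (rescale t (- z)) w < \<epsilon> / 2}. z \<notin> S})"
      using A0 w by (intro expsmall_mono[OF reach[of "uminus ` A0" w]] always_eventually) auto
    then show "AE \<omega> in M. \<forall>\<^sub>F t in sequentially. \<exists>z\<in>{z. dist (rescale t (- z)) w < \<epsilon> / 2}. z \<in> A t \<omega>"
      by (rule meets)
  qed
  ultimately show ?thesis
    using up
  proof eventually_elim
    case (elim \<omega>)
    have "\<forall>\<^sub>F t in sequentially. \<forall>w\<in>W. \<exists>z\<in>A t \<omega>. dist (rescale t z) w < \<epsilon> / 2"
      by (intro eventually_ball_finite[OF W(1)] ballI, drule elim(1)[rule_format])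
         (blast intro: eventually_mono)
    moreover have "\<forall>\<^sub>F t in sequentially. \<forall>w\<in>W. \<exists>z\<in>A t \<omega>. dist (rescale t (- z)) w < \<epsilon> / 2"
      by (intro eventually_ball_finite[OF W(1)] ballI, drule elim(2)[rule_format])
         (blast intro: eventually_mono)
    ultimately show ?case
      using elim(3,4)
    proof eventually_elim
      case t: (elim t)
      show ?case
      proof (rule hausdorff_distance_le)
        fix a assume "a \<in> scaled t (A t \<omega>)"
        then obtain z where z: "z \<in> A t \<omega>" "a = rescale t z" by (auto simp: scaled_eq)
        show "\<exists>b\<in>L. dist a b < \<epsilon>"
        proof (cases "0 \<le> snd z")
          case True
          moreover have "\<not> far t z" using t(3) z(1) by blast
          ultimately show ?thesis unfolding far_def L_def z(2) by blast
        next
          case False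
          then have "0 \<le> snd (- z)" by simp
          moreover have "\<not> far t (- z)" using t(4) z(1) by blast
          ultimately obtain w where w: "w \<in> top_half p" "dist (rescale t (- z)) w < \<epsilon>"
            unfolding far_def by blast
          then have "dist a (- w) < \<epsilon>"
            using dist_uminus_uminus[of a "- w"] z by (simp add: rescale_uminus)
          then show ?thesis using w(1) unfolding L_def by blast
        qed
      next
        have near: "\<exists>v\<in>W. dist v w < \<epsilon> / 2" if "w \<in> top_half p" for w
          using subsetD[OF W(3) that] by auto
        fix b assume "b \<in> L"
        then consider "b \<in> top_half p" | w where "w \<in> top_half p" "b = - w" by (auto simp: L_def)
        then show "\<exists>a\<in>scaled t (A t \<omega>). dist a b < \<epsilon>"
        proof cases
          case 1
          then obtain v where v: "v \<in> W" "dist v b < \<epsilon> / 2" using near by blast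
          then obtain z where z: "z \<in> A t \<omega>" "dist (rescale t z) v < \<epsilon> / 2" using t(1) by blast
          have "dist (rescale t z) b < \<epsilon>"
            using v(2) z(2) dist_triangle[of "rescale t z" b v] by simp
          then show ?thesis using z(1) by (auto simp: scaled_eq)
        next
          case 2
          then obtain v where v: "v \<in> W" "dist v w < \<epsilon> / 2" using near by blast
          then obtain z where z: "z \<in> A t \<omega>" "dist (rescale t (- z)) v < \<epsilon> / 2" using t(2) by blast
          have "dist (rescale t (- z)) w < \<epsilon>"
            using v(2) z(2) dist_triangle[of "rescale t (- z)" w v] by simp
          then have "dist (rescale t z) b < \<epsilon>"
            using dist_uminus_uminus[of "rescale t z" b] 2 by (simp add: rescale_uminus)
          then show ?thesis using z(1) by (auto simp: scaled_eq)
        qed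
      qed
    qed
  qed
qed

text \<open>Countably many thresholds suffice, so only countably many null sets have to be
  united.\<close>

lemma ennreal_tendsto_0I:
  fixes f :: "nat \<Rightarrow> ennreal"
  assumes "\<And>n. \<forall>\<^sub>F t in sequentially. f t \<le> ennreal (1 / real (Suc n))"
  shows "f \<longlonglongrightarrow> 0"
proof (rule order_tendstoI)
  fix a :: ennreal assume "0 < a"
  then obtain b where b: "0 < b" "b < a" using dense by blast
  from b(2) have fin: "b < top" by (rule less_le_trans) simp
  obtain r where r: "b = ennreal r" "0 \<le> r" using fin by (cases b) auto
  then have "0 < r" using b by (simp add: ennreal_less_zero_iff)
  then obtain n where n: "1 / real (Suc n) < r"
    using reals_Archimedean[of r] by (auto simp: inverse_eq_divide)
  have "ennreal (1 / real (Suc n)) \<le> b" unfolding r(1) using n by (intro ennreal_leI) auto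
  then show "\<forall>\<^sub>F t in sequentially. f t < a"
    using assms[of n] b(2) by (auto elim!: eventually_mono)
qed simp

theorem mainTheorem6:
  fixes p :: real
  assumes "0 \<le> p" and "p \<le> 1"
  shows "\<exists>L. has_asymptotic_shape TYPE('w) hex_nbhd (hex_rule p) L \<and>
    uminus ` L = L \<and>
    L \<inter> {(x, y). y \<ge> 0} =
      {(x, y). (p \<le> y \<and> y \<le> y0 p \<and> - \<phi> p y \<le> x \<and> x \<le> \<phi> p y - y) \<or>
               (0 \<le> y \<and> y \<le> p \<and> - 1 \<le> x \<and> x \<le> 1 - y)}"
proof (intro exI conjI)
  let ?L = "top_half p \<union> uminus ` top_half p"
  have nonneg: "0 \<le> y" if "(x, y) \<in> top_half p" for x y
    using that assms by (auto simp: top_half_def)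
  \<comment> \<open>The top half and its negative meet only at height 0, where the slice from -1 to
    1 is symmetric.\<close>
  have axis: "(x, 0) \<in> top_half p \<longleftrightarrow> - 1 \<le> x \<and> x \<le> 1" for x
    using assms \<phi>_p[of 0] by (auto simp: top_half_def)
  have "compact ?L"
    using compact_top_half[OF assms] by (intro compact_Un compact_negations)
  moreover have "?L \<noteq> {}" using axis[of 0] by auto
  moreover have "AE \<omega> in M. (\<lambda>t. hausdorff_distance (scaled t (A t \<omega>)) ?L) \<longlonglongrightarrow> 0"
    if "finite A0" "fills_space hex_nbhd (hex_rule p) A0" "growth_process hex_nbhd (hex_rule p) A0 M A"
    for A0 and M :: "'w measure" and A
  proof -
    have "AE \<omega> in M. \<forall>n. \<forall>\<^sub>F t in sequentially.
        hausdorff_distance (scaled t (A t \<omega>)) ?L \<le> ennreal (1 / real (Suc n))"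
      unfolding AE_all_countable
      using eventually_close_to_shape[OF assms that(1) fills_space_nonempty[OF that(2)] that(3)] by simp
    then show ?thesis by eventually_elim (auto intro: ennreal_tendsto_0I)
  qed
  ultimately show "has_asymptotic_shape TYPE('w) hex_nbhd (hex_rule p) ?L"
    unfolding has_asymptotic_shape_def by blast
  show "uminus ` ?L = ?L" by (auto simp: image_Un image_image)
  have "?L \<inter> {(x, y). y \<ge> 0} = top_half p"
  proof (intro set_eqI iffI)
    fix z assume z: "z \<in> ?L \<inter> {(x, y). y \<ge> 0}"
    obtain x y where xy: "z = (x, y)" by fastforce
    show "z \<in> top_half p"
    proof (cases "z \<in> top_half p")
      case False
      then have m: "(- x, - y) \<in> top_half p" using z xy by auto
      then have "y = 0" using nonneg[OF m] z xy by simp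
      then show ?thesis using m axis[of "- x"] axis[of x] xy by auto
    qed
  qed (use nonneg in auto)
  then show "?L \<inter> {(x, y). y \<ge> 0} =
      {(x, y). (p \<le> y \<and> y \<le> y0 p \<and> - \<phi> p y \<le> x \<and> x \<le> \<phi> p y - y) \<or>
               (0 \<le> y \<and> y \<le> p \<and> - 1 \<le> x \<and> x \<le> 1 - y)}"
    unfolding top_half_def .
qed

end
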